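(* Let $n\ge 1$, let $\psi:\mathbb{R}^n\to[0,\infty)$ be a locally integrable radial function and let $$I=\int_{\mathbb{R}^n}\frac{\psi(x)}{(1+|x|)^{n+1}}\,dx .$$ (a) Let $f\in L^2(\mathbb{R}^n)$ be a function for which there is a constant $C$ such that $$|\widehat f(y)|\le C e^{-\psi(y)}\quad\text{for almost every } y\in\mathbb{R}^n. \qquad ( * )$$ Suppose $\mathrm{supp}\, f\subset\{x\in\mathbb{R}^n : x\cdot\eta\le t\}$ for some $\eta\in S^{n-1}$ and some $t\in\mathbb{R}$. If $I=\infty$, then $f(x)=0$ for almost every $x\in\mathbb{R}^n$. (b) If $I$ is finite and $\psi$ is nondecreasing, then given any $l>0$ there exists a nontrivial $f\in C_c^\infty(\mathbb{R}^n)$ supported in the ball $B(0,l)$ and satisfying $( * )$ for some constant $C$.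
   Context: The Fourier transform is $\widehat f(y)=\int_{\mathbb{R}^n}f(x)e^{-2\pi i x\cdot y}\,dx$ for $f\in L^1(\mathbb{R}^n)$, extended to $L^2(\mathbb{R}^n)$ by Plancherel. A radial function $\psi$ is called nondecreasing if $\psi(x)$ is a nondecreasing function of $|x|$. $B(0,l)$ is the ball of radius $l$ centred at $0$. The support of an $L^2$ function is its essential support. *)

theory Defs
  imports "HOL-Analysis.Analysis"
begin

definition locally_integrable :: "(real^'n \<Rightarrow> real) \<Rightarrow> bool" where
  "locally_integrable \<psi> \<longleftrightarrow> (\<forall>K. compact K \<longrightarrow> set_integrable lebesgue K \<psi>)"

definition radial :: "(real^'n \<Rightarrow> real) \<Rightarrow> bool" where
  "radial \<psi> \<longleftrightarrow> (\<forall>x y. norm x = norm y \<longrightarrow> \<psi> x = \<psi> y)"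

definition radially_nondecreasing :: "(real^'n \<Rightarrow> real) \<Rightarrow> bool" where
  "radially_nondecreasing \<psi> \<longleftrightarrow> (\<forall>x y. norm x \<le> norm y \<longrightarrow> \<psi> x \<le> \<psi> y)"

text \<open>The integral of a nonnegative function, with value in \<open>[0,\<infinity>]\<close>; here \<open>n = CARD('n)\<close>.\<close>
definition weighted_integral :: "(real^'n \<Rightarrow> real) \<Rightarrow> ennreal" where
  "weighted_integral \<psi> = (\<integral>\<^sup>+ x. ennreal (\<psi> x / (1 + norm x) ^ (CARD('n) + 1)) \<partial>lebesgue)"

definition square_integrable :: "(real^'n \<Rightarrow> complex) \<Rightarrow> bool" where
  "square_integrable f \<longleftrightarrow>
     f \<in> borel_measurable lebesgue \<and> integrable lebesgue (\<lambda>x. (norm (f x))\<^sup>2)"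

definition L2_tendsto :: "(nat \<Rightarrow> real^'n \<Rightarrow> complex) \<Rightarrow> (real^'n \<Rightarrow> complex) \<Rightarrow> bool" where
  "L2_tendsto F f \<longleftrightarrow>
     (\<lambda>k. \<integral>\<^sup>+ x. ennreal ((norm (F k x - f x))\<^sup>2) \<partial>lebesgue) \<longlonglongrightarrow> 0"

text \<open>Meaningful for integrable \<open>f\<close> only: otherwise the Bochner integral is \<open>0\<close>.\<close>
definition fourier_L1 :: "(real^'n \<Rightarrow> complex) \<Rightarrow> real^'n \<Rightarrow> complex" where
  "fourier_L1 f y =
     (LINT x|lebesgue. f x * exp (- (2 * of_real pi * \<i> * of_real (x \<bullet> y))))"

text \<open>The extension to \<open>L\<^sup>2\<close> by continuity from \<open>L\<^sup>1 \<inter> L\<^sup>2\<close>. It is a relation because elements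
  of \<open>L\<^sup>2\<close> are represented by functions, so the transform is determined only almost
  everywhere. By Plancherel, every square integrable \<open>f\<close> has a transform \<open>g\<close>, which up to null
  sets does not depend on the approximating sequence.\<close>
definition has_fourier_L2 :: "(real^'n \<Rightarrow> complex) \<Rightarrow> (real^'n \<Rightarrow> complex) \<Rightarrow> bool" where
  "has_fourier_L2 f g \<longleftrightarrow> square_integrable f \<and> square_integrable g \<and>
     (\<exists>F. (\<forall>k. integrable lebesgue (F k) \<and> square_integrable (F k)) \<and>
          L2_tendsto F f \<and> L2_tendsto (\<lambda>k. fourier_L1 (F k)) g)"

text \<open>Complement of the largest open set on which \<open>f\<close> vanishes almost everywhere.\<close>
definition ess_support :: "(real^'n \<Rightarrow> complex) \<Rightarrow> (real^'n) set" where
  "ess_support f = - \<Union>{U. open U \<and> (AE x in lebesgue. x \<in> U \<longrightarrow> f x = 0)}"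

definition support :: "(real^'n \<Rightarrow> complex) \<Rightarrow> (real^'n) set" where
  "support f = closure {x. f x \<noteq> 0}"

text \<open>\<open>C_k k f\<close>: \<open>f\<close> is \<open>k\<close> times continuously differentiable (over the reals), i.e. it is
  differentiable and all its directional derivatives are of class \<open>k - 1\<close>.\<close>
primrec C_k :: "nat \<Rightarrow> (real^'n \<Rightarrow> complex) \<Rightarrow> bool" where
  "C_k 0 f \<longleftrightarrow> continuous_on UNIV f"
| "C_k (Suc k) f \<longleftrightarrow> f differentiable_on UNIV \<and>
     (\<forall>v. C_k k (\<lambda>x. frechet_derivative f (at x) v))"

definition C_c_infinity :: "(real^'n \<Rightarrow> complex) \<Rightarrow> bool" where
  "C_c_infinity f \<longleftrightarrow> (\<forall>k. C_k k f) \<and> compact (support f)"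

end

theory Submission
  imports Defs "HOL-Probability.Probability" "HOL-Complex_Analysis.Complex_Analysis"
begin

text \<open>
  Part (a).  Write \<open>g\<close> for the transform of \<open>f\<close>.  Since \<open>f\<close> lives in the half-space
  \<open>x \<bullet> \<eta> \<le> t\<close>, the function \<open>s \<mapsto> g (y + s \<eta>) exp (2\<pi>its)\<close> is, for almost every \<open>y\<close>, the boundary
  value of a bounded holomorphic function in the upper half-plane.  Such a function is either zero or has
  a logarithm that is integrable against \<open>ds / (1 + s\<^sup>2)\<close>.  But \<open>log \<bar>g\<bar> \<le> log C - \<psi>\<close>, and
  because \<open>\<psi>\<close> is radial, \<open>I = \<infinity>\<close> forces \<open>\<integral> \<psi> (y + s \<eta>) / (1 + s\<^sup>2) ds = \<infinity>\<close> on \<^emph>\<open>every\<close> line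
  parallel to \<open>\<eta>\<close>.  Hence \<open>g = 0\<close>, and \<open>f = 0\<close>.

  No theory of boundary values is used.  Let \<open>\<zeta> s = (s - \<i>) / (s + \<i>)\<close>.  Holomorphy enters only
  through the moments \<open>\<integral> g (y + s \<eta>) exp (2\<pi>its) \<zeta>\<^sup>k / (1 + s\<^sup>2) ds\<close>, which vanish for all \<open>k \<ge> 1\<close>
  (\<open>integral_gauss_line_transform\<close>): tested against Gaussians in \<open>y\<close>, and moved to the side of
  \<open>f\<close> by \<open>has_fourier_L2_multiplication_formula\<close>, they contain the Fourier transform of \<open>\<zeta>\<^sup>k / (1 + s\<^sup>2)\<close>, which
  vanishes at \<open>x \<bullet> \<eta>\<close> for all \<open>x\<close> in the support of \<open>f\<close>, after the shift by \<open>t\<close>.  The logarithmic integral enters through an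
  extremal argument of Szego (\<open>vanishing_of_log_integral\<close>): the vanishing moments make the mean of
  \<open>g\<close> equal to the mean of \<open>g \<cdot> exp (Q \<circ> \<zeta> - Q 0)\<close> for every polynomial \<open>Q\<close>, and when \<open>Re (Q \<circ> \<zeta>)\<close>
  imitates \<open>\<psi>\<close> the latter is as small as desired.  Hence the moment for \<open>k = 0\<close>
  vanishes as well.  On the side of \<open>f\<close> it is \<open>f\<close> times the strictly positive weight
  \<open>\<pi> exp (- 2\<pi>(t - x \<bullet> \<eta>))\<close>, tested against all Gaussians; so \<open>f = 0\<close>.

  Part (b).  This is Ingham's construction in probabilistic form.  For nondecreasing \<open>\<psi>\<close>, finiteness
  of \<open>I\<close> amounts to \<open>\<Sum>\<^sub>j \<psi>(2\<^sup>j) / 2\<^sup>j < \<infinity>\<close> (\<open>summable_dyadic_values\<close>).  Let \<open>X\<close> be a random vector that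
  is the sum, over \<open>j \<ge> j0\<close>, of \<open>m\<^sub>j\<close> independent vectors uniform in the cube of half-side \<open>1 / 2\<^sup>j\<close>,
  where \<open>m\<^sub>j\<close> is about the value of \<open>\<psi>\<close> at radius \<open>2\<^sup>j\<close>.  The summability says that \<open>X\<close> stays in a small ball when \<open>j0\<close> is
  large.  At frequency about \<open>2\<^sup>j\<close> each of the \<open>m\<^sub>j\<close> summands contributes a factor at most \<open>1/e\<close> to
  the characteristic function of \<open>X\<close>, which is therefore at most \<open>exp (- \<psi>)\<close> up to a constant
  (\<open>random_vector_with_decaying_transform\<close>).  The function \<open>f x = E h (x - X)\<close>, with \<open>h\<close> a smooth bump,
  inherits smoothness from \<open>h\<close> and decay from \<open>X\<close>, since its transform is the product of the two.
\<close>

section \<open>The Poisson integral of the upper half-plane at the imaginary unit\<close>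

definition cauchy_weight :: "real \<Rightarrow> real" where "cauchy_weight s = 1 / (1 + s\<^sup>2)"

lemma measurable_cauchy_weight [measurable]: "cauchy_weight \<in> borel_measurable borel"
  unfolding cauchy_weight_def by measurable

lemma cauchy_weight_pos: "cauchy_weight s > 0"
  unfolding cauchy_weight_def by (simp add: add_pos_nonneg)

lemma cauchy_weight_nonneg [simp]: "cauchy_weight s \<ge> 0"
  using cauchy_weight_pos[of s] by simp

lemma integrable_cauchy_weight: "integrable lborel cauchy_weight"
  and integral_cauchy_weight: "(LINT s|lborel. cauchy_weight s) = pi"
  using integrable_inverse_1_plus_square LBINT_inverse_1_plus_square
  by (simp_all add: set_integrable_def interval_lebesgue_integral_def set_lebesgue_integral_def
      cauchy_weight_def[abs_def] inverse_eq_divide)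

lemma integrable_cauchy_weight_scaleR:
  fixes g :: "real \<Rightarrow> 'b::{banach, second_countable_topology}"
  assumes [measurable]: "g \<in> borel_measurable borel" and "AE s in lborel. norm (g s) \<le> M"
  shows "integrable lborel (\<lambda>s. cauchy_weight s *\<^sub>R g s)"
proof (rule Bochner_Integration.integrable_bound)
  show "integrable lborel (\<lambda>s. M * cauchy_weight s)"
    using integrable_cauchy_weight by simp
  show "AE s in lborel. norm (cauchy_weight s *\<^sub>R g s) \<le> norm (M * cauchy_weight s)"
    using assms(2)
  proof eventually_elim
    case (elim s)
    have "M \<ge> 0" using elim norm_ge_zero order_trans by blast
    then show ?case using elim by (simp add: mult.commute[of M] mult_left_mono)
  qed
qed measurable

lemma integral_norm_bound_integral_AE:
  fixes f :: "'a \<Rightarrow> 'b::{banach, second_countable_topology}"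
  assumes f: "integrable M f" and "integrable M g" and "AE x in M. norm (f x) \<le> g x"
  shows "norm (integral\<^sup>L M f) \<le> integral\<^sup>L M g"
proof -
  have "norm (integral\<^sup>L M f) \<le> (\<integral>x. norm (f x) \<partial>M)" by (rule integral_norm_bound)
  also have "\<dots> \<le> integral\<^sup>L M g" using assms by (intro integral_mono_AE integrable_norm)
  finally show ?thesis .
qed
lemma one_plus_square_factor: "1 + (z::complex)\<^sup>2 = (z - \<i>) * (z + \<i>)"
  by (simp add: power2_eq_square algebra_simps)

text \<open>The Poisson kernel of the upper half-plane at \<open>\<i>\<close> is \<open>1 / (\<pi> (1 + s\<^sup>2))\<close>.  To avoid winding
  numbers, the constant \<open>h \<i>\<close> is subtracted first: \<open>(h z - h \<i>) / (1 + z\<^sup>2)\<close> has no pole in the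
  half-plane, so its integral over the boundary of a large half-disc vanishes, and the arc contributes
  nothing in the limit because the integrand is \<open>O(1 / \<bar>z\<bar>\<^sup>2)\<close>.\<close>
lemma poisson_integral_upper_half_plane:
  fixes h :: "complex \<Rightarrow> complex"
  assumes hol: "h holomorphic_on {z. Im z > -1}"
    and bnd: "\<And>z. Im z \<ge> 0 \<Longrightarrow> norm (h z) \<le> M"
  shows "(LINT s|lborel. cauchy_weight s *\<^sub>R h (of_real s)) = pi * h \<i>"
proof -
  define S where "S = {z. Im z > -1}"
  have opS: "open S" unfolding S_def by (simp add: open_halfspace_Im_gt)
  have cvS: "convex S" unfolding S_def by (simp add: convex_halfspace_Im_gt)
  \<comment> \<open>The factor \<open>z - \<i>\<close> is removed by the difference quotient, and \<open>z + \<i>\<close> has no zero in \<open>S\<close>.\<close>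
  define q where "q = (\<lambda>z. (if z = \<i> then deriv h \<i> else (h z - h \<i>) / (z - \<i>)) / (z + \<i>))"
  have qhol: "q holomorphic_on S"
    unfolding q_def
  proof (intro holomorphic_intros)
    show "(\<lambda>z. if z = \<i> then deriv h \<i> else (h z - h \<i>) / (z - \<i>)) holomorphic_on S"
      using hol opS by (intro pole_lemma) (auto simp: S_def interior_open)
    show "z + \<i> \<noteq> 0" if "z \<in> S" for z
      using that by (auto simp: S_def complex_eq_iff)
  qed
  have q_eq: "q z = (h z - h \<i>) / (1 + z\<^sup>2)" if "z \<noteq> \<i>" for z
    using that by (simp add: q_def one_plus_square_factor)
  define r where "r = (\<lambda>s::real. cauchy_weight s *\<^sub>R (h (of_real s) - h \<i>))"
  have qr: "q (of_real s) = r s" for s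
    by (subst q_eq) (auto simp: r_def complex_eq_iff cauchy_weight_def scaleR_conv_of_real)
  have contr: "continuous_on UNIV (\<lambda>s. h (of_real s))"
    by (rule continuous_on_compose2[OF holomorphic_on_imp_continuous_on[OF hol]]) (auto intro!: continuous_intros)
  have mh: "(\<lambda>s. h (of_real s)) \<in> borel_measurable borel"
    using contr by (rule borel_measurable_continuous_onI)
  have ih: "integrable lborel (\<lambda>s. cauchy_weight s *\<^sub>R h (of_real s))"
    by (rule integrable_cauchy_weight_scaleR[OF mh]) (auto intro!: AE_I2 bnd)
  have ic: "integrable lborel (\<lambda>s. cauchy_weight s *\<^sub>R h \<i>)"
    using integrable_cauchy_weight by simp
  have ir: "integrable lborel r"
    unfolding r_def scaleR_diff_right by (intro Bochner_Integration.integrable_diff ih ic)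
  define R where "R = (\<lambda>n::nat. real n + 2)"
  have lim1: "(\<lambda>n. LINT s|lborel. indicator {- R n..R n} s *\<^sub>R r s) \<longlonglongrightarrow> (LINT s|lborel. r s)"
  proof (rule integral_dominated_convergence)
    show "integrable lborel (\<lambda>s. norm (r s))" using ir by simp
    show "AE s in lborel. (\<lambda>n. indicator {- R n..R n} s *\<^sub>R r s) \<longlonglongrightarrow> r s"
    proof (rule AE_I2)
      fix s
      have "\<forall>\<^sub>F n in sequentially. s \<in> {- R n..R n}"
        using eventually_ge_at_top[of "nat \<lceil>\<bar>s\<bar>\<rceil>"]
        by eventually_elim (auto simp: R_def abs_le_iff nat_le_iff ceiling_le_iff)
      then have "\<forall>\<^sub>F n in sequentially. indicator {- R n..R n} s *\<^sub>R r s = r s"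
        by eventually_elim simp
      then show "(\<lambda>n. indicator {- R n..R n} s *\<^sub>R r s) \<longlonglongrightarrow> r s"
        by (rule tendsto_eventually)
    qed
    show "r \<in> borel_measurable lborel" using ir by simp
    then show "(\<lambda>s. indicator {- R n..R n} s *\<^sub>R r s) \<in> borel_measurable lborel" for n by measurable
    show "AE s in lborel. norm (indicator {- R n..R n} s *\<^sub>R r s) \<le> norm (r s)" for n
      by (auto simp: indicator_def)
  qed
  have est: "norm (LINT s|lborel. indicator {- R n..R n} s *\<^sub>R r s) \<le> 2 * M / ((R n)\<^sup>2 - 1) * R n * pi" for n
  proof -
    have Rn: "R n \<ge> 2" by (simp add: R_def)
    define g1 where "g1 = linepath (of_real (- R n)) (of_real (R n) :: complex)"
    define g2 where "g2 = part_circlepath 0 (R n) 0 pi"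
    have img1: "path_image g1 \<subseteq> {z. Im z \<ge> 0}"
      unfolding g1_def path_image_linepath by (auto simp: closed_segment_def)
    have img2: "path_image g2 \<subseteq> {z. Im z \<ge> 0 \<and> norm z = R n}"
    proof
      fix z assume z: "z \<in> path_image g2"
      then obtain x where x: "z = of_real (R n) * iexp x" "0 \<le> x" "x \<le> pi"
        unfolding g2_def by (auto simp: path_image_part_circlepath)
      have "norm z = R n" using x Rn by (simp add: norm_mult)
      moreover have "Im z = R n * sin x" using x by (simp add: Im_exp)
      then have "Im z \<ge> 0" using x Rn sin_ge_zero by simp
      ultimately show "z \<in> {z. Im z \<ge> 0 \<and> norm z = R n}" by simp
    qed
    have ends: "pathfinish g1 = pathstart g2" "pathfinish g2 = pathstart g1"
      by (auto simp: g1_def g2_def pathstart_part_circlepath pathfinish_part_circlepath exp_pi_i')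
    have vp: "valid_path g1" "valid_path g2" by (auto simp: g1_def g2_def)
    have sub: "path_image g1 \<subseteq> S" "path_image g2 \<subseteq> S" using img1 img2 by (force simp: S_def)+
    have ci: "q contour_integrable_on g1" "q contour_integrable_on g2"
      using contour_integrable_holomorphic_simple[OF qhol opS] vp sub by auto
    have "(q has_contour_integral 0) (g1 +++ g2)"
      using qhol cvS by (rule Cauchy_theorem_convex_simple) (use vp sub ends in \<open>auto simp: path_image_join\<close>)
    then have sum0: "contour_integral g1 q + contour_integral g2 q = 0"
      using contour_integral_join[OF ci vp] contour_integral_unique by metis
    have b2: "norm (contour_integral g2 q) \<le> 2 * M / ((R n)\<^sup>2 - 1) * R n * \<bar>pi - 0\<bar>"
      unfolding g2_def
    proof (rule contour_integral_bound_part_circlepath)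
      show "q contour_integrable_on part_circlepath 0 (R n) 0 pi" using ci(2) by (simp add: g2_def)
      have R1: "(R n)\<^sup>2 - 1 > 0" using power_mono[OF Rn, of 2] by simp
      have M0: "M \<ge> 0" using bnd[of 0] norm_ge_zero order_trans by (metis order_refl zero_complex.sel(2))
      show "0 \<le> 2 * M / ((R n)\<^sup>2 - 1)" using R1 M0 by simp
      fix z assume "z \<in> path_image (part_circlepath 0 (R n) 0 pi)"
      then have z: "Im z \<ge> 0" "norm z = R n" using img2 by (auto simp: g2_def)
      have zi: "z \<noteq> \<i>" using z Rn by auto
      have "norm (h z - h \<i>) \<le> M + M" by (rule norm_triangle_le_diff) (intro add_mono bnd; use z in auto)
      moreover have "(R n)\<^sup>2 - 1 \<le> norm (1 + z\<^sup>2)"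
        using norm_diff_ineq[of "z\<^sup>2" 1] z by (simp add: norm_power add.commute)
      ultimately show "norm (q z) \<le> 2 * M / ((R n)\<^sup>2 - 1)"
        unfolding q_eq[OF zi] norm_divide using R1 M0 by (intro frac_le) auto
    qed (use Rn in auto)
    have "contour_integral g1 q = integral {- R n..R n} (\<lambda>s. q (of_real s))"
      unfolding g1_def using Rn by (subst contour_integral_linepath_Reals_eq) auto
    also have "\<dots> = integral {- R n..R n} r" by (simp add: qr)
    also have "\<dots> = (LINT s|lborel. indicator {- R n..R n} s *\<^sub>R r s)"
      using integrable_mult_indicator[OF _ ir, of "{- R n..R n}"]
      by (intro set_borel_integral_eq_integral(2)[unfolded set_integrable_def set_lebesgue_integral_def, symmetric]) auto
    finally have "norm (LINT s|lborel. indicator {- R n..R n} s *\<^sub>R r s) = norm (contour_integral g2 q)"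
      using sum0 by (metis add_eq_0_iff norm_minus_cancel)
    with b2 show ?thesis by simp
  qed
  have "(\<lambda>n. 2 * M / ((R n)\<^sup>2 - 1) * R n * pi) \<longlonglongrightarrow> 0"
    unfolding R_def by real_asymp
  then have "(\<lambda>n. LINT s|lborel. indicator {- R n..R n} s *\<^sub>R r s) \<longlonglongrightarrow> 0"
    by (rule Lim_null_comparison[rotated]) (use est in auto)
  then have "(LINT s|lborel. r s) = 0" using lim1 LIMSEQ_unique by blast
  moreover have "(LINT s|lborel. r s) = (LINT s|lborel. cauchy_weight s *\<^sub>R h (of_real s)) - (LINT s|lborel. cauchy_weight s *\<^sub>R h \<i>)"
    unfolding r_def scaleR_diff_right by (rule Bochner_Integration.integral_diff[OF ih ic])
  moreover have "(LINT s|lborel. cauchy_weight s *\<^sub>R h \<i>) = h \<i> * pi"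
    using integral_scaleR_left[OF integrable_cauchy_weight, of "h \<i>"]
    by (simp add: integral_cauchy_weight scaleR_conv_of_real)
  ultimately show ?thesis by simp
qed

text \<open>The conformal map of the upper half-plane onto the unit disc that sends \<open>\<i>\<close> to \<open>0\<close>.\<close>
definition cayley :: "complex \<Rightarrow> complex" where "cayley z = (z - \<i>) / (z + \<i>)"

lemma cayley_holomorphic: "cayley holomorphic_on {z. Im z > -1}"
  unfolding cayley_def by (intro holomorphic_intros) (auto simp: complex_eq_iff)

lemma norm_cayley_le: "Im z \<ge> 0 \<Longrightarrow> norm (cayley z) \<le> 1"
proof -
  assume "Im z \<ge> 0"
  then have "(norm (z - \<i>))\<^sup>2 \<le> (norm (z + \<i>))\<^sup>2"
    by (simp only: cmod_power2) (simp add: power2_eq_square algebra_simps)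
  then have "norm (z - \<i>) \<le> norm (z + \<i>)" by (simp add: power2_le_iff_abs_le)
  moreover have "z + \<i> \<noteq> 0" using \<open>Im z \<ge> 0\<close> by (auto simp: complex_eq_iff)
  ultimately show ?thesis by (simp add: cayley_def norm_divide)
qed

lemma norm_cayley_of_real: "norm (cayley (of_real s)) = 1"
proof -
  have "norm (of_real s - \<i>) = norm (of_real s + \<i>)"
    by (simp add: cmod_def)
  moreover have "of_real s + \<i> \<noteq> 0" by (auto simp: complex_eq_iff)
  ultimately show ?thesis by (simp add: cayley_def norm_divide)
qed

lemma cayley_ii [simp]: "cayley \<i> = 0" by (simp add: cayley_def)

lemma measurable_cayley [measurable]: "(\<lambda>s. cayley (of_real s)) \<in> borel_measurable borel"
  unfolding cayley_def by measurable

text \<open>This is a one-variable Fourier transform, evaluated on a half-line: the transform of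
  \<open>cayley\<^sup>k / (1 + s\<^sup>2)\<close> vanishes there when \<open>k \<ge> 1\<close>, because \<open>cayley \<i> = 0\<close>, and is a
  positive exponential when \<open>k = 0\<close>.\<close>
lemma integral_cayley_power_exp:
  assumes "lam \<ge> 0"
  shows "(LINT s|lborel. cauchy_weight s *\<^sub>R (cayley (of_real s) ^ k * exp (\<i> * of_real lam * of_real s))) = (if k = 0 then pi * exp (- lam) else 0)"
proof -
  have "(LINT s|lborel. cauchy_weight s *\<^sub>R (\<lambda>z. cayley z ^ k * exp (\<i> * of_real lam * z)) (of_real s)) = pi * (cayley \<i> ^ k * exp (\<i> * of_real lam * \<i>))"
  proof (rule poisson_integral_upper_half_plane)
    show "(\<lambda>z. cayley z ^ k * exp (\<i> * of_real lam * z)) holomorphic_on {z. - 1 < Im z}"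
      by (intro holomorphic_intros cayley_holomorphic)
    show "norm (cayley z ^ k * exp (\<i> * of_real lam * z)) \<le> 1" if "Im z \<ge> 0" for z
      using that assms by (auto simp: norm_mult norm_power intro!: mult_le_one power_le_one norm_cayley_le)
  qed
  then show ?thesis
    by (auto simp: power_0_left algebra_simps exp_of_real[symmetric] simp flip: of_real_minus)
qed

section \<open>Approximation by continuous functions and by trigonometric polynomials\<close>

text \<open>Truncation keeps the approximating continuous functions in the range of \<open>h\<close>, so that dominated
  convergence applies to them.\<close>
lemma bounded_measurable_limit_continuous:
  fixes h :: "'a::euclidean_space \<Rightarrow> real"
  assumes [measurable]: "h \<in> borel_measurable borel" and bnd: "\<And>x. h x \<in> {a..b}"
  obtains c where "\<And>n::nat. continuous_on UNIV (c n)" "\<And>n x. c n x \<in> {a..b}"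
    "AE x in lborel. (\<lambda>n. c n x) \<longlonglongrightarrow> h x"
proof -
  have "h \<in> borel_measurable lebesgue" by (simp add: measurable_completion)
  then have "h measurable_on UNIV"
    by (rule lebesgue_measurable_imp_measurable_on) simp
  then obtain N g where N: "negligible N" and cg: "\<And>n. continuous_on UNIV (g n)"
    and lim: "\<And>x. x \<notin> N \<Longrightarrow> (\<lambda>n. g n x) \<longlonglongrightarrow> h x"
    unfolding measurable_on_def by auto
  have ab: "a \<le> b" using bnd[of undefined] by auto
  define c where "c = (\<lambda>n x. max a (min b (g n x)))"
  have "continuous_on UNIV (c n)" for n
    unfolding c_def by (intro continuous_intros cg)
  moreover have "c n x \<in> {a..b}" for n x using ab by (auto simp: c_def)
  moreover have "AE x in lborel. (\<lambda>n. c n x) \<longlonglongrightarrow> h x"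
  proof -
    have "AE x in lebesgue. x \<notin> N"
      using N by (simp add: negligible_iff_null_sets AE_not_in)
    then have "AE x in lborel. x \<notin> N" by (simp add: AE_completion_iff)
    then show ?thesis
    proof eventually_elim
      case (elim x)
      have "(\<lambda>n. c n x) \<longlonglongrightarrow> max a (min b (h x))"
        unfolding c_def by (intro tendsto_intros lim elim)
      also have "max a (min b (h x)) = h x" using bnd[of x] by auto
      finally show ?case .
    qed
  qed
  ultimately show ?thesis using that by blast
qed

text \<open>Real trigonometric polynomials, written as real parts of polynomials: the frequencies of the
  polynomial are nonnegative, so that it extends holomorphically to the disc.\<close>
definition real_trig_poly :: "(complex \<Rightarrow> real) \<Rightarrow> bool" where
  "real_trig_poly h \<longleftrightarrow> (\<exists>Q. \<forall>z\<in>sphere 0 1. h z = Re (poly Q z))"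

lemma real_trig_poly_add: "real_trig_poly h \<Longrightarrow> real_trig_poly g \<Longrightarrow> real_trig_poly (\<lambda>z. h z + g z)"
  unfolding real_trig_poly_def
proof (elim exE)
  fix Q R assume "\<forall>z\<in>sphere 0 1. h z = Re (poly Q z)" "\<forall>z\<in>sphere 0 1. g z = Re (poly R z)"
  then show "\<exists>Q. \<forall>z\<in>sphere 0 1. h z + g z = Re (poly Q z)"
    by (intro exI[of _ "Q + R"]) auto
qed

lemma real_trig_poly_sum: "(\<And>i. i \<in> A \<Longrightarrow> real_trig_poly (h i)) \<Longrightarrow> real_trig_poly (\<lambda>z. \<Sum>i\<in>A. h i z)"
proof (induction A rule: infinite_finite_induct)
  case (insert x F) then show ?case by (simp add: real_trig_poly_add)
qed (auto simp: real_trig_poly_def intro: exI[of _ 0])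

lemma real_trig_poly_monom: "real_trig_poly (\<lambda>z. Re (c * z ^ k))"
  unfolding real_trig_poly_def by (intro exI[of _ "monom c k"]) (simp add: poly_monom)

lemma real_trig_poly_cong: "real_trig_poly h \<Longrightarrow> (\<And>z. norm z = 1 \<Longrightarrow> h z = g z) \<Longrightarrow> real_trig_poly g"
  unfolding real_trig_poly_def by auto

lemma real_trig_poly_monom_mult_le:
  assumes "j \<le> k" shows "real_trig_poly (\<lambda>z. Re (a * z ^ j) * Re (b * z ^ k))"
proof (rule real_trig_poly_cong)
  show "real_trig_poly (\<lambda>z. Re (a * b / 2 * z ^ (j + k)) + Re (cnj a * b / 2 * z ^ (k - j)))"
    by (intro real_trig_poly_add real_trig_poly_monom)
  fix z :: complex assume z: "norm z = 1"
  \<comment> \<open>On the circle \<open>cnj z = 1 / z\<close>, so both products below are monomials of nonnegative degree.\<close>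
  have Re_mult: "Re u * Re v = Re (u * v / 2) + Re (cnj u * v / 2)" for u v :: complex
    by (simp add: field_simps)
  have "z * cnj z = 1" using z by (metis complex_norm_square of_real_1 one_power2)
  then have "(cnj z * z) ^ j = 1" by (metis mult.commute power_one)
  moreover have "cnj (z ^ j) * z ^ k = (cnj z * z) ^ j * z ^ (k - j)"
  proof -
    have "z ^ k = z ^ j * z ^ (k - j)" using assms by (simp flip: power_add)
    then show ?thesis by (simp add: power_mult_distrib)
  qed
  ultimately have "cnj (z ^ j) * z ^ k = z ^ (k - j)" by simp
  then show "Re (a * b / 2 * z ^ (j + k)) + Re (cnj a * b / 2 * z ^ (k - j)) = Re (a * z ^ j) * Re (b * z ^ k)"
    unfolding Re_mult[of "a * z ^ j"] by (simp add: power_add mult_ac)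
qed

lemma real_trig_poly_monom_mult: "real_trig_poly (\<lambda>z. Re (a * z ^ j) * Re (b * z ^ k))"
  using real_trig_poly_monom_mult_le[of j k a b] real_trig_poly_monom_mult_le[of k j b a]
  by (cases "j \<le> k") (auto simp: mult.commute)

lemma real_trig_poly_mult:
  assumes "real_trig_poly h" "real_trig_poly g" shows "real_trig_poly (\<lambda>z. h z * g z)"
proof -
  obtain Q where Q: "\<And>z. norm z = 1 \<Longrightarrow> h z = Re (poly Q z)"
    using assms(1) by (auto simp: real_trig_poly_def)
  obtain R where R: "\<And>z. norm z = 1 \<Longrightarrow> g z = Re (poly R z)"
    using assms(2) by (auto simp: real_trig_poly_def)
  show ?thesis
  proof (rule real_trig_poly_cong)
    show "real_trig_poly (\<lambda>z. \<Sum>j\<le>degree Q. \<Sum>k\<le>degree R. Re (coeff Q j * z ^ j) * Re (coeff R k * z ^ k))"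
      by (intro real_trig_poly_sum real_trig_poly_monom_mult)
    show "(\<Sum>j\<le>degree Q. \<Sum>k\<le>degree R. Re (coeff Q j * z ^ j) * Re (coeff R k * z ^ k)) = h z * g z"
      if "norm z = 1" for z
      unfolding Q[OF that] R[OF that] poly_altdef by (simp add: sum_product)
  qed
qed

lemma real_polynomial_function_imp_trig: "real_polynomial_function p \<Longrightarrow> real_trig_poly p"
proof (induction rule: real_polynomial_function.induct)
  case (linear f)
  interpret bounded_linear f by fact
  have "f z = Re (Complex (f 1) (- f \<i>) * z ^ 1)" for z
  proof -
    have "z = Re z *\<^sub>R 1 + Im z *\<^sub>R \<i>" by (simp add: complex_eq_iff)
    then have "f z = f (Re z *\<^sub>R 1 + Im z *\<^sub>R \<i>)" by simp
    also have "\<dots> = Re z * f 1 + Im z * f \<i>" by (simp only: add scaleR real_scaleR_def)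
    finally show ?thesis by (simp add: algebra_simps)
  qed
  then show ?case using real_trig_poly_cong[OF real_trig_poly_monom[of "Complex (f 1) (- f \<i>)" 1]] by metis
next
  case (const c)
  show ?case using real_trig_poly_monom[of "of_real c" 0] by simp
qed (auto intro: real_trig_poly_add real_trig_poly_mult)

text \<open>Stone and Weierstrass give a polynomial in \<open>Re z\<close> and \<open>Im z\<close>; on the circle it is a trigonometric
  polynomial.\<close>
lemma trig_poly_approx_circle:
  fixes D :: "complex \<Rightarrow> real"
  assumes "continuous_on (sphere 0 1) D" "e > 0"
  obtains Q where "\<And>z. norm z = 1 \<Longrightarrow> \<bar>D z - Re (poly Q z)\<bar> < e"
proof -
  obtain p where p: "polynomial_function p" "\<And>x. x \<in> sphere 0 1 \<Longrightarrow> norm (D x - p x) < e"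
    using Stone_Weierstrass_polynomial_function[OF _ assms] by auto
  have "real_polynomial_function p" using p(1) by (simp add: real_polynomial_function_eq)
  then have "real_trig_poly p" by (rule real_polynomial_function_imp_trig)
  then obtain Q where "\<And>z. norm z = 1 \<Longrightarrow> p z = Re (poly Q z)"
    unfolding real_trig_poly_def by auto
  then show ?thesis using that[of Q] p(2) by simp
qed

section \<open>The extremal argument on a line\<close>

text \<open>The map \<open>cayley\<close> takes the line to the circle without the point \<open>1\<close>.  A function vanishing outside a
  bounded interval becomes continuous on the whole circle when it is given the value \<open>0\<close> at \<open>1\<close>.\<close>
lemma cayley_approx:
  fixes d :: "real \<Rightarrow> real"
  assumes cont: "continuous_on UNIV d" and zero: "\<And>s. \<bar>s\<bar> \<ge> J \<Longrightarrow> d s = 0" and e: "e > 0"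
  obtains Q where "\<And>s. \<bar>d s - Re (poly Q (cayley (of_real s)))\<bar> < e"
proof -
  \<comment> \<open>The inverse of \<open>cayley\<close>; the expression is real on the circle.\<close>
  define \<sigma> where "\<sigma> = (\<lambda>z::complex. Re (\<i> * (1 + z) / (1 - z)))"
  define D where "D = (\<lambda>z. if z = 1 then 0 else d (\<sigma> z))"
  have \<sigma>_cayley: "\<sigma> (cayley (of_real s)) = s" "cayley (of_real s) \<noteq> 1" for s
  proof -
    have ne: "of_real s + \<i> \<noteq> 0" by (auto simp: complex_eq_iff)
    then show "cayley (of_real s) \<noteq> 1" by (auto simp: cayley_def)
    have "1 + cayley (of_real s) = 2 * of_real s / (of_real s + \<i>)"
      and "1 - cayley (of_real s) = 2 * \<i> / (of_real s + \<i>)"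
      using ne by (simp_all add: cayley_def field_simps)
    then have "\<i> * (1 + cayley (of_real s)) / (1 - cayley (of_real s)) = of_real s"
      using ne by simp
    then show "\<sigma> (cayley (of_real s)) = s" by (simp add: \<sigma>_def)
  qed
  have real: "norm (\<i> * (1 + z) / (1 - z)) = \<bar>\<sigma> z\<bar>" if z: "norm z = 1" "z \<noteq> 1" for z
  proof -
    have "Im (\<i> * (1 + z) * cnj (1 - z)) = 1 - (norm z)\<^sup>2"
      by (simp only: cmod_power2) (simp add: power2_eq_square algebra_simps)
    then have "Im (\<i> * (1 + z) / (1 - z)) = 0"
      using z by (subst complex_div_cnj) simp
    then show ?thesis by (simp add: \<sigma>_def cmod_def)
  qed
  have "continuous_on (sphere 0 1) D"
    unfolding continuous_on_eq_continuous_within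
  proof
    fix z :: complex assume z: "z \<in> sphere 0 1"
    show "continuous (at z within sphere 0 1) D"
    proof (cases "z = 1")
      case False
      have "isCont \<sigma> z" unfolding \<sigma>_def using False by (intro continuous_intros isCont_Re) auto
      moreover have "isCont d (\<sigma> z)" using cont by (simp add: continuous_on_eq_continuous_at)
      ultimately have "isCont (\<lambda>z. d (\<sigma> z)) z" by (rule isCont_o2)
      moreover have "\<forall>\<^sub>F w in nhds z. D w = d (\<sigma> w)"
        using t1_space_nhds[OF False] by eventually_elim (simp add: D_def)
      ultimately have "isCont D z" by (subst isCont_cong)
      then show ?thesis by (rule continuous_at_imp_continuous_at_within)
    next
      case True
      have "\<forall>\<^sub>F w in at 1 within sphere 0 1. D w = 0"
        unfolding eventually_at
      proof (intro exI[of _ "1 / (\<bar>J\<bar> + 1)"] conjI ballI impI)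
        fix w :: complex assume w: "w \<in> sphere 0 1" "w \<noteq> 1 \<and> dist w 1 < 1 / (\<bar>J\<bar> + 1)"
        have d: "norm (1 - w) < 1 / (\<bar>J\<bar> + 1)" "norm (1 - w) > 0" using w by (simp_all add: dist_norm norm_minus_commute)
        have "norm (1 - w) < 1" using d(1) by (rule less_le_trans) simp
        then have "norm (1 + w) \<ge> 1" using norm_diff_ineq[of 2 "1 - w"] norm_triangle_ineq2[of 2 "1 - w"] by simp
        have "J * norm (1 - w) \<le> (\<bar>J\<bar> + 1) * norm (1 - w)" by (intro mult_right_mono) auto
        also have "\<dots> \<le> 1" using d(1) by (simp add: field_simps add_pos_nonneg)
        finally have "J \<le> norm (1 + w) / norm (1 - w)"
          using d(2) \<open>norm (1 + w) \<ge> 1\<close> by (simp add: field_simps)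
        then have "\<bar>\<sigma> w\<bar> \<ge> J" using real[of w] w by (simp add: norm_divide norm_mult)
        then show "D w = 0" by (simp add: D_def zero)
      qed (simp add: add_pos_nonneg)
      then show ?thesis using True by (simp add: continuous_within D_def tendsto_eventually)
    qed
  qed
  from trig_poly_approx_circle[OF this e] obtain Q where Q: "\<And>z. norm z = 1 \<Longrightarrow> \<bar>D z - Re (poly Q z)\<bar> < e" by blast
  show ?thesis
  proof (rule that[of Q])
    show "\<bar>d s - Re (poly Q (cayley (of_real s)))\<bar> < e" for s
      using Q[OF norm_cayley_of_real[of s]] by (simp add: D_def \<sigma>_cayley)
  qed
qed

lemma norm_poly_le_unit_disc:
  fixes Q :: "complex poly"
  assumes "norm z \<le> 1" shows "norm (poly Q z) \<le> (\<Sum>i\<le>degree Q. norm (coeff Q i))"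
  unfolding poly_altdef
proof (rule order_trans[OF norm_sum sum_mono])
  fix i
  have "norm z ^ i \<le> 1" using assms by (simp add: power_le_one)
  then have "norm (coeff Q i) * norm z ^ i \<le> norm (coeff Q i) * 1" by (rule mult_left_mono) simp
  then show "norm (coeff Q i * z ^ i) \<le> norm (coeff Q i)" by (simp add: norm_mult norm_power)
qed

lemma measurable_poly_complex [measurable]: "poly (Q :: complex poly) \<in> borel_measurable borel"
  by (intro borel_measurable_continuous_onI continuous_intros)

text \<open>The hypothesis on the moments says that \<open>g\<close> behaves like the boundary value of a bounded holomorphic
  function.  Its consequence is a mean value property: for \<open>F\<close> holomorphic near the closed disc,
  integrating \<open>g \<cdot> (F \<circ> cayley)\<close> against the weight gives \<open>F 0\<close> times the integral of \<open>g\<close>.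
  It is needed for \<open>F\<close> a polynomial or the exponential of one.\<close>
context
  fixes g :: "real \<Rightarrow> complex" and M :: real
  assumes g [measurable]: "g \<in> borel_measurable borel"
    and bnd: "AE s in lborel. norm (g s) \<le> M"
    and moments: "\<And>k. k \<ge> 1 \<Longrightarrow> (LINT s|lborel. cauchy_weight s *\<^sub>R (g s * cayley (of_real s) ^ k)) = 0"
begin

lemma integrable_weighted_mult:
  assumes [measurable]: "f \<in> borel_measurable borel" and "\<And>s. norm (f s) \<le> B"
  shows "integrable lborel (\<lambda>s. cauchy_weight s *\<^sub>R (g s * f s :: complex))"
proof (rule integrable_cauchy_weight_scaleR)
  show "AE s in lborel. norm (g s * f s) \<le> M * B"
    using bnd
  proof eventually_elim
    case (elim s)
    then have "M \<ge> 0" using norm_ge_zero order_trans by blast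
    then show ?case unfolding norm_mult using elim assms(2)[of s] by (intro mult_mono) auto
  qed
qed measurable

lemma integral_weighted_poly:
  "(LINT s|lborel. cauchy_weight s *\<^sub>R (g s * poly Q (cayley (of_real s)))) = poly Q 0 * (LINT s|lborel. cauchy_weight s *\<^sub>R g s)"
proof -
  have int: "integrable lborel (\<lambda>s. cauchy_weight s *\<^sub>R (g s * cayley (of_real s) ^ i))" for i
    by (rule integrable_weighted_mult[where B = 1]) (auto simp: norm_power norm_cayley_of_real)
  have "(LINT s|lborel. cauchy_weight s *\<^sub>R (g s * poly Q (cayley (of_real s)))) =
     (LINT s|lborel. (\<Sum>i\<le>degree Q. coeff Q i * (cauchy_weight s *\<^sub>R (g s * cayley (of_real s) ^ i))))"
    by (simp add: poly_altdef sum_distrib_left scaleR_sum_right mult_ac)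
  also have "\<dots> = (\<Sum>i\<le>degree Q. coeff Q i * (LINT s|lborel. (cauchy_weight s *\<^sub>R (g s * cayley (of_real s) ^ i))))"
    using int by (subst Bochner_Integration.integral_sum)
      (auto intro!: integrable_mult_right simp del: integrable_mult_right_iff mult_scaleR_right scaleR_conv_of_real)
  also have "\<dots> = (\<Sum>i\<in>{0}. coeff Q i * (LINT s|lborel. (cauchy_weight s *\<^sub>R (g s * cayley (of_real s) ^ i))))"
    by (intro sum.mono_neutral_right) (auto simp: moments)
  finally show ?thesis by (simp add: poly_0_coeff_0)
qed

lemma integral_weighted_exp_poly:
  "(LINT s|lborel. cauchy_weight s *\<^sub>R (g s * exp (poly Q (cayley (of_real s))))) = exp (poly Q 0) * (LINT s|lborel. cauchy_weight s *\<^sub>R g s)"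
proof -
  \<comment> \<open>Taylor polynomials of the exponential at \<open>Q\<close>; they are polynomials in \<open>z\<close> and bounded on the disc.\<close>
  define T where "T = (\<lambda>N. \<Sum>j<N. smult (1 / fact j) (Q ^ j))"
  have T: "poly (T N) z = (\<Sum>j<N. poly Q z ^ j /\<^sub>R fact j)" for N z
    by (simp add: T_def poly_sum scaleR_conv_of_real field_simps)
  have Tlim: "(\<lambda>N. poly (T N) z) \<longlonglongrightarrow> exp (poly Q z)" for z
    unfolding T using exp_converges[of "poly Q z"] by (simp add: sums_def)
  define B where "B = exp (\<Sum>i\<le>degree Q. norm (coeff Q i))"
  have Tbnd: "norm (poly (T N) (cayley (of_real s))) \<le> B" for N s
  proof -
    have "norm (poly (T N) (cayley (of_real s))) \<le> (\<Sum>j<N. norm (poly Q (cayley (of_real s))) ^ j /\<^sub>R fact j)"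
      unfolding T by (rule order_trans[OF norm_sum]) (simp add: norm_power)
    also have "\<dots> \<le> exp (norm (poly Q (cayley (of_real s))))"
      using exp_converges[of "norm (poly Q (cayley (of_real s)))"]
      by (intro sum_le_suminf[THEN order_trans]) (auto simp: sums_iff)
    also have "\<dots> \<le> B" unfolding B_def using norm_poly_le_unit_disc[of "cayley (of_real s)" Q] by (simp add: norm_cayley_of_real)
    finally show ?thesis .
  qed
  have "(\<lambda>N. LINT s|lborel. cauchy_weight s *\<^sub>R (g s * poly (T N) (cayley (of_real s)))) \<longlonglongrightarrow> (LINT s|lborel. cauchy_weight s *\<^sub>R (g s * exp (poly Q (cayley (of_real s)))))"
  proof (rule integral_dominated_convergence)
    show "integrable lborel (\<lambda>s. norm (cauchy_weight s *\<^sub>R (g s * of_real B)))"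
      by (intro integrable_norm integrable_weighted_mult[where B = "\<bar>B\<bar>"]) auto
    show "AE s in lborel. norm (cauchy_weight s *\<^sub>R (g s * poly (T N) (cayley (complex_of_real s)))) \<le> norm (cauchy_weight s *\<^sub>R (g s * complex_of_real B))" for N
      using Tbnd by (intro AE_I2) (auto simp: norm_mult intro!: mult_left_mono order_trans[OF Tbnd])
    show "AE s in lborel. (\<lambda>N. cauchy_weight s *\<^sub>R (g s * poly (T N) (cayley (complex_of_real s)))) \<longlonglongrightarrow> cauchy_weight s *\<^sub>R (g s * exp (poly Q (cayley (complex_of_real s))))"
      by (intro AE_I2 tendsto_intros Tlim)
  qed measurable
  moreover have "(\<lambda>N. LINT s|lborel. cauchy_weight s *\<^sub>R (g s * poly (T N) (cayley (of_real s)))) \<longlonglongrightarrow> exp (poly Q 0) * (LINT s|lborel. cauchy_weight s *\<^sub>R g s)"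
    unfolding integral_weighted_poly by (intro tendsto_intros Tlim)
  ultimately show ?thesis by (rule LIMSEQ_unique)
qed

end

lemma integral_Re_poly_cayley:
  "(LINT s|lborel. cauchy_weight s * Re (poly Q (cayley (of_real s)))) = pi * Re (poly Q 0)"
proof -
  have "(LINT s|lborel. cauchy_weight s *\<^sub>R (\<lambda>z. poly Q (cayley z)) (of_real s)) = pi * poly Q (cayley \<i>)"
    by (rule poisson_integral_upper_half_plane[OF _ norm_poly_le_unit_disc[OF norm_cayley_le]])
       (intro holomorphic_intros cayley_holomorphic)
  moreover have "integrable lborel (\<lambda>s. cauchy_weight s *\<^sub>R poly Q (cayley (of_real s)))"
    by (rule integrable_cauchy_weight_scaleR, measurable)
       (rule AE_I2, rule norm_poly_le_unit_disc, simp add: norm_cayley_of_real)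
  ultimately show ?thesis using integral_Re[of lborel "\<lambda>s. cauchy_weight s *\<^sub>R poly Q (cayley (of_real s))"] by simp
qed

text \<open>The easy half of Szego's theorem.  For every polynomial \<open>Q\<close> the mean value property gives
  \<open>\<bar>\<integral> w g\<bar> \<le> exp (- Re (Q 0)) \<integral> w \<bar>g\<bar> exp (Re (Q \<circ> cayley))\<close>, where \<open>w\<close> is the weight.  Choose \<open>Q\<close> with
  \<open>Re (Q \<circ> cayley)\<close> close to \<open>min \<phi> N\<close>: the integral on the right stays bounded since
  \<open>\<bar>g\<bar> \<le> C exp (- \<phi>)\<close>, while \<open>Re (Q 0)\<close>, being the mean of \<open>Re (Q \<circ> cayley)\<close>, is about the mean of
  \<open>min \<phi> N\<close> and tends to infinity with \<open>N\<close>.\<close>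
lemma vanishing_of_log_integral:
  fixes g :: "real \<Rightarrow> complex" and \<phi> :: "real \<Rightarrow> real"
  assumes g [measurable]: "g \<in> borel_measurable borel" and \<phi> [measurable]: "\<phi> \<in> borel_measurable borel"
    and \<phi>0: "\<And>s. \<phi> s \<ge> 0"
    and bnd: "AE s in lborel. norm (g s) \<le> C * exp (- \<phi> s)"
    and div: "(\<integral>\<^sup>+ s. ennreal (cauchy_weight s * \<phi> s) \<partial>lborel) = \<infinity>"
    and moments: "\<And>k. k \<ge> 1 \<Longrightarrow> (LINT s|lborel. cauchy_weight s *\<^sub>R (g s * cayley (of_real s) ^ k)) = 0"
  shows "(LINT s|lborel. cauchy_weight s *\<^sub>R g s) = 0"
proof -
  have C0: "C \<ge> 0"
  proof (rule ccontr)
    assume "\<not> C \<ge> 0"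
    then have "C * exp (- \<phi> s) < 0" for s by (simp add: mult_neg_pos)
    with bnd have "AE s::real in lborel. False"
      by (elim AE_mp) (intro AE_I2 impI, metis less_le_trans norm_ge_zero not_le)
    then have "ae_filter (lborel :: real measure) = bot" by (simp add: trivial_limit_def)
    then show False by (simp add: ae_filter_eq_bot_iff)
  qed
  have bndC: "AE s in lborel. norm (g s) \<le> C"
    using bnd
  proof eventually_elim
    case (elim s)
    have "C * exp (- \<phi> s) \<le> C * 1" using C0 \<phi>0[of s] by (intro mult_left_mono) auto
    with elim show ?case by simp
  qed
  define I where "I = (LINT s|lborel. cauchy_weight s *\<^sub>R g s)"
  define m where "m = (\<lambda>N::nat. LINT s|lborel. cauchy_weight s * min (\<phi> s) N)"
  have key: "norm I \<le> C * (pi + 1) * exp (3 - m N / pi)" for N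
  proof -
    define \<phi>N where "\<phi>N = (\<lambda>s. min (\<phi> s) N)"
    have [measurable]: "\<phi>N \<in> borel_measurable borel" unfolding \<phi>N_def by measurable
    have \<phi>N: "\<phi>N s \<in> {0..real N}" for s using \<phi>0[of s] by (auto simp: \<phi>N_def)
    obtain c where c: "\<And>n::nat. continuous_on UNIV (c n)" "\<And>n x. c n x \<in> {0..real N}"
      "AE x in lborel. (\<lambda>n. c n x) \<longlonglongrightarrow> \<phi>N x"
      using bounded_measurable_limit_continuous[of \<phi>N 0 "real N"] \<phi>N by auto
    \<comment> \<open>The cutoff makes the approximants vanish near infinity, as \<open>cayley_approx\<close> requires.\<close>
    define d where "d = (\<lambda>n s. c n s * max 0 (min 1 (real n - \<bar>s\<bar>)))"
    have dcont: "continuous_on UNIV (d n)" for n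
      unfolding d_def by (intro continuous_intros c(1))
    have [measurable]: "d n \<in> borel_measurable borel" for n
      using dcont by (rule borel_measurable_continuous_onI)
    have d_range: "0 \<le> d n s" "d n s \<le> N" for n s
    proof -
      show "0 \<le> d n s" using c(2)[of n s] by (simp add: d_def)
      have "d n s \<le> real N * 1" unfolding d_def using c(2)[of n s] by (intro mult_mono) auto
      then show "d n s \<le> N" by simp
    qed
    have dlim: "AE s in lborel. (\<lambda>n. d n s) \<longlonglongrightarrow> \<phi>N s"
      using c(3)
    proof eventually_elim
      case (elim s)
      have "\<forall>\<^sub>F n in sequentially. c n s = d n s"
        using eventually_ge_at_top[of "nat \<lceil>\<bar>s\<bar>\<rceil> + 1"]
      proof eventually_elim
        case (elim n)
        then have "\<bar>s\<bar> + 1 \<le> real n" by linarith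
        then show ?case by (simp add: d_def)
      qed
      then show ?case using elim by (rule Lim_transform_eventually[rotated])
    qed
    have lim1: "(\<lambda>n. LINT s|lborel. cauchy_weight s * d n s) \<longlonglongrightarrow> (LINT s|lborel. cauchy_weight s * \<phi>N s)"
    proof (rule integral_dominated_convergence)
      show "integrable lborel (\<lambda>s. cauchy_weight s * real N)" using integrable_cauchy_weight by simp
      show "AE s in lborel. (\<lambda>n. cauchy_weight s * d n s) \<longlonglongrightarrow> cauchy_weight s * \<phi>N s"
        using dlim by eventually_elim (intro tendsto_intros)
    qed (use d_range in \<open>auto intro!: mult_left_mono\<close>)
    have lim2: "(\<lambda>n. LINT s|lborel. cauchy_weight s * exp (d n s - \<phi>N s)) \<longlonglongrightarrow> (LINT s|lborel. cauchy_weight s * exp (\<phi>N s - \<phi>N s))"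
    proof (rule integral_dominated_convergence)
      show "integrable lborel (\<lambda>s. cauchy_weight s * exp (real N))" using integrable_cauchy_weight by simp
      show "AE s in lborel. (\<lambda>n. cauchy_weight s * exp (d n s - \<phi>N s)) \<longlonglongrightarrow> cauchy_weight s * exp (\<phi>N s - \<phi>N s)"
        using dlim by eventually_elim (intro tendsto_intros)
      show "AE s in lborel. norm (cauchy_weight s * exp (d n s - \<phi>N s)) \<le> cauchy_weight s * exp (real N)" for n
      proof (rule AE_I2)
        fix s
        have "d n s - \<phi>N s \<le> N" using d_range[of n s] \<phi>N[of s] by simp
        then show "norm (cauchy_weight s * exp (d n s - \<phi>N s)) \<le> cauchy_weight s * exp (real N)"
          by (simp add: mult_left_mono)
      qed
    qed measurable
    have mN: "(LINT s|lborel. cauchy_weight s * \<phi>N s) = m N" by (simp add: m_def \<phi>N_def)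
    have "\<forall>\<^sub>F n in sequentially. (LINT s|lborel. cauchy_weight s * d n s) > m N - 1"
      using lim1 unfolding mN by (rule order_tendstoD) simp
    moreover have "\<forall>\<^sub>F n in sequentially. (LINT s|lborel. cauchy_weight s * exp (d n s - \<phi>N s)) < pi + 1"
      using lim2 by (rule order_tendstoD) (simp add: integral_cauchy_weight)
    ultimately have "\<forall>\<^sub>F n in sequentially. (LINT s|lborel. cauchy_weight s * d n s) > m N - 1 \<and>
        (LINT s|lborel. cauchy_weight s * exp (d n s - \<phi>N s)) < pi + 1"
      by eventually_elim simp
    then obtain n where n1: "(LINT s|lborel. cauchy_weight s * d n s) > m N - 1"
      and n2: "(LINT s|lborel. cauchy_weight s * exp (d n s - \<phi>N s)) < pi + 1"
      by (auto simp: eventually_sequentially)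
    obtain Q where Q: "\<And>s. \<bar>d n s - Re (poly Q (cayley (of_real s)))\<bar> < 1"
      using cayley_approx[OF dcont[of n], of "real n" 1] by (auto simp: d_def)
    have int_d: "integrable lborel (\<lambda>s. cauchy_weight s *\<^sub>R d n s)"
      by (rule integrable_cauchy_weight_scaleR[where M = N]) (use d_range in auto)
    have int_Q: "integrable lborel (\<lambda>s. cauchy_weight s *\<^sub>R Re (poly Q (cayley (of_real s))))"
    proof (rule integrable_cauchy_weight_scaleR[where M = "N + 1"])
      show "AE s in lborel. norm (Re (poly Q (cayley (complex_of_real s)))) \<le> real (N + 1)"
        proof (rule AE_I2)
          show "norm (Re (poly Q (cayley (complex_of_real s)))) \<le> real (N + 1)" for s
            using Q[of s] d_range[of n s] by (simp add: abs_less_iff abs_le_iff)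
        qed
    qed measurable
    have "m N - 1 - pi < (LINT s|lborel. cauchy_weight s * d n s) - (LINT s|lborel. cauchy_weight s)"
      using n1 by (simp add: integral_cauchy_weight)
    also have "\<dots> = (LINT s|lborel. cauchy_weight s * d n s - cauchy_weight s)"
      using int_d integrable_cauchy_weight by simp
    also have "\<dots> \<le> (LINT s|lborel. cauchy_weight s * Re (poly Q (cayley (of_real s))))"
    proof (rule integral_mono)
      show "integrable lborel (\<lambda>s. cauchy_weight s * d n s - cauchy_weight s)"
        using int_d integrable_cauchy_weight by simp
      show "integrable lborel (\<lambda>s. cauchy_weight s * Re (poly Q (cayley (of_real s))))" using int_Q by simp
      fix s
      have "cauchy_weight s * (d n s - 1) \<le> cauchy_weight s * Re (poly Q (cayley (of_real s)))"
        using Q[of s] by (intro mult_left_mono) (auto simp: abs_less_iff)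
      then show "cauchy_weight s * d n s - cauchy_weight s \<le> cauchy_weight s * Re (poly Q (cayley (of_real s)))"
        by (simp add: right_diff_distrib)
    qed
    also have "\<dots> = pi * Re (poly Q 0)" by (rule integral_Re_poly_cayley)
    finally have Q0: "m N / pi - 2 < Re (poly Q 0)"
    proof -
      assume "m N - 1 - pi < pi * Re (poly Q 0)"
      moreover have "1 < pi" using pi_gt3 by simp
      ultimately have "m N - 2 * pi < pi * Re (poly Q 0)" by simp
      then show ?thesis by (simp add: field_simps)
    qed
    have "exp (Re (poly Q 0)) * norm I = norm (LINT s|lborel. cauchy_weight s *\<^sub>R (g s * exp (poly Q (cayley (of_real s)))))"
      using arg_cong[where f = norm, OF integral_weighted_exp_poly[OF g bndC moments, of Q]] by (simp add: I_def norm_mult)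
    also have "\<dots> \<le> (LINT s|lborel. C * exp 1 * (cauchy_weight s * exp (d n s - \<phi>N s)))"
    proof (rule integral_norm_bound_integral_AE)
      show "integrable lborel (\<lambda>s. cauchy_weight s *\<^sub>R (g s * exp (poly Q (cayley (complex_of_real s)))))"
      proof (rule integrable_weighted_mult[OF g bndC moments])
        show "norm (exp (poly Q (cayley (complex_of_real s)))) \<le> exp (\<Sum>i\<le>degree Q. norm (coeff Q i))" for s
          using norm_poly_le_unit_disc[of "cayley (of_real s)" Q] complex_Re_le_cmod[of "poly Q (cayley (of_real s))"]
          by (simp add: norm_cayley_of_real)
      qed auto
      have "integrable lborel (\<lambda>s. cauchy_weight s *\<^sub>R exp (d n s - \<phi>N s))"
      proof (rule integrable_cauchy_weight_scaleR[where M = "exp N"])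
        show "AE s in lborel. norm (exp (d n s - \<phi>N s)) \<le> exp (real N)"
        proof (rule AE_I2)
          show "norm (exp (d n s - \<phi>N s)) \<le> exp (real N)" for s
            using d_range[of n s] \<phi>N[of s] by simp
        qed
      qed measurable
      then show "integrable lborel (\<lambda>s. C * exp 1 * (cauchy_weight s * exp (d n s - \<phi>N s)))" by simp
      show "AE s in lborel. norm (cauchy_weight s *\<^sub>R (g s * exp (poly Q (cayley (complex_of_real s))))) \<le> C * exp 1 * (cauchy_weight s * exp (d n s - \<phi>N s))"
        using bnd
      proof eventually_elim
        case (elim s)
        have "norm (g s * exp (poly Q (cayley (complex_of_real s)))) \<le> (C * exp (- \<phi> s)) * exp (d n s + 1)"
          unfolding norm_mult norm_exp_eq_Re using elim Q[of s] C0 by (intro mult_mono) (auto simp: abs_less_iff)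
        also have "\<dots> = C * exp 1 * exp (d n s - \<phi> s)" by (simp add: exp_add exp_diff exp_minus field_simps)
        also have "\<dots> \<le> C * exp 1 * exp (d n s - \<phi>N s)"
          using C0 by (intro mult_left_mono) (auto simp: \<phi>N_def)
        finally have "cauchy_weight s * norm (g s * exp (poly Q (cayley (complex_of_real s)))) \<le> cauchy_weight s * (C * exp 1 * exp (d n s - \<phi>N s))"
          by (rule mult_left_mono) simp
        then show ?case by (simp add: mult_ac)
      qed
    qed
    also have "\<dots> = C * exp 1 * (LINT s|lborel. cauchy_weight s * exp (d n s - \<phi>N s))" by simp
    also have "\<dots> \<le> C * exp 1 * (pi + 1)" using n2 C0 by (intro mult_left_mono) auto
    finally have "norm I \<le> C * exp 1 * (pi + 1) * exp (- Re (poly Q 0))"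
      by (simp add: exp_minus field_simps)
    also have "\<dots> \<le> C * exp 1 * (pi + 1) * exp (- (m N / pi - 2))"
      using Q0 C0 by (intro mult_left_mono) auto
    also have "\<dots> = C * (pi + 1) * exp (3 - m N / pi)"
    proof -
      have "exp 1 * exp (- (m N / pi - 2)) = exp (3 - m N / pi)" by (simp add: exp_add[symmetric])
      then show ?thesis by (metis (no_types, opaque_lifting) mult.assoc mult.commute)
    qed
    finally show ?thesis .
  qed
  have m_lim: "filterlim m at_top sequentially"
  proof -
    have int_m: "integrable lborel (\<lambda>s. cauchy_weight s *\<^sub>R min (\<phi> s) (real N))" for N
      by (rule integrable_cauchy_weight_scaleR[where M = "real N"]) (use \<phi>0 in \<open>auto intro!: AE_I2\<close>)
    have "(\<lambda>N. \<integral>\<^sup>+ s. ennreal (cauchy_weight s * min (\<phi> s) (real N)) \<partial>lborel) \<longlonglongrightarrow> (\<integral>\<^sup>+ s. ennreal (cauchy_weight s * \<phi> s) \<partial>lborel)"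
    proof (rule nn_integral_LIMSEQ)
      show "incseq (\<lambda>N s. ennreal (cauchy_weight s * min (\<phi> s) (real N)))"
        by (auto simp: incseq_def le_fun_def intro!: ennreal_leI mult_left_mono)
      fix s
      have "\<forall>\<^sub>F N in sequentially. ennreal (cauchy_weight s * min (\<phi> s) (real N)) = ennreal (cauchy_weight s * \<phi> s)"
        using eventually_ge_at_top[of "nat \<lceil>\<phi> s\<rceil>"]
        by eventually_elim (simp add: nat_le_iff ceiling_le_iff min_def)
      then show "(\<lambda>N. ennreal (cauchy_weight s * min (\<phi> s) (real N))) \<longlonglongrightarrow> ennreal (cauchy_weight s * \<phi> s)"
        by (rule tendsto_eventually)
    qed measurable
    then have lim: "(\<lambda>N. ennreal (m N)) \<longlonglongrightarrow> \<infinity>"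
      using int_m \<phi>0 unfolding div m_def by (subst nn_integral_eq_integral[symmetric]) auto
    show ?thesis
      unfolding filterlim_at_top
    proof
      fix Z
      have "\<forall>\<^sub>F N in sequentially. ennreal (m N) > ennreal Z" using lim by (rule order_tendstoD) simp
      then show "\<forall>\<^sub>F N in sequentially. m N \<ge> Z"
        by eventually_elim (meson ennreal_leI leI not_le order.strict_implies_order)
    qed
  qed
  have "(\<lambda>N. C * (pi + 1) * exp (3 - m N / pi)) \<longlonglongrightarrow> C * (pi + 1) * 0"
  proof (intro tendsto_mult tendsto_const)
    have "filterlim (\<lambda>N. (- 1 / pi) * m N) at_bot sequentially"
      by (rule filterlim_tendsto_neg_mult_at_bot[OF tendsto_const _ m_lim]) simp
    then have "(\<lambda>N. exp ((- 1 / pi) * m N)) \<longlonglongrightarrow> 0"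
      by (rule filterlim_compose[OF exp_at_bot])
    then have "(\<lambda>N. exp 3 * exp ((- 1 / pi) * m N)) \<longlonglongrightarrow> exp 3 * 0"
      by (intro tendsto_mult tendsto_const)
    then show "(\<lambda>N. exp (3 - m N / pi)) \<longlonglongrightarrow> 0"
      by (simp add: exp_diff exp_minus divide_inverse mult.commute)
  qed
  then have "norm I \<le> 0" using key by (intro LIMSEQ_le_const[of _ _ "norm I"]) auto
  then show ?thesis by (simp add: I_def)
qed

section \<open>Gaussians and uniqueness\<close>

lemma
  fixes f :: "'a::euclidean_space \<Rightarrow> real \<Rightarrow> complex"
  assumes f: "\<And>b. b \<in> Basis \<Longrightarrow> integrable lborel (f b)"
  shows integrable_lborel_prod_coordinates: "integrable lborel (\<lambda>x::'a. \<Prod>b\<in>Basis. f b (x \<bullet> b))"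
    and integral_lborel_prod_coordinates: "(LINT x|lborel. (\<Prod>b\<in>Basis. f b ((x::'a) \<bullet> b))) = (\<Prod>b\<in>Basis. LINT u|lborel. f b u)"
proof -
  interpret finite_product_sigma_finite "\<lambda>_::'a. lborel :: real measure" Basis
    by unfold_locales auto
  have [measurable]: "f b \<in> borel_measurable borel" if "b \<in> Basis" for b
    using borel_measurable_integrable[OF f[OF that]] by simp
  have coord: "(\<Sum>b'\<in>Basis. u b' *\<^sub>R b') \<bullet> b = u b" if "b \<in> (Basis :: 'a set)" for u b
    using that by (simp add: inner_sum_left inner_Basis if_distrib cong: if_cong)
  have prod_eq: "(\<Prod>b\<in>Basis. f b ((\<Sum>b'\<in>Basis. u b' *\<^sub>R b') \<bullet> b)) = (\<Prod>b\<in>Basis. f b (u b))" for u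
    by (intro prod.cong refl) (simp add: coord)
  have [measurable]: "(\<lambda>x::'a. \<Prod>b\<in>Basis. f b (x \<bullet> b)) \<in> borel_measurable borel"
    by (intro borel_measurable_prod) measurable
  have [measurable]: "(\<lambda>u. \<Sum>b\<in>Basis. u b *\<^sub>R b) \<in> measurable (\<Pi>\<^sub>M b\<in>Basis. lborel) (borel :: 'a measure)"
    by measurable
  show "integrable lborel (\<lambda>x::'a. \<Prod>b\<in>Basis. f b (x \<bullet> b))"
    by (subst lborel_eq, subst integrable_distr_eq)
       (auto simp only: prod_eq intro!: product_integrable_prod f, measurable)
  show "(LINT x|lborel. (\<Prod>b\<in>Basis. f b ((x::'a) \<bullet> b))) = (\<Prod>b\<in>Basis. LINT u|lborel. f b u)"
    by (subst lborel_eq, subst integral_distr)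
       (auto simp only: prod_eq intro!: product_integral_prod f, measurable)
qed

abbreviation fourier_char :: "real \<Rightarrow> complex" where
  "fourier_char r \<equiv> exp (- (2 * of_real pi * \<i> * of_real r))"

lemma
  assumes c: "c > 0"
  shows integrable_gauss_fourier_real: "integrable lborel (\<lambda>u. fourier_char (x * u) * of_real (exp (- c * u\<^sup>2)))"
    and gauss_fourier_real: "(LINT u|lborel. fourier_char (x * u) * of_real (exp (- c * u\<^sup>2))) = of_real (sqrt (pi / c) * exp (- pi\<^sup>2 * x\<^sup>2 / c))"
proof -
  define k where "k = 1 / sqrt (2 * c)"
  have k: "k > 0" "k\<^sup>2 = 1 / (2 * c)" using c by (simp_all add: k_def power_divide)
  define t where "t = - 2 * pi * x * k"
  define F where "F = (\<lambda>u. fourier_char (x * u) * complex_of_real (exp (- c * u\<^sup>2)))"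
  have F: "F (0 + k * v) = of_real (sqrt (2 * pi)) * (std_normal_density v *\<^sub>R iexp (t * v))" for v
  proof -
    have "c * (k * v)\<^sup>2 = v\<^sup>2 / 2" using c k by (simp add: power_mult_distrib)
    then show ?thesis by (simp add: F_def t_def std_normal_density_def scaleR_conv_of_real algebra_simps)
  qed
  have int: "integrable lborel (\<lambda>v. std_normal_density v *\<^sub>R iexp (t * v))"
  proof (rule Bochner_Integration.integrable_bound)
    show "integrable lborel std_normal_density" by simp
    show "AE v in lborel. norm (std_normal_density v *\<^sub>R iexp (t * v)) \<le> norm (std_normal_density v)"
      by (simp add: norm_exp_i_times)
  qed measurable
  have "has_bochner_integral lborel (\<lambda>v. std_normal_density v *\<^sub>R iexp (t * v)) (of_real (exp (- (t\<^sup>2) / 2)))"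
  proof -
    have "(LINT v|lborel. std_normal_density v *\<^sub>R iexp (t * v)) = char std_normal_distribution t"
      unfolding char_def by (subst integral_density) auto
    then show ?thesis using int by (simp add: has_bochner_integral_iff char_std_normal_distribution)
  qed
  then have "has_bochner_integral lborel (\<lambda>v. F (0 + k * v)) (of_real (sqrt (2 * pi)) * of_real (exp (- (t\<^sup>2) / 2)))"
    unfolding F by (rule has_bochner_integral_mult_right)
  also have "of_real (sqrt (2 * pi)) * of_real (exp (- (t\<^sup>2) / 2)) = complex_of_real (sqrt (pi / c) * exp (- pi\<^sup>2 * x\<^sup>2 / c)) /\<^sub>R \<bar>k\<bar>"
  proof -
    have "sqrt (2 * pi) = sqrt (pi / c) / k"
      using c by (simp add: k_def real_sqrt_mult[symmetric] real_sqrt_divide) (simp add: real_sqrt_mult)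
    moreover have "t\<^sup>2 / 2 = pi\<^sup>2 * x\<^sup>2 / c" using k by (simp add: t_def power_mult_distrib)
    moreover have "complex_of_real (r / k) * of_real e = of_real (r * e) /\<^sub>R \<bar>k\<bar>" for r e
      using k(1) by (simp add: scaleR_conv_of_real field_simps)
    ultimately show ?thesis by simp
  qed
  finally have "has_bochner_integral lborel F (complex_of_real (sqrt (pi / c) * exp (- pi\<^sup>2 * x\<^sup>2 / c)))"
    using k(1) lborel_has_bochner_integral_real_affine_iff[of k F _ 0] by simp
  then show "integrable lborel (\<lambda>u. fourier_char (x * u) * of_real (exp (- c * u\<^sup>2)))"
    "(LINT u|lborel. fourier_char (x * u) * of_real (exp (- c * u\<^sup>2))) = of_real (sqrt (pi / c) * exp (- pi\<^sup>2 * x\<^sup>2 / c))"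
    by (auto simp: F_def has_bochner_integral_iff)
qed

text \<open>The Gaussian and the character are both products over the coordinates, so this is the
  one-dimensional case, which in turn is the characteristic function of the standard normal
  distribution after rescaling.\<close>
lemma
  fixes x :: "'a::euclidean_space"
  assumes c: "c > 0"
  shows integrable_gauss_fourier: "integrable lborel (\<lambda>y. fourier_char (x \<bullet> y) * of_real (exp (- c * (norm y)\<^sup>2)))"
    and gauss_fourier: "(LINT y|lborel. fourier_char (x \<bullet> y) * of_real (exp (- c * (norm y)\<^sup>2))) = of_real (sqrt (pi / c) ^ DIM('a) * exp (- pi\<^sup>2 * (norm x)\<^sup>2 / c))"
proof -
  have nrm: "(norm y)\<^sup>2 = (\<Sum>b\<in>Basis. (y \<bullet> b)\<^sup>2)" for y :: 'a
    by (subst power2_norm_eq_inner, subst euclidean_inner) (simp add: power2_eq_square)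
  have eq: "fourier_char (x \<bullet> y) * of_real (exp (- c * (norm y)\<^sup>2)) =
    (\<Prod>b\<in>Basis. fourier_char ((x \<bullet> b) * (y \<bullet> b)) * complex_of_real (exp (- c * (y \<bullet> b)\<^sup>2)))" for y
    unfolding nrm euclidean_inner[of x y]
    by (simp add: prod.distrib exp_sum[symmetric] sum_distrib_left sum_negf of_real_prod[symmetric])
  show "integrable lborel (\<lambda>y. fourier_char (x \<bullet> y) * of_real (exp (- c * (norm y)\<^sup>2)))"
    unfolding eq by (intro integrable_lborel_prod_coordinates integrable_gauss_fourier_real c)
  show "(LINT y|lborel. fourier_char (x \<bullet> y) * of_real (exp (- c * (norm y)\<^sup>2))) = of_real (sqrt (pi / c) ^ DIM('a) * exp (- pi\<^sup>2 * (norm x)\<^sup>2 / c))"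
  proof -
    have "(LINT y|lborel. fourier_char (x \<bullet> y) * of_real (exp (- c * (norm y)\<^sup>2))) =
      (\<Prod>b\<in>Basis. LINT u|lborel. fourier_char ((x \<bullet> b) * u) * complex_of_real (exp (- c * u\<^sup>2)))"
      unfolding eq by (rule integral_lborel_prod_coordinates) (rule integrable_gauss_fourier_real[OF c])
    also have "\<dots> = of_real (\<Prod>b\<in>(Basis::'a set). sqrt (pi / c) * exp (- pi\<^sup>2 * (x \<bullet> b)\<^sup>2 / c))"
      by (simp only: gauss_fourier_real[OF c] of_real_prod)
    also have "(\<Prod>b\<in>(Basis::'a set). sqrt (pi / c) * exp (- pi\<^sup>2 * (x \<bullet> b)\<^sup>2 / c)) = sqrt (pi / c) ^ DIM('a) * exp (- pi\<^sup>2 * (norm x)\<^sup>2 / c)"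
      by (simp only: prod.distrib nrm sum_distrib_left sum_divide_distrib exp_sum[OF finite_Basis] prod_constant)
    finally show ?thesis .
  qed
qed

lemma integral_lborel_affine:
  fixes f :: "'a::euclidean_space \<Rightarrow> complex"
  assumes c: "c \<noteq> 0" and [measurable]: "f \<in> borel_measurable borel"
  shows "(LINT x|lborel. f x) = \<bar>c\<bar> ^ DIM('a) *\<^sub>R (LINT x|lborel. f (t + c *\<^sub>R x))"
  by (subst lborel_affine[OF c, of t]) (simp add: integral_density integral_distr)

lemma integral_lborel_translate:
  fixes f :: "'a::euclidean_space \<Rightarrow> complex"
  assumes "f \<in> borel_measurable borel"
  shows "(LINT x|lborel. f (x + z)) = (LINT x|lborel. f x)"
  using integral_lborel_affine[of 1 f z] assms by (simp add: add.commute)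

lemma integrable_lborel_translate:
  fixes f :: "'a::euclidean_space \<Rightarrow> 'b::{banach, second_countable_topology}"
  assumes f: "integrable lborel f" shows "integrable lborel (\<lambda>x. f (x + z))"
proof -
  have [measurable]: "f \<in> borel_measurable borel" using f borel_measurable_integrable by auto
  have "integrable (distr lborel borel ((+) z)) f" using f by (simp only: lborel_distr_plus)
  then show ?thesis by (subst (asm) integrable_distr_eq) (auto simp: add.commute)
qed

lemma integrable_gauss: "c > 0 \<Longrightarrow> integrable lborel (\<lambda>x. exp (- c * (norm (x - b :: 'a::euclidean_space))\<^sup>2))"
proof -
  assume c: "c > 0"
  have "integrable lborel (\<lambda>y. fourier_char ((0::'a) \<bullet> y) * of_real (exp (- c * (norm y)\<^sup>2)))"
    by (rule integrable_gauss_fourier[OF c])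
  then have "integrable lborel (\<lambda>y::'a. exp (- c * (norm y)\<^sup>2))"
    by (simp flip: complex_of_real_integrable_eq)
  from integrable_lborel_translate[OF this, of "- b"] show ?thesis by simp
qed

lemma integral_gauss_pos: "(LINT x|lborel. exp (- (norm (x::'a::euclidean_space))\<^sup>2)) > 0"
proof -
  have "(LINT y|lborel. fourier_char ((0::'a) \<bullet> y) * of_real (exp (- 1 * (norm y)\<^sup>2))) = of_real (sqrt (pi / 1) ^ DIM('a) * exp (- pi\<^sup>2 * (norm (0::'a))\<^sup>2 / 1))"
    by (rule gauss_fourier) simp
  then have "complex_of_real (LINT y|lborel. (exp (- (norm (y::'a))\<^sup>2))) = of_real (sqrt pi ^ DIM('a))"
    by (simp flip: integral_complex_of_real)
  then show ?thesis by (simp only: of_real_eq_iff) simp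
qed

text \<open>Convolving \<open>\<phi>\<close> with narrower and narrower Gaussians gives back \<open>\<phi>\<close> up to a factor, and by Fubini every
  such convolution is orthogonal to \<open>F\<close>.\<close>
lemma integral_continuous_eq_0_of_gauss:
  fixes F :: "'a::euclidean_space \<Rightarrow> complex" and \<phi> :: "'a \<Rightarrow> real"
  assumes F: "integrable lborel F"
    and orth: "\<And>c b. c > 0 \<Longrightarrow> (LINT x|lborel. F x * of_real (exp (- c * (norm (x - b))\<^sup>2))) = 0"
    and \<phi>: "continuous_on UNIV \<phi>" "\<And>x. \<bar>\<phi> x\<bar> \<le> B"
  shows "(LINT x|lborel. F x * of_real (\<phi> x)) = 0"
proof -
  have [measurable]: "F \<in> borel_measurable borel" using F borel_measurable_integrable by auto
  have [measurable]: "\<phi> \<in> borel_measurable borel" using \<phi>(1) by (rule borel_measurable_continuous_onI)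
  have B0: "B \<ge> 0" using \<phi>(2)[of 0] by linarith
  define \<gamma> where "\<gamma> = (\<lambda>u::'a. exp (- (norm u)\<^sup>2))"
  have [measurable]: "\<gamma> \<in> borel_measurable borel" unfolding \<gamma>_def by measurable
  have int_\<gamma>: "integrable lborel \<gamma>" using integrable_gauss[of 1 0] by (simp add: \<gamma>_def)
  define Z where "Z = (LINT u|lborel. \<gamma> u)"
  have Z: "Z > 0" using integral_gauss_pos by (simp add: Z_def \<gamma>_def)
  define \<Phi> where "\<Phi> = (\<lambda>n x. LINT u|lborel. complex_of_real (\<phi> (x + (1 / Suc n) *\<^sub>R u) * \<gamma> u))"
  have bnd: "norm (complex_of_real (\<phi> (x + (1 / Suc n) *\<^sub>R u) * \<gamma> u)) \<le> B * \<gamma> u" for n x u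
    using \<phi>(2) by (simp add: norm_mult \<gamma>_def mult_right_mono)
  have \<Phi>_lim: "(\<lambda>n. \<Phi> n x) \<longlonglongrightarrow> (LINT u|lborel. complex_of_real (\<phi> x * \<gamma> u))" for x
    unfolding \<Phi>_def
  proof (rule integral_dominated_convergence)
    show "integrable lborel (\<lambda>u. B * \<gamma> u)" using int_\<gamma> by simp
    show "AE u in lborel. norm (complex_of_real (\<phi> (x + (1 / Suc n) *\<^sub>R u) * \<gamma> u)) \<le> B * \<gamma> u" for n
      using bnd by simp
    show "AE u in lborel. (\<lambda>n. complex_of_real (\<phi> (x + (1 / Suc n) *\<^sub>R u) * \<gamma> u)) \<longlonglongrightarrow> complex_of_real (\<phi> x * \<gamma> u)"
    proof (rule AE_I2)
      fix u
      have "(\<lambda>n. x + (1 / Suc n) *\<^sub>R u) \<longlonglongrightarrow> x + 0 *\<^sub>R u"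
        by (intro tendsto_intros LIMSEQ_Suc lim_1_over_n[THEN LIMSEQ_Suc])
      then have "(\<lambda>n. \<phi> (x + (1 / Suc n) *\<^sub>R u)) \<longlonglongrightarrow> \<phi> (x + 0 *\<^sub>R u)"
        using \<phi>(1) by (intro isCont_tendsto_compose[of _ \<phi>]) (auto simp: continuous_on_eq_continuous_at)
      then show "(\<lambda>n. complex_of_real (\<phi> (x + (1 / Suc n) *\<^sub>R u) * \<gamma> u)) \<longlonglongrightarrow> complex_of_real (\<phi> x * \<gamma> u)"
        by (intro tendsto_intros) simp
    qed
  qed measurable
  have \<Phi>_bnd: "norm (\<Phi> n x) \<le> B * Z" for n x
  proof -
    have "norm (\<Phi> n x) \<le> (LINT u|lborel. B * \<gamma> u)"
      unfolding \<Phi>_def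
    proof (rule Bochner_Integration.integral_norm_bound_integral)
      show "integrable lborel (\<lambda>u. B * \<gamma> u)" using int_\<gamma> by simp
      then show "integrable lborel (\<lambda>u. complex_of_real (\<phi> (x + (1 / Suc n) *\<^sub>R u) * \<gamma> u))"
        by (rule Bochner_Integration.integrable_bound) (use order_trans[OF bnd abs_ge_self] in \<open>auto intro!: AE_I2\<close>)
    qed (rule bnd)
    then show ?thesis by (simp add: Z_def)
  qed
  have [measurable]: "\<Phi> n \<in> borel_measurable borel" for n
    unfolding \<Phi>_def by measurable
  have lim: "(\<lambda>n. LINT x|lborel. F x * \<Phi> n x) \<longlonglongrightarrow> (LINT x|lborel. F x * (LINT u|lborel. complex_of_real (\<phi> x * \<gamma> u)))"
  proof (rule integral_dominated_convergence)
    show "integrable lborel (\<lambda>x. (B * Z) * norm (F x))" using F by simp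
    show "AE x in lborel. norm (F x * \<Phi> n x) \<le> B * Z * norm (F x)" for n
      using mult_left_mono[OF \<Phi>_bnd norm_ge_zero] by (intro AE_I2) (simp add: norm_mult mult.commute[of "B * Z"])
    show "AE x in lborel. (\<lambda>n. F x * \<Phi> n x) \<longlonglongrightarrow> F x * (LINT u|lborel. complex_of_real (\<phi> x * \<gamma> u))"
      by (intro AE_I2 tendsto_intros \<Phi>_lim)
  qed measurable
  have zero: "(LINT x|lborel. F x * \<Phi> n x) = 0" for n
  proof -
    define N where "N = real (Suc n)"
    have N: "N > 0" by (simp add: N_def)
    define k where "k = (\<lambda>x a. complex_of_real (exp (- N\<^sup>2 * (norm (x - a :: 'a))\<^sup>2)))"
    have [measurable]: "(\<lambda>(x, a). k x a) \<in> borel_measurable (borel \<Otimes>\<^sub>M borel)"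
      unfolding k_def by measurable
    have intk: "integrable lborel (\<lambda>a. k x a)" "(LINT a|lborel. norm (k x a)) = (LINT a|lborel. norm (k 0 a))" for x
    proof -
      show "integrable lborel (\<lambda>a. k x a)"
        unfolding k_def complex_of_real_integrable_eq norm_minus_commute[of x] using N by (intro integrable_gauss) auto
      have "(LINT a|lborel. complex_of_real (norm (k x a))) = (LINT a|lborel. complex_of_real (norm (k 0 a)))"
        by (subst integral_lborel_affine[of 1 _ x]) (auto simp: k_def)
      then show "(LINT a|lborel. norm (k x a)) = (LINT a|lborel. norm (k 0 a))" by simp
    qed
    \<comment> \<open>The substitution \<open>u = N (a - x)\<close> turns \<open>\<Phi>\<close> into a convolution with a Gaussian centred at \<open>x\<close>.\<close>
    have \<Phi>_eq: "\<Phi> n x = N ^ DIM('a) *\<^sub>R (LINT a|lborel. of_real (\<phi> a) * k x a)" for x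
    proof -
      have "\<Phi> n x = \<bar>N\<bar> ^ DIM('a) *\<^sub>R (LINT a|lborel. complex_of_real (\<phi> (x + (1 / Suc n) *\<^sub>R (- N *\<^sub>R x + N *\<^sub>R a)) * \<gamma> (- N *\<^sub>R x + N *\<^sub>R a)))"
        unfolding \<Phi>_def using N by (subst integral_lborel_affine[of N _ "- N *\<^sub>R x"]) auto
      also have "(\<lambda>a. complex_of_real (\<phi> (x + (1 / Suc n) *\<^sub>R (- N *\<^sub>R x + N *\<^sub>R a)) * \<gamma> (- N *\<^sub>R x + N *\<^sub>R a))) = (\<lambda>a. of_real (\<phi> a) * k x a)"
      proof
        fix a
        have "(1 / Suc n) *\<^sub>R (- N *\<^sub>R x + N *\<^sub>R a) = a - x"
        proof -
          have "(1 / Suc n) *\<^sub>R (- N *\<^sub>R x + N *\<^sub>R a) = (1 / Suc n * N) *\<^sub>R (a - x)"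
            by (simp add: scaleR_diff_right)
          also have "1 / Suc n * N = 1" by (simp add: N_def)
          finally show ?thesis by simp
        qed
        moreover have "norm (- N *\<^sub>R x + N *\<^sub>R a) = N * norm (x - a)"
        proof -
          have "- N *\<^sub>R x + N *\<^sub>R a = - (N *\<^sub>R (x - a))" by (simp add: scaleR_diff_right)
          then show ?thesis using N by (simp only: norm_minus_cancel norm_scaleR abs_of_pos)
        qed
        ultimately show "complex_of_real (\<phi> (x + (1 / Suc n) *\<^sub>R (- N *\<^sub>R x + N *\<^sub>R a)) * \<gamma> (- N *\<^sub>R x + N *\<^sub>R a)) = of_real (\<phi> a) * k x a"
          by (simp add: \<gamma>_def k_def power_mult_distrib)
      qed
      finally show ?thesis using N by simp
    qed
    have intp: "integrable (lborel \<Otimes>\<^sub>M lborel) (\<lambda>(x, a). F x * (of_real (\<phi> a) * k x a))"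
    proof (rule lborel_pair.Fubini_integrable)
      have le: "norm (F x * (of_real (\<phi> a) * k x a)) \<le> norm (F x) * B * norm (k x a)" for x a
        using mult_right_mono[OF mult_left_mono[OF \<phi>(2)[of a] norm_ge_zero[of "F x"]] norm_ge_zero[of "k x a"]]
        by (simp add: norm_mult mult.assoc)
      have int2: "integrable lborel (\<lambda>a. F x * (of_real (\<phi> a) * k x a))" for x
        by (rule Bochner_Integration.integrable_bound[of _ "\<lambda>a. norm (F x) * B * norm (k x a)"])
           (use intk(1)[of x] order_trans[OF le[of x] abs_ge_self] in \<open>auto intro!: AE_I2\<close>)
      then show "AE x in lborel. integrable lborel (\<lambda>a. case (x, a) of (x, a) \<Rightarrow> F x * (of_real (\<phi> a) * k x a))" by simp
      show "integrable lborel (\<lambda>x. LINT a|lborel. norm (case (x, a) of (x, a) \<Rightarrow> F x * (of_real (\<phi> a) * k x a)))"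
      proof (rule Bochner_Integration.integrable_bound)
        show "integrable lborel (\<lambda>x. norm (F x) * (B * (LINT a|lborel. norm (k 0 a))))" using F by simp
        show "AE x in lborel. norm (LINT a|lborel. norm (case (x, a) of (x, a) \<Rightarrow> F x * (of_real (\<phi> a) * k x a))) \<le> norm (norm (F x) * (B * (LINT a|lborel. norm (k 0 a))))"
        proof (rule AE_I2)
          fix x
          have "(LINT a|lborel. norm (F x * (of_real (\<phi> a) * k x a))) \<le> (LINT a|lborel. norm (F x) * B * norm (k x a))"
            using int2[of x] intk(1)[of x] le by (intro integral_mono) auto
          also have "\<dots> = norm (F x) * (B * (LINT a|lborel. norm (k 0 a)))" using intk(2)[of x] by simp
          finally show "norm (LINT a|lborel. norm (case (x, a) of (x, a) \<Rightarrow> F x * (of_real (\<phi> a) * k x a))) \<le> norm (norm (F x) * (B * (LINT a|lborel. norm (k 0 a))))"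
            by simp
        qed
      qed measurable
    qed measurable
    have "(LINT x|lborel. F x * \<Phi> n x) = N ^ DIM('a) *\<^sub>R (LINT x|lborel. LINT a|lborel. F x * (of_real (\<phi> a) * k x a))"
      by (simp add: \<Phi>_eq)
    also have "(LINT x|lborel. LINT a|lborel. F x * (of_real (\<phi> a) * k x a)) = (LINT a|lborel. LINT x|lborel. F x * (of_real (\<phi> a) * k x a))"
      using lborel_pair.Fubini_integral[OF intp] by simp
    also have "\<dots> = (LINT a|lborel. of_real (\<phi> a) * (LINT x|lborel. F x * k x a))"
      by (simp add: mult_ac flip: integral_mult_right_zero)
    also have "\<dots> = 0" using orth[of "N\<^sup>2"] N by (simp add: k_def)
    finally show ?thesis by simp
  qed
  have "(LINT x|lborel. F x * (LINT u|lborel. complex_of_real (\<phi> x * \<gamma> u))) = 0"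
    using lim unfolding zero by (simp add: LIMSEQ_const_iff)
  moreover have "(LINT u|lborel. complex_of_real (\<phi> x * \<gamma> u)) = of_real (\<phi> x) * of_real Z" for x
    by (simp only: integral_complex_of_real) (simp add: Z_def)
  ultimately have "(LINT x|lborel. F x * of_real (\<phi> x)) * of_real Z = 0"
    by (simp only: mult.assoc[symmetric] integral_mult_left_zero)
  then show ?thesis using Z by simp
qed

text \<open>By approximation, \<open>F\<close> is orthogonal to all bounded measurable functions, in particular to
  \<open>cnj (sgn F)\<close>; this makes its \<open>L\<^sup>1\<close> norm zero.\<close>
lemma AE_eq_0_of_gauss_integrable:
  fixes F :: "'a::euclidean_space \<Rightarrow> complex"
  assumes F: "integrable lborel F"
    and orth: "\<And>c b. c > 0 \<Longrightarrow> (LINT x|lborel. F x * of_real (exp (- c * (norm (x - b))\<^sup>2))) = 0"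
  shows "AE x in lborel. F x = 0"
proof -
  have [measurable]: "F \<in> borel_measurable borel" using F borel_measurable_integrable by auto
  have zero: "(LINT x|lborel. F x * of_real (h x)) = 0"
    if [measurable]: "h \<in> borel_measurable borel" and h: "\<And>x. h x \<in> {-1..1}" for h
  proof -
    obtain c where c: "\<And>n::nat. continuous_on UNIV (c n)" "\<And>n x. c n x \<in> {-1..1}"
      "AE x in lborel. (\<lambda>n. c n x) \<longlonglongrightarrow> h x"
      using bounded_measurable_limit_continuous[of h "-1" 1] h by auto
    have [measurable]: "c n \<in> borel_measurable borel" for n
      using c(1) by (rule borel_measurable_continuous_onI)
    have c1: "\<bar>c n x\<bar> \<le> 1" for n x using c(2)[of n x] by auto
    have "(\<lambda>n. LINT x|lborel. F x * of_real (c n x)) \<longlonglongrightarrow> (LINT x|lborel. F x * of_real (h x))"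
    proof (rule integral_dominated_convergence)
      show "integrable lborel (\<lambda>x. norm (F x))" using F by simp
      show "AE x in lborel. (\<lambda>n. F x * of_real (c n x)) \<longlonglongrightarrow> F x * of_real (h x)"
        using c(3) by eventually_elim (intro tendsto_intros)
      show "AE x in lborel. norm (F x * of_real (c n x)) \<le> norm (F x)" for n
        using c1 by (intro AE_I2) (simp add: norm_mult mult_left_le)
    qed measurable
    moreover have "(LINT x|lborel. F x * of_real (c n x)) = 0" for n
      by (rule integral_continuous_eq_0_of_gauss[OF F orth c(1) c1])
    ultimately show ?thesis by (simp add: LIMSEQ_const_iff)
  qed
  define S where "S = (\<lambda>x. sgn (F x))"
  have [measurable]: "S \<in> borel_measurable borel" unfolding S_def sgn_eq by measurable
  have S1: "\<bar>Re (S x)\<bar> \<le> 1" "\<bar>Im (S x)\<bar> \<le> 1" for x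
    using abs_Re_le_cmod[of "S x"] abs_Im_le_cmod[of "S x"] norm_sgn[of "F x"] by (auto simp: S_def split: if_splits)
  have eq: "of_real (norm (F x)) = F x * of_real (Re (S x)) - \<i> * (F x * of_real (Im (S x)))" for x
  proof -
    have "of_real (norm (F x)) = F x * cnj (S x)"
      using complex_norm_square[of "F x"] by (cases "F x = 0") (simp_all add: S_def sgn_eq power2_eq_square field_simps)
    also have "cnj (S x) = of_real (Re (S x)) - \<i> * of_real (Im (S x))" by (simp add: complex_eq_iff)
    finally show ?thesis by (simp add: algebra_simps)
  qed
  have int: "integrable lborel (\<lambda>x. F x * of_real (Re (S x)))" "integrable lborel (\<lambda>x. F x * of_real (Im (S x)))"
    using S1 by (auto intro!: Bochner_Integration.integrable_bound[OF F] AE_I2 simp: norm_mult mult_left_le)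
  have "(LINT x|lborel. F x * of_real (Re (S x))) = 0" "(LINT x|lborel. F x * of_real (Im (S x))) = 0"
    using S1 by (auto intro!: zero simp: abs_le_iff minus_le_iff)
  then have "(LINT x|lborel. complex_of_real (norm (F x))) = 0"
    unfolding eq using int by simp
  then have "(LINT x|lborel. norm (F x)) = 0" by simp
  then have "AE x in lborel. norm (F x) = 0"
    using F by (subst (asm) integral_nonneg_eq_0_iff_AE) auto
  then show ?thesis by simp
qed

text \<open>Multiplying \<open>F\<close> by one fixed Gaussian makes it integrable and keeps the hypothesis, because a product
  of two Gaussians is a multiple of a Gaussian (complete the square).  This covers bounded functions as
  well as square integrable ones.\<close>
lemma AE_eq_0_of_gauss:
  fixes F :: "'a::euclidean_space \<Rightarrow> complex"
  assumes F: "integrable lborel (\<lambda>x. F x * of_real (exp (- (norm x)\<^sup>2)))"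
    and orth: "\<And>c b. c > 0 \<Longrightarrow> (LINT x|lborel. F x * of_real (exp (- c * (norm (x - b))\<^sup>2))) = 0"
  shows "AE x in lborel. F x = 0"
proof -
  have "AE x in lborel. F x * of_real (exp (- (norm x)\<^sup>2)) = 0"
  proof (rule AE_eq_0_of_gauss_integrable[OF F])
    fix c :: real and b :: 'a assume c: "c > 0"
    define b' where "b' = (c / (1 + c)) *\<^sub>R b"
    have expo: "- (norm x)\<^sup>2 + - c * (norm (x - b))\<^sup>2 = - c / (1 + c) * (norm b)\<^sup>2 + - (1 + c) * (norm (x - b'))\<^sup>2" for x
    proof -
      have "(norm (x - b'))\<^sup>2 = (norm x)\<^sup>2 - 2 * (c / (1 + c)) * (x \<bullet> b) + (c / (1 + c))\<^sup>2 * (norm b)\<^sup>2"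
        unfolding b'_def power2_norm_eq_inner by (simp add: inner_diff inner_commute power2_eq_square)
      then have "(1 + c) * (norm (x - b'))\<^sup>2 = (1 + c) * (norm x)\<^sup>2 - 2 * ((1 + c) * (c / (1 + c))) * (x \<bullet> b) + (1 + c) * (c / (1 + c))\<^sup>2 * (norm b)\<^sup>2"
        by (simp only: distrib_left right_diff_distrib mult_ac)
      also have "(1 + c) * (c / (1 + c)) = c" using c by simp
      also have "(1 + c) * (c / (1 + c))\<^sup>2 = c * (c / (1 + c))" using c by (simp add: power2_eq_square)
      also have "c * (c / (1 + c)) = c - c / (1 + c)" using c by (simp add: field_simps)
      finally have "(1 + c) * (norm (x - b'))\<^sup>2 = (1 + c) * (norm x)\<^sup>2 - 2 * c * (x \<bullet> b) + (c - c / (1 + c)) * (norm b)\<^sup>2" .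
      moreover {
      have "(norm (x - b))\<^sup>2 = (norm x)\<^sup>2 - 2 * (x \<bullet> b) + (norm b)\<^sup>2"
        unfolding power2_norm_eq_inner by (simp add: inner_diff inner_commute)
      then have "c * (norm (x - b))\<^sup>2 = c * (norm x)\<^sup>2 - 2 * c * (x \<bullet> b) + c * (norm b)\<^sup>2"
        by (simp only: distrib_left right_diff_distrib mult_ac) }
      ultimately show ?thesis
        by (simp only: mult_minus_left minus_divide_left[symmetric] left_diff_distrib) (simp add: distrib_right)
    qed
    have "exp (- (norm x)\<^sup>2) * exp (- c * (norm (x - b))\<^sup>2) = exp (- c / (1 + c) * (norm b)\<^sup>2) * exp (- (1 + c) * (norm (x - b'))\<^sup>2)" for x
      by (simp only: exp_add[symmetric] expo)
    then have "F x * of_real (exp (- (norm x)\<^sup>2)) * of_real (exp (- c * (norm (x - b))\<^sup>2)) = of_real (exp (- c / (1 + c) * (norm b)\<^sup>2)) * (F x * of_real (exp (- (1 + c) * (norm (x - b'))\<^sup>2)))" for x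
      by (metis (no_types, lifting) mult.assoc mult.left_commute of_real_mult)
    then show "(LINT x|lborel. F x * of_real (exp (- (norm x)\<^sup>2)) * of_real (exp (- c * (norm (x - b))\<^sup>2))) = 0"
      using orth[of "1 + c" b'] c by (simp only: integral_mult_right_zero) simp
  qed
  then show ?thesis by simp
qed

section \<open>The multiplication formula for the Fourier transform on L2\<close>

text \<open>The passage to Borel functions permits restriction to lines: the restriction of a Lebesgue
  measurable function to a line may fail to be measurable.\<close>
lemma lebesgue_measurable_borel_version:
  fixes f :: "'a::euclidean_space \<Rightarrow> complex"
  assumes "f \<in> borel_measurable lebesgue"
  obtains g where "g \<in> borel_measurable borel" "AE x in lborel. f x = g x"
proof -
  have "(\<lambda>x. Re (f x)) \<in> borel_measurable lebesgue" "(\<lambda>x. Im (f x)) \<in> borel_measurable lebesgue"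
    using assms by measurable
  from this[THEN completion_ex_borel_measurable_real] obtain u v
    where uv: "u \<in> borel_measurable lborel" "AE x in lborel. Re (f x) = u x"
      "v \<in> borel_measurable lborel" "AE x in lborel. Im (f x) = v x" by blast
  show ?thesis
  proof (rule that)
    have [measurable]: "u \<in> borel_measurable borel" "v \<in> borel_measurable borel" using uv(1,3) by auto
    show "(\<lambda>x. complex_of_real (u x) + \<i> * of_real (v x)) \<in> borel_measurable borel"
      by measurable
    show "AE x in lborel. f x = complex_of_real (u x) + \<i> * of_real (v x)"
      using uv(2,4) by eventually_elim (simp add: complex_eq_iff)
  qed
qed

lemma AE_lebesgue_iff: "(AE x in lebesgue. P x) \<longleftrightarrow> (AE x in lborel. P x)"
  by (rule AE_completion_iff)

lemma fourier_L1_borel: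
  fixes F :: "real^'n \<Rightarrow> complex"
  assumes [measurable]: "F \<in> borel_measurable borel"
  shows "fourier_L1 F y = (LINT x|lborel. F x * fourier_char (x \<bullet> y))"
  unfolding fourier_L1_def by (rule integral_completion) measurable

lemma fourier_L1_cong_AE:
  fixes F :: "real^'n \<Rightarrow> complex"
  assumes "F \<in> borel_measurable lebesgue" "G \<in> borel_measurable borel" "AE x in lborel. F x = G x"
  shows "fourier_L1 F = fourier_L1 G"
proof
  fix y :: "real^'n"
  have [measurable]: "G \<in> borel_measurable lebesgue" using assms(2) by (simp add: measurable_completion)
  have e[measurable]: "(\<lambda>x. fourier_char (x \<bullet> y)) \<in> borel_measurable lebesgue"
    by (intro measurable_completion) measurable
  show "fourier_L1 F y = fourier_L1 G y"
    unfolding fourier_L1_def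
    using assms(1,3) by (intro integral_cong_AE) (auto simp: AE_lebesgue_iff elim: eventually_mono intro!: borel_measurable_times)
qed

lemma norm_fourier_kernel [simp]: "norm (exp (- (2 * of_real pi * \<i> * of_real r))) = 1"
  by (simp add: norm_exp_eq_Re)

lemma measurable_fourier_L1 [measurable]:
  fixes F :: "real^'n \<Rightarrow> complex"
  assumes [measurable]: "F \<in> borel_measurable borel"
  shows "fourier_L1 F \<in> borel_measurable borel"
  unfolding fourier_L1_borel[OF assms, abs_def] by measurable

lemma norm_fourier_L1_le:
  fixes F :: "real^'n \<Rightarrow> complex"
  assumes [measurable]: "F \<in> borel_measurable borel"
  shows "norm (fourier_L1 F y) \<le> (LINT x|lborel. norm (F x))"
  unfolding fourier_L1_borel[OF assms] using integral_norm_bound[of lborel "\<lambda>x. F x * fourier_char (x \<bullet> y)"]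
  by (simp add: norm_mult)

lemma integrable_mult_bounded:
  fixes f g :: "'a \<Rightarrow> complex"
  assumes "integrable M f" and [measurable]: "g \<in> borel_measurable M" and "\<And>x. norm (g x) \<le> B"
  shows "integrable M (\<lambda>x. f x * g x)" "integrable M (\<lambda>x. g x * f x)"
proof -
  have [measurable]: "f \<in> borel_measurable M" using assms(1) by auto
  show "integrable M (\<lambda>x. f x * g x)"
  proof (rule Bochner_Integration.integrable_bound)
    show "integrable M (\<lambda>x. B * norm (f x))" using assms(1) by simp
    show "AE x in M. norm (f x * g x) \<le> norm (B * norm (f x))"
      using order_trans[OF mult_right_mono[OF assms(3) norm_ge_zero] abs_ge_self]
      by (intro AE_I2) (simp add: norm_mult mult.commute)
  qed measurable
  then show "integrable M (\<lambda>x. g x * f x)" by (simp add: mult.commute)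
qed

lemma integrable_prod_mult:
  fixes f :: "'a::euclidean_space \<Rightarrow> complex" and g :: "'b::euclidean_space \<Rightarrow> complex"
  assumes f: "integrable lborel f" and g: "integrable lborel g"
  shows "integrable (lborel \<Otimes>\<^sub>M lborel) (\<lambda>(x, y). f x * g y)"
proof (rule lborel_pair.Fubini_integrable)
  have [measurable]: "f \<in> borel_measurable borel" "g \<in> borel_measurable borel" using assms borel_measurable_integrable by auto
  show "(\<lambda>(x, y). f x * g y) \<in> borel_measurable (lborel \<Otimes>\<^sub>M lborel)" by measurable
  show "integrable lborel (\<lambda>x. LINT y|lborel. norm (case (x, y) of (x, y) \<Rightarrow> f x * g y))"
    using f by (simp add: norm_mult)
  show "AE x in lborel. integrable lborel (\<lambda>y. case (x, y) of (x, y) \<Rightarrow> f x * g y)"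
    using g by simp
qed

lemma fourier_L1_multiplication_formula:
  fixes F K :: "real^'n \<Rightarrow> complex"
  assumes F: "integrable lborel F" and K: "integrable lborel K"
  shows "(LINT y|lborel. fourier_L1 F y * K y) = (LINT x|lborel. F x * fourier_L1 K x)"
proof -
  have [measurable]: "F \<in> borel_measurable borel" "K \<in> borel_measurable borel" using assms borel_measurable_integrable by auto
  have int: "integrable (lborel \<Otimes>\<^sub>M lborel) (\<lambda>z. (\<lambda>(x, y). F x * K y) z * (\<lambda>(x, y). fourier_char (x \<bullet> y)) z)"
    by (rule integrable_mult_bounded(1)[OF integrable_prod_mult[OF F K], where B = 1]) (auto, measurable)
  then have int: "integrable (lborel \<Otimes>\<^sub>M lborel) (\<lambda>(x, y). F x * K y * fourier_char (x \<bullet> y))"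
    by (simp add: case_prod_unfold)
  have "(LINT y|lborel. fourier_L1 F y * K y) = (LINT y|lborel. LINT x|lborel. F x * K y * fourier_char (x \<bullet> y))"
    by (simp add: fourier_L1_borel mult_ac flip: integral_mult_right_zero)
  also have "\<dots> = (LINT x|lborel. LINT y|lborel. F x * K y * fourier_char (x \<bullet> y))"
    using lborel_pair.Fubini_integral[OF int] by simp
  also have "\<dots> = (LINT x|lborel. F x * fourier_L1 K x)"
    by (simp add: fourier_L1_borel mult_ac inner_commute flip: integral_mult_right_zero)
  finally show ?thesis .
qed

lemma square_integrable_mult:
  fixes f k :: "real^'n \<Rightarrow> complex"
  assumes "square_integrable f" "square_integrable k"
  shows "integrable lebesgue (\<lambda>x. f x * k x)"
proof (rule Bochner_Integration.integrable_bound)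
  show "integrable lebesgue (\<lambda>x. (norm (f x))\<^sup>2 + (norm (k x))\<^sup>2)"
    using assms by (simp add: square_integrable_def)
  have "a * b \<le> a\<^sup>2 + b\<^sup>2" if "a \<ge> 0" "b \<ge> 0" for a b :: real
    using sum_squares_bound[of a b] that mult_nonneg_nonneg[of a b] by linarith
  then show "AE x in lebesgue. norm (f x * k x) \<le> norm ((norm (f x))\<^sup>2 + (norm (k x))\<^sup>2)"
    by (intro AE_I2) (simp add: norm_mult)
qed (use assms in \<open>auto simp: square_integrable_def\<close>)

lemma square_integrable_of_bounded:
  fixes k :: "real^'n \<Rightarrow> complex"
  assumes "integrable lborel k" "\<And>x. norm (k x) \<le> B"
  shows "square_integrable k"
proof -
  have k: "integrable lebesgue k" using assms(1) by (simp add: integrable_completion)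
  have "integrable lebesgue (\<lambda>x. (norm (k x))\<^sup>2)"
  proof (rule Bochner_Integration.integrable_bound)
    show "integrable lebesgue (\<lambda>x. B * norm (k x))" using k by simp
    show "AE x in lebesgue. norm ((norm (k x))\<^sup>2) \<le> norm (B * norm (k x))"
      using order_trans[OF mult_right_mono[OF assms(2) norm_ge_zero] abs_ge_self]
      by (intro AE_I2) (simp add: power2_eq_square)
  qed (use k in auto)
  with k show ?thesis by (auto simp: square_integrable_def)
qed

text \<open>By Cauchy and Schwarz.  The hypothesis on \<open>A j\<close> is integrability against \<open>k\<close>, because the lemma is
  applied to transforms of approximants, which are not known individually to be square integrable.\<close>
lemma L2_tendsto_pairing:
  fixes k :: "real^'n \<Rightarrow> complex"
  assumes A: "\<And>j. A j \<in> borel_measurable lebesgue" "\<And>j. integrable lebesgue (\<lambda>x. A j x * k x)" and a: "square_integrable a" and lim: "L2_tendsto A a" and k: "square_integrable k"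
  shows "(\<lambda>j. LINT x|lebesgue. A j x * k x) \<longlonglongrightarrow> (LINT x|lebesgue. a x * k x)"
proof -
  have [measurable]: "A j \<in> borel_measurable lebesgue" "a \<in> borel_measurable lebesgue" "k \<in> borel_measurable lebesgue" for j
    using assms by (auto simp: square_integrable_def)
  define S where "S = (\<integral>\<^sup>+ x. ennreal ((norm (k x))\<^sup>2) \<partial>lebesgue)"
  have S: "S < \<infinity>" unfolding S_def using k by (subst nn_integral_eq_integral) (auto simp: square_integrable_def)
  define e where "e = (\<lambda>j. \<integral>\<^sup>+ x. ennreal ((norm (A j x - a x))\<^sup>2) \<partial>lebesgue)"
  define d where "d = (\<lambda>j. (LINT x|lebesgue. A j x * k x) - (LINT x|lebesgue. a x * k x))"
  have le: "ennreal ((norm (d j))\<^sup>2) \<le> e j * S" for j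
  proof -
    have "d j = (LINT x|lebesgue. (A j x - a x) * k x)"
      unfolding d_def left_diff_distrib by (rule Bochner_Integration.integral_diff[symmetric]) (intro square_integrable_mult A(2) a k)+
    moreover have "integrable lebesgue (\<lambda>x. (A j x - a x) * k x)"
      unfolding left_diff_distrib by (intro Bochner_Integration.integrable_diff square_integrable_mult A(2) a k)
    ultimately have "ennreal (norm (d j)) \<le> (\<integral>\<^sup>+ x. ennreal (norm ((A j x - a x) * k x)) \<partial>lebesgue)"
      by (simp only:) (rule integral_norm_bound_ennreal)
    also have "\<dots> = (\<integral>\<^sup>+ x. ennreal (norm (A j x - a x)) * ennreal (norm (k x)) \<partial>lebesgue)"
      by (simp add: norm_mult ennreal_mult)
    finally have "ennreal (norm (d j)) ^ 2 \<le> (\<integral>\<^sup>+ x. ennreal (norm (A j x - a x)) * ennreal (norm (k x)) \<partial>lebesgue)\<^sup>2"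
      by (rule power_mono) simp
    also have "\<dots> \<le> (\<integral>\<^sup>+ x. ennreal (norm (A j x - a x)) ^ 2 \<partial>lebesgue) * (\<integral>\<^sup>+ x. ennreal (norm (k x)) ^ 2 \<partial>lebesgue)"
      by (rule Cauchy_Schwarz_nn_integral) measurable
    finally show ?thesis by (simp add: e_def S_def ennreal_power)
  qed
  have "e \<longlonglongrightarrow> 0" using lim by (simp add: e_def L2_tendsto_def)
  then have Se: "(\<lambda>j. S * e j) \<longlonglongrightarrow> S * 0" using S by (intro ennreal_tendsto_cmult) auto
  have "(\<lambda>j. ennreal ((norm (d j))\<^sup>2)) \<longlonglongrightarrow> 0"
  proof (rule tendsto_sandwich[OF _ _ tendsto_const])
    show "(\<lambda>j. S * e j) \<longlonglongrightarrow> 0" using Se by (simp only: mult_zero_right)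
    show "\<forall>\<^sub>F j in sequentially. ennreal ((norm (d j))\<^sup>2) \<le> S * e j"
      using le by (simp only: mult.commute[of S] eventually_True)
  qed (simp only: zero_le eventually_True)
  then have "(\<lambda>j. ennreal ((norm (d j))\<^sup>2)) \<longlonglongrightarrow> ennreal 0" by (simp only: ennreal_0)
  then have "(\<lambda>j. (norm (d j))\<^sup>2) \<longlonglongrightarrow> 0"
    by (subst (asm) tendsto_ennreal_iff) auto
  then have "d \<longlonglongrightarrow> 0" by (simp add: tendsto_norm_zero_iff power_tendsto_0_iff)
  then show ?thesis unfolding d_def by (simp add: LIM_zero_iff)
qed

text \<open>This formula replaces Plancherel's theorem: it holds for the approximants by Fubini, and both sides pass to
  the limit since \<open>K\<close> and its transform are bounded and integrable, hence square integrable.\<close>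
lemma has_fourier_L2_multiplication_formula:
  fixes f g K :: "real^'n \<Rightarrow> complex"
  assumes hf: "has_fourier_L2 f g"
    and f': "f' \<in> borel_measurable borel" "AE x in lborel. f x = f' x"
    and g': "g' \<in> borel_measurable borel" "AE x in lborel. g x = g' x"
    and K: "integrable lborel K" "\<And>x. norm (K x) \<le> B"
    and Khat: "integrable lborel (fourier_L1 K)"
  shows "(LINT y|lborel. g' y * K y) = (LINT x|lborel. f' x * fourier_L1 K x)"
proof -
  have [measurable]: "K \<in> borel_measurable borel" using K borel_measurable_integrable by auto
  note [measurable] = f'(1) g'(1)
  have sK: "square_integrable K" by (rule square_integrable_of_bounded[OF K])
  have sKh: "square_integrable (fourier_L1 K)"
    by (rule square_integrable_of_bounded[OF Khat norm_fourier_L1_le]) measurable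
  obtain F where F: "\<And>k. integrable lebesgue (F k)" "\<And>k. square_integrable (F k)" "L2_tendsto F f" "L2_tendsto (\<lambda>k. fourier_L1 (F k)) g"
    and fg: "square_integrable f" "square_integrable g"
    using hf unfolding has_fourier_L2_def by blast
  have eq: "(LINT y|lebesgue. fourier_L1 (F k) y * K y) = (LINT x|lebesgue. F k x * fourier_L1 K x)"
    and mFh: "fourier_L1 (F k) \<in> borel_measurable lebesgue"
    and iFh: "integrable lebesgue (\<lambda>y. fourier_L1 (F k) y * K y)" for k
  proof -
    have mF: "F k \<in> borel_measurable lebesgue" using F(1) by auto
    then obtain F' where F': "F' \<in> borel_measurable borel" "AE x in lborel. F k x = F' x"
      by (rule lebesgue_measurable_borel_version)
    note [measurable] = F'(1)
    have F'l: "F' \<in> borel_measurable lebesgue" using F'(1) by (simp add: measurable_completion)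
    have "integrable lebesgue F'" using F(1)[of k] F'(2) F'l mF by (subst integrable_cong_AE[of F' _ "F k"]) (auto simp: AE_lebesgue_iff elim: eventually_mono)
    then have intF': "integrable lborel F'" by (simp add: integrable_completion)
    have Fh: "fourier_L1 (F k) = fourier_L1 F'" by (rule fourier_L1_cong_AE[OF mF F'])
    show "fourier_L1 (F k) \<in> borel_measurable lebesgue"
      unfolding Fh by (intro measurable_completion) measurable
    have "integrable lborel (\<lambda>y. fourier_L1 F' y * K y)"
      by (rule integrable_mult_bounded(2)[OF K(1) _ norm_fourier_L1_le]) measurable
    then show "integrable lebesgue (\<lambda>y. fourier_L1 (F k) y * K y)"
      unfolding Fh by (simp add: integrable_completion)
    have "(LINT y|lebesgue. fourier_L1 (F k) y * K y) = (LINT y|lborel. fourier_L1 F' y * K y)"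
      unfolding Fh by (rule integral_completion) measurable
    also have "\<dots> = (LINT x|lborel. F' x * fourier_L1 K x)"
      by (rule fourier_L1_multiplication_formula[OF intF' K(1)])
    also have "\<dots> = (LINT x|lebesgue. F' x * fourier_L1 K x)"
      by (rule integral_completion[symmetric]) measurable
    also have "\<dots> = (LINT x|lebesgue. F k x * fourier_L1 K x)"
      using sKh mF F'l F'(2) by (intro integral_cong_AE) (auto simp: AE_lebesgue_iff square_integrable_def elim: eventually_mono)
    finally show "(LINT y|lebesgue. fourier_L1 (F k) y * K y) = (LINT x|lebesgue. F k x * fourier_L1 K x)" .
  qed
  have l1: "(\<lambda>k. LINT x|lebesgue. F k x * fourier_L1 K x) \<longlonglongrightarrow> (LINT x|lebesgue. f x * fourier_L1 K x)"
    by (rule L2_tendsto_pairing[OF _ _ fg(1) F(3) sKh]) (auto intro!: F square_integrable_mult sKh borel_measurable_integrable)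
  have l2: "(\<lambda>k. LINT x|lebesgue. fourier_L1 (F k) x * K x) \<longlonglongrightarrow> (LINT x|lebesgue. g x * K x)"
    by (rule L2_tendsto_pairing[OF mFh iFh fg(2) F(4) sK])
  have to_borel: "(LINT y|lebesgue. u y * k y) = (LINT y|lborel. u' y * k y)"
    if "u \<in> borel_measurable lebesgue" and [measurable]: "u' \<in> borel_measurable borel" "k \<in> borel_measurable borel"
      and "AE x in lborel. u x = u' x" for u u' k :: "real^'n \<Rightarrow> complex"
  proof -
    have m: "u' \<in> borel_measurable lebesgue" "k \<in> borel_measurable lebesgue" using that by (simp_all add: measurable_completion)
    have "(LINT y|lebesgue. u y * k y) = (LINT y|lebesgue. u' y * k y)"
      using that m by (intro integral_cong_AE) (auto simp: AE_lebesgue_iff elim: eventually_mono)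
    also have "\<dots> = (LINT y|lborel. u' y * k y)" by (rule integral_completion) measurable
    finally show ?thesis .
  qed
  have "(LINT y|lebesgue. g y * K y) = (LINT x|lebesgue. f x * fourier_L1 K x)"
    using l1 l2 unfolding eq by (rule LIMSEQ_unique[rotated])
  moreover have "(LINT y|lebesgue. g y * K y) = (LINT y|lborel. g' y * K y)"
    using fg g' by (intro to_borel) (auto simp: square_integrable_def)
  moreover have "(LINT y|lebesgue. f y * fourier_L1 K y) = (LINT y|lborel. f' y * fourier_L1 K y)"
    using fg f' by (intro to_borel) (auto simp: square_integrable_def)
  ultimately show ?thesis by simp
qed

section \<open>Moments of the transform along lines\<close>

text \<open>Both the unmodulated Gaussians with arbitrary centre \<open>b\<close> and the centred ones with
  arbitrary modulation \<open>a\<close> are needed: the transform of the latter is a Gaussian centred at \<open>a\<close>.\<close>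
definition modulated_gauss :: "real \<Rightarrow> real^'n \<Rightarrow> real^'n \<Rightarrow> real^'n \<Rightarrow> complex" where
  "modulated_gauss c a b y = exp (2 * of_real pi * \<i> * of_real (a \<bullet> y)) * of_real (exp (- c * (norm (y - b))\<^sup>2))"

lemma measurable_modulated_gauss [measurable]: "modulated_gauss c a b \<in> borel_measurable borel"
  unfolding modulated_gauss_def[abs_def] by measurable

lemma norm_modulated_gauss: "norm (modulated_gauss c a b y) = exp (- c * (norm (y - b))\<^sup>2)"
  by (simp add: modulated_gauss_def norm_mult)

lemma integrable_modulated_gauss:
  fixes a b :: "real^'n"
  assumes "c > 0" shows "integrable lborel (modulated_gauss c a b)"
  using integrable_gauss[OF assms, of b]
  by (rule Bochner_Integration.integrable_bound) (auto simp: norm_modulated_gauss)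

lemma fourier_modulated_gauss:
  fixes a b :: "real^'n"
  assumes c: "c > 0"
  shows "fourier_L1 (modulated_gauss c a b) x = fourier_char ((x - a) \<bullet> b) * of_real (sqrt (pi / c) ^ CARD('n) * exp (- (pi\<^sup>2 / c) * (norm (x - a))\<^sup>2))"
proof -
  have "fourier_L1 (modulated_gauss c a b) x = (LINT y|lborel. modulated_gauss c a b (b + 1 *\<^sub>R y) * fourier_char ((b + 1 *\<^sub>R y) \<bullet> x))"
    unfolding fourier_L1_borel[OF measurable_modulated_gauss] by (subst integral_lborel_affine[of 1 _ b]) (auto, measurable)
  also have "\<dots> = (LINT y|lborel. fourier_char ((x - a) \<bullet> b) *
      (fourier_char ((x - a) \<bullet> y) * of_real (exp (- c * (norm y)\<^sup>2))))"
  proof (rule Bochner_Integration.integral_cong[OF refl])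
    fix y
    have "exp (2 * of_real pi * \<i> * of_real (a \<bullet> (b + y))) * fourier_char ((b + y) \<bullet> x) =
      fourier_char ((x - a) \<bullet> b) * fourier_char ((x - a) \<bullet> y)"
      by (simp add: exp_add[symmetric] inner_diff_left inner_add_right inner_add_left inner_commute algebra_simps)
    then show "modulated_gauss c a b (b + 1 *\<^sub>R y) * fourier_char ((b + 1 *\<^sub>R y) \<bullet> x) =
      fourier_char ((x - a) \<bullet> b) * (fourier_char ((x - a) \<bullet> y) * of_real (exp (- c * (norm y)\<^sup>2)))"
      by (simp add: modulated_gauss_def mult_ac)
  qed
  also have "\<dots> = fourier_char ((x - a) \<bullet> b) * of_real (sqrt (pi / c) ^ CARD('n) * exp (- pi\<^sup>2 * (norm (x - a))\<^sup>2 / c))"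
    using gauss_fourier[OF c, of "x - a"] by (simp only: integral_mult_right_zero) simp
  finally show ?thesis by simp
qed

lemma integrable_fourier_modulated_gauss:
  fixes a b :: "real^'n"
  assumes c: "c > 0"
  shows "integrable lborel (fourier_L1 (modulated_gauss c a b))"
proof -
  have "integrable lborel (\<lambda>x. (sqrt (pi / c) ^ CARD('n)) * exp (- (pi\<^sup>2 / c) * (norm (x - a))\<^sup>2))"
    using c by (intro integrable_mult_right integrable_gauss) simp
  then show ?thesis
  proof (rule Bochner_Integration.integrable_bound)
    show "AE x in lborel. norm (fourier_L1 (modulated_gauss c a b) x) \<le> norm (sqrt (pi / c) ^ CARD('n) * exp (- (pi\<^sup>2 / c) * (norm (x - a))\<^sup>2))"
      by (intro AE_I2) (simp only: fourier_modulated_gauss[OF c] norm_mult norm_fourier_kernel norm_of_real, simp add: abs_mult)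
  qed measurable
qed

text \<open>The factor \<open>exp (2\<pi>its)\<close> moves the supporting half-space \<open>x \<bullet> \<eta> \<le> t\<close> of \<open>f\<close> to one through the origin.\<close>
definition line_kernel :: "real \<Rightarrow> nat \<Rightarrow> real \<Rightarrow> complex" where
  "line_kernel t k s = cauchy_weight s *\<^sub>R (cayley (of_real s) ^ k * exp (2 * of_real pi * \<i> * of_real (t * s)))"

lemma measurable_line_kernel [measurable]: "line_kernel t k \<in> borel_measurable borel"
  unfolding line_kernel_def[abs_def] by measurable

lemma norm_line_kernel: "norm (line_kernel t k s) = cauchy_weight s"
  by (simp add: line_kernel_def norm_mult norm_power norm_cayley_of_real norm_exp_eq_Re)

lemma integrable_line_kernel: "integrable lborel (line_kernel t k)"
  using integrable_cauchy_weight by (rule Bochner_Integration.integrable_bound) (auto simp: norm_line_kernel)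

lemma fourier_line_kernel:
  assumes "u \<le> t"
  shows "(LINT s|lborel. line_kernel t k s * fourier_char (s * u)) = (if k = 0 then of_real (pi * exp (- (2 * pi * (t - u)))) else 0)"
proof -
  have "(LINT s|lborel. line_kernel t k s * fourier_char (s * u)) =
    (LINT s|lborel. cauchy_weight s *\<^sub>R (cayley (of_real s) ^ k * exp (\<i> * of_real (2 * pi * (t - u)) * of_real s)))"
  proof (rule Bochner_Integration.integral_cong[OF refl])
    fix s
    have "exp (2 * of_real pi * \<i> * of_real (t * s)) * fourier_char (s * u) = exp (\<i> * of_real (2 * pi * (t - u)) * complex_of_real s)"
      by (simp add: exp_add[symmetric] algebra_simps)
    then show "line_kernel t k s * fourier_char (s * u) = cauchy_weight s *\<^sub>R (cayley (of_real s) ^ k * exp (\<i> * of_real (2 * pi * (t - u)) * of_real s))"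
      by (simp add: line_kernel_def mult.assoc)
  qed
  also have "\<dots> = (if k = 0 then pi * exp (- (2 * pi * (t - u))) else 0)"
    using assms by (intro integral_cayley_power_exp) simp
  finally show ?thesis by simp
qed

definition line_transform :: "(real^'n \<Rightarrow> complex) \<Rightarrow> real^'n \<Rightarrow> real \<Rightarrow> nat \<Rightarrow> real^'n \<Rightarrow> complex" where
  "line_transform G \<eta> t k y = (LINT s|lborel. G (y + s *\<^sub>R \<eta>) * line_kernel t k s)"

context
  fixes G :: "real^'n \<Rightarrow> complex" and C :: real and \<eta> :: "real^'n" and t :: real
  assumes G [measurable]: "G \<in> borel_measurable borel" and Gb: "\<And>y. norm (G y) \<le> C"
begin

lemma measurable_line_transform [measurable]: "line_transform G \<eta> t k \<in> borel_measurable borel"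
  unfolding line_transform_def[abs_def] by measurable

lemma norm_line_transform_le: "norm (line_transform G \<eta> t k y) \<le> C * pi"
proof -
  have "norm (line_transform G \<eta> t k y) \<le> (LINT s|lborel. C * cauchy_weight s)"
    unfolding line_transform_def
  proof (rule Bochner_Integration.integral_norm_bound_integral)
    show "integrable lborel (\<lambda>s. G (y + s *\<^sub>R \<eta>) * line_kernel t k s)"
      by (rule integrable_mult_bounded(2)[OF integrable_line_kernel _ Gb]) measurable
    show "norm (G (y + s *\<^sub>R \<eta>) * line_kernel t k s) \<le> C * cauchy_weight s" for s
      using mult_right_mono[OF Gb cauchy_weight_nonneg] by (simp add: norm_mult norm_line_kernel)
  qed (use integrable_cauchy_weight in simp)
  then show ?thesis by (simp add: integral_cauchy_weight)
qed

text \<open>By Fubini, pairing \<open>line_transform G\<close> with a Gaussian \<open>\<kappa>\<close> is pairing \<open>G\<close> with the superposition \<open>K\<close> of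
  translates of \<open>\<kappa>\<close> along \<open>\<eta>\<close>.  The transform of \<open>K\<close> is the transform of \<open>\<kappa>\<close> times that of the line
  kernel at \<open>x \<bullet> \<eta>\<close>, which on the support of \<open>f\<close> is known explicitly from \<open>fourier_line_kernel\<close>.\<close>
lemma integral_gauss_line_transform:
  assumes hf: "has_fourier_L2 f g"
    and f': "f' \<in> borel_measurable borel" "AE x in lborel. f x = f' x"
    and g': "AE x in lborel. g x = G x"
    and supp: "AE x in lborel. x \<bullet> \<eta> > t \<longrightarrow> f' x = 0"
    and c: "c > 0"
  shows "(LINT y|lborel. modulated_gauss c a b y * line_transform G \<eta> t k y) =
    (if k = 0 then LINT x|lborel. f' x * fourier_L1 (modulated_gauss c a b) x * of_real (pi * exp (- (2 * pi * (t - x \<bullet> \<eta>)))) else 0)"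
proof -
  define \<kappa> where "\<kappa> = modulated_gauss c a b"
  define w where "w = line_kernel t k"
  have [measurable]: "\<kappa> \<in> borel_measurable borel" "w \<in> borel_measurable borel" by (simp_all add: \<kappa>_def w_def)
  have int\<kappa>: "integrable lborel \<kappa>" unfolding \<kappa>_def by (rule integrable_modulated_gauss[OF c])
  have intw: "integrable lborel w" unfolding w_def by (rule integrable_line_kernel)
  have \<kappa>1: "norm (\<kappa> y) \<le> 1" for y using c by (simp add: \<kappa>_def norm_modulated_gauss)
  define K where "K = (\<lambda>y. LINT s|lborel. w s * \<kappa> (y - s *\<^sub>R \<eta>))"
  have [measurable]: "K \<in> borel_measurable borel" unfolding K_def by measurable
  have shear: "integrable (lborel \<Otimes>\<^sub>M lborel) (\<lambda>(s, y). w s * \<kappa> (y - s *\<^sub>R \<eta>))"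
  proof (rule lborel_pair.Fubini_integrable)
    have i: "integrable lborel (\<lambda>y. \<kappa> (y - s *\<^sub>R \<eta>))" for s
      using integrable_lborel_translate[OF int\<kappa>, of "- s *\<^sub>R \<eta>"] by simp
    have n: "(LINT y|lborel. norm (\<kappa> (y - s *\<^sub>R \<eta>))) = (LINT y|lborel. norm (\<kappa> y))" for s
    proof -
      have "(LINT y|lborel. complex_of_real (norm (\<kappa> (y - s *\<^sub>R \<eta>)))) = (LINT y|lborel. complex_of_real (norm (\<kappa> y)))"
        using integral_lborel_translate[of "\<lambda>y. complex_of_real (norm (\<kappa> y))" "- s *\<^sub>R \<eta>"] by simp
      then show ?thesis by simp
    qed
    show "AE s in lborel. integrable lborel (\<lambda>y. case (s, y) of (s, y) \<Rightarrow> w s * \<kappa> (y - s *\<^sub>R \<eta>))"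
      using i by simp
    show "integrable lborel (\<lambda>s. LINT y|lborel. norm (case (s, y) of (s, y) \<Rightarrow> w s * \<kappa> (y - s *\<^sub>R \<eta>)))"
      using intw by (simp add: norm_mult n)
  qed measurable
  have K1: "norm (K y) \<le> pi" for y
  proof -
    have "norm (K y) \<le> (LINT s|lborel. cauchy_weight s)"
      unfolding K_def
    proof (rule Bochner_Integration.integral_norm_bound_integral)
      show "integrable lborel (\<lambda>s. w s * \<kappa> (y - s *\<^sub>R \<eta>))"
        by (rule integrable_mult_bounded(1)[OF intw _ \<kappa>1]) measurable
      show "norm (w s * \<kappa> (y - s *\<^sub>R \<eta>)) \<le> cauchy_weight s" for s
        using mult_left_mono[OF \<kappa>1 cauchy_weight_nonneg] by (simp add: norm_mult w_def norm_line_kernel)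
    qed (rule integrable_cauchy_weight)
    then show ?thesis by (simp add: integral_cauchy_weight)
  qed
  have intK: "integrable lborel K"
    using lborel_pair.integrable_snd[OF shear] by (simp add: K_def)
  define \<beta> where "\<beta> = (\<lambda>u. LINT s|lborel. w s * fourier_char (s * u))"
  have Khat: "fourier_L1 K x = fourier_L1 \<kappa> x * \<beta> (x \<bullet> \<eta>)" for x
  proof -
    have "integrable (lborel \<Otimes>\<^sub>M lborel) (\<lambda>z. (\<lambda>(s, y). w s * \<kappa> (y - s *\<^sub>R \<eta>)) z * (\<lambda>(s, y). fourier_char (y \<bullet> x)) z)"
      by (rule integrable_mult_bounded(1)[OF shear, where B = 1]) (auto, measurable)
    then have int: "integrable (lborel \<Otimes>\<^sub>M lborel) (\<lambda>(s, y). w s * \<kappa> (y - s *\<^sub>R \<eta>) * fourier_char (y \<bullet> x))"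
      by (simp add: case_prod_unfold)
    have "fourier_L1 K x = (LINT y|lborel. LINT s|lborel. w s * \<kappa> (y - s *\<^sub>R \<eta>) * fourier_char (y \<bullet> x))"
      unfolding fourier_L1_borel[OF \<open>K \<in> borel_measurable borel\<close>] by (simp add: K_def flip: integral_mult_left_zero)
    also have "\<dots> = (LINT s|lborel. LINT y|lborel. w s * \<kappa> (y - s *\<^sub>R \<eta>) * fourier_char (y \<bullet> x))"
      using lborel_pair.Fubini_integral[OF int] by simp
    also have "\<dots> = (LINT s|lborel. w s * fourier_char (s * (x \<bullet> \<eta>)) * fourier_L1 \<kappa> x)"
    proof (rule Bochner_Integration.integral_cong[OF refl])
      fix s
      have "(LINT y|lborel. w s * \<kappa> (y - s *\<^sub>R \<eta>) * fourier_char (y \<bullet> x)) =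
        (LINT y|lborel. w s * \<kappa> y * fourier_char ((y + s *\<^sub>R \<eta>) \<bullet> x))"
        using integral_lborel_translate[of "\<lambda>y. w s * \<kappa> (y - s *\<^sub>R \<eta>) * fourier_char (y \<bullet> x)" "s *\<^sub>R \<eta>"] by simp
      also have "\<dots> = (LINT y|lborel. (w s * fourier_char (s * (x \<bullet> \<eta>))) * (\<kappa> y * fourier_char (y \<bullet> x)))"
      proof (rule Bochner_Integration.integral_cong[OF refl])
        fix y
        have "fourier_char ((y + s *\<^sub>R \<eta>) \<bullet> x) = fourier_char (s * (x \<bullet> \<eta>)) * fourier_char (y \<bullet> x)"
          by (simp add: exp_add[symmetric] inner_add_left inner_commute algebra_simps)
        then show "w s * \<kappa> y * fourier_char ((y + s *\<^sub>R \<eta>) \<bullet> x) = (w s * fourier_char (s * (x \<bullet> \<eta>))) * (\<kappa> y * fourier_char (y \<bullet> x))"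
          by (simp only: mult_ac)
      qed
      also have "\<dots> = w s * fourier_char (s * (x \<bullet> \<eta>)) * fourier_L1 \<kappa> x"
        by (subst integral_mult_right_zero, subst fourier_L1_borel) auto
      finally show "(LINT y|lborel. w s * \<kappa> (y - s *\<^sub>R \<eta>) * fourier_char (y \<bullet> x)) = w s * fourier_char (s * (x \<bullet> \<eta>)) * fourier_L1 \<kappa> x" .
    qed
    also have "\<dots> = fourier_L1 \<kappa> x * \<beta> (x \<bullet> \<eta>)" by (simp add: \<beta>_def mult.commute)
    finally show ?thesis .
  qed
  have \<beta>1: "norm (\<beta> u) \<le> pi" for u
  proof -
    have "norm (\<beta> u) \<le> (LINT s|lborel. norm (w s * fourier_char (s * u)))"
      unfolding \<beta>_def by (rule integral_norm_bound)
    then show ?thesis by (simp add: norm_mult w_def norm_line_kernel integral_cauchy_weight)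
  qed
  have [measurable]: "\<beta> \<in> borel_measurable borel" unfolding \<beta>_def by measurable
  have intKhat: "integrable lborel (fourier_L1 K)"
    unfolding Khat[abs_def]
    by (rule integrable_mult_bounded(1)[OF _ _ \<beta>1]) (auto simp: \<kappa>_def intro!: integrable_fourier_modulated_gauss[OF c])
  have main: "(LINT y|lborel. G y * K y) = (LINT x|lborel. f' x * fourier_L1 K x)"
    by (rule has_fourier_L2_multiplication_formula[OF hf f' G g' intK K1 intKhat])
  have "(LINT y|lborel. \<kappa> y * line_transform G \<eta> t k y) = (LINT y|lborel. LINT s|lborel. \<kappa> y * w s * G (y + s *\<^sub>R \<eta>))"
    by (simp add: line_transform_def w_def mult_ac flip: integral_mult_right_zero)
  also have "\<dots> = (LINT s|lborel. LINT y|lborel. \<kappa> y * w s * G (y + s *\<^sub>R \<eta>))"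
  proof -
    have "integrable (lborel \<Otimes>\<^sub>M lborel) (\<lambda>z. (\<lambda>(y, s). \<kappa> y * w s) z * (\<lambda>(y, s). G (y + s *\<^sub>R \<eta>)) z)"
      by (rule integrable_mult_bounded(1)[OF integrable_prod_mult[OF int\<kappa> intw], where B = C]) (auto simp: Gb, measurable)
    then have "integrable (lborel \<Otimes>\<^sub>M lborel) (\<lambda>(y, s). \<kappa> y * w s * G (y + s *\<^sub>R \<eta>))"
      by (simp add: case_prod_unfold)
    from lborel_pair.Fubini_integral[OF this] show ?thesis by simp
  qed
  also have "\<dots> = (LINT s|lborel. LINT y|lborel. \<kappa> (y - s *\<^sub>R \<eta>) * w s * G y)"
  proof (rule Bochner_Integration.integral_cong[OF refl])
    show "(LINT y|lborel. \<kappa> y * w s * G (y + s *\<^sub>R \<eta>)) = (LINT y|lborel. \<kappa> (y - s *\<^sub>R \<eta>) * w s * G y)" for s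
      using integral_lborel_translate[of "\<lambda>y. \<kappa> (y - s *\<^sub>R \<eta>) * w s * G y" "s *\<^sub>R \<eta>"] by simp
  qed
  also have "\<dots> = (LINT y|lborel. LINT s|lborel. \<kappa> (y - s *\<^sub>R \<eta>) * w s * G y)"
  proof -
    have "integrable (lborel \<Otimes>\<^sub>M lborel) (\<lambda>z. (\<lambda>(s, y). w s * \<kappa> (y - s *\<^sub>R \<eta>)) z * (\<lambda>(s, y). G y) z)"
      by (rule integrable_mult_bounded(1)[OF shear, where B = C]) (auto simp: Gb, measurable)
    then have "integrable (lborel \<Otimes>\<^sub>M lborel) (\<lambda>(s, y). \<kappa> (y - s *\<^sub>R \<eta>) * w s * G y)"
      by (simp add: case_prod_unfold mult_ac)
    from lborel_pair.Fubini_integral[OF this] show ?thesis by simp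
  qed
  also have "\<dots> = (LINT y|lborel. G y * K y)" by (simp add: K_def mult_ac flip: integral_mult_right_zero)
  also have "\<dots> = (LINT x|lborel. f' x * fourier_L1 K x)" by (rule main)
  also have "\<dots> = (LINT x|lborel. (if k = 0 then f' x * fourier_L1 \<kappa> x * of_real (pi * exp (- (2 * pi * (t - x \<bullet> \<eta>)))) else 0))"
  proof (rule integral_cong_AE)
    note [measurable] = f'(1)
    show "(\<lambda>x. f' x * fourier_L1 K x) \<in> borel_measurable lborel" by measurable
    show "(\<lambda>x. if k = 0 then f' x * fourier_L1 \<kappa> x * of_real (pi * exp (- (2 * pi * (t - x \<bullet> \<eta>)))) else 0) \<in> borel_measurable lborel" by measurable
    show "AE x in lborel. f' x * fourier_L1 K x = (if k = 0 then f' x * fourier_L1 \<kappa> x * of_real (pi * exp (- (2 * pi * (t - x \<bullet> \<eta>)))) else 0)"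
      using supp
    proof eventually_elim
      case (elim x)
      show ?case
      proof (cases "x \<bullet> \<eta> \<le> t")
        case True
        then show ?thesis unfolding Khat \<beta>_def w_def using fourier_line_kernel[OF True, of k] by simp
      qed (use elim in auto)
    qed
  qed
  finally show ?thesis by (cases "k = 0") (simp_all add: \<kappa>_def)
qed

end

section \<open>Radial weights and their integrals along lines\<close>

text \<open>Fubini for a null set in the variables \<open>(y, s)\<close>: the line through almost every \<open>y\<close> avoids it for almost
  every parameter.\<close>
lemma AE_on_lines:
  fixes \<eta> :: "'a::euclidean_space"
  assumes "AE x in lborel. P x"
  shows "AE y in lborel. AE s in lborel. P (y + s *\<^sub>R \<eta>)"
proof -
  obtain N where N: "{x \<in> space lborel. \<not> P x} \<subseteq> N" "N \<in> null_sets lborel"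
    using assms unfolding eventually_ae_filter by blast
  then have [measurable]: "N \<in> sets borel" by auto
  have zero: "(\<integral>\<^sup>+ y. indicator N (y + s *\<^sub>R \<eta>) \<partial>lborel) = 0" for s
  proof -
    have "(\<integral>\<^sup>+ y. indicator N (y + s *\<^sub>R \<eta>) \<partial>lborel) = (\<integral>\<^sup>+ y. indicator N y \<partial>distr lborel borel ((+) (s *\<^sub>R \<eta>)))"
      by (subst nn_integral_distr) (auto simp: add.commute)
    also have "\<dots> = 0" unfolding lborel_distr_plus using null_setsD1[OF N(2)] by simp
    finally show ?thesis .
  qed
  have "(\<integral>\<^sup>+ y. \<integral>\<^sup>+ s. indicator N (y + s *\<^sub>R \<eta>) \<partial>lborel \<partial>lborel) = (\<integral>\<^sup>+ s. \<integral>\<^sup>+ y. indicator N (y + s *\<^sub>R \<eta>) \<partial>lborel \<partial>(lborel :: real measure))"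
    by (rule lborel_pair.Fubini') measurable
  also have "\<dots> = 0" by (simp add: zero)
  finally have "AE y in lborel. (\<integral>\<^sup>+ s. indicator N (y + s *\<^sub>R \<eta>) \<partial>(lborel :: real measure)) = 0"
    by (subst (asm) nn_integral_0_iff_AE) auto
  then show ?thesis
  proof eventually_elim
    case (elim y)
    then have "AE s in lborel. indicator N (y + s *\<^sub>R \<eta>) = (0::ennreal)"
      by (subst (asm) nn_integral_0_iff_AE) auto
    then show ?case by eventually_elim (use N(1) in \<open>auto simp: indicator_def split: if_splits\<close>)
  qed
qed

text \<open>Along lines and in the profile variable \<open>norm x\<close> a Borel function is needed, and one that is still
  radial.  A radial Lebesgue set contains, with each compact subset \<open>K\<close>, the whole preimage of \<open>norm ` K\<close>
  under the norm; so, up to a null set, it is the preimage of a \<open>\<sigma>\<close>-compact set of radii.  Applied to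
  the superlevel sets of \<open>\<psi>\<close>, this yields \<open>\<phi>\<close>.\<close>
lemma radial_borel_minorant:
  fixes \<psi> :: "real^'n \<Rightarrow> real"
  assumes meas: "\<psi> \<in> borel_measurable lebesgue" and nonneg: "\<And>x. 0 \<le> \<psi> x" and rad: "radial \<psi>"
  obtains \<phi> :: "real \<Rightarrow> real" where "\<phi> \<in> borel_measurable borel" "\<And>r. 0 \<le> \<phi> r"
    "\<And>x. \<phi> (norm x) \<le> \<psi> x" "AE x in lborel. \<psi> x = \<phi> (norm x)"
proof -
  define S where "S = (\<lambda>q::rat. {x. real_of_rat q < \<psi> x})"
  have S: "S q \<in> sets lebesgue" for q
  proof -
    have "{x \<in> space lebesgue. real_of_rat q < \<psi> x} \<in> sets lebesgue"
      using meas unfolding borel_measurable_iff_greater by blast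
    then show ?thesis by (simp add: S_def)
  qed
  have "\<exists>T. closed T \<and> T \<subseteq> S q \<and> emeasure lebesgue (S q - T) < ennreal (1 / Suc j)" for q j
  proof -
    have "1 / real (Suc j) > 0" by simp
    from sets_lebesgue_inner_closed[OF S[of q] this] obtain T where
      "closed T" "T \<subseteq> S q" "emeasure lebesgue (S q - T) < ennreal (1 / Suc j)" by metis
    then show ?thesis by (intro exI[of _ T] conjI)
  qed
  then have "\<forall>q. \<exists>T. \<forall>j. closed (T j) \<and> T j \<subseteq> S q \<and> emeasure lebesgue (S q - T j) < ennreal (1 / Suc j)"
    by (intro allI) (rule choice, rule allI)
  then have "\<exists>T. \<forall>q j. closed (T q j) \<and> T q j \<subseteq> S q \<and> emeasure lebesgue (S q - T q j) < ennreal (1 / Suc j)"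
    by (rule choice)
  then obtain T where T': "\<forall>q j. closed (T q j) \<and> T q j \<subseteq> S q \<and> emeasure lebesgue (S q - T q j) < ennreal (1 / Suc j)"
    by (rule exE)
  have T: "closed (T q j)" "T q j \<subseteq> S q" "emeasure lebesgue (S q - T q j) < ennreal (1 / Suc j)" for q j
    using T'[rule_format, of q j] by simp_all
  define E where "E = (\<lambda>q. \<Union>j. \<Union>m::nat. norm ` (T q j \<inter> cball 0 (real m)))"
  have E_eq: "r \<in> E q \<longleftrightarrow> (\<exists>j x. x \<in> T q j \<and> norm x = r)" for r q
  proof
    assume "\<exists>j x. x \<in> T q j \<and> norm x = r"
    then obtain j x where x: "x \<in> T q j" "norm x = r" by blast
    obtain m :: nat where "norm x \<le> real m" using real_arch_simple by blast
    with x have "r \<in> norm ` (T q j \<inter> cball 0 (real m))" by auto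
    then show "r \<in> E q" unfolding E_def by blast
  qed (auto simp: E_def)
  have [measurable]: "E q \<in> sets borel" for q
  proof -
    have "compact (norm ` (T q j \<inter> cball 0 (real m)))" for j m
      by (intro compact_continuous_image continuous_intros closed_Int_compact T) auto
    then show ?thesis unfolding E_def by (intro sets.countable_UN) (auto intro: borel_compact)
  qed
  have E_less: "real_of_rat q < \<psi> x" if "norm x \<in> E q" for q x
  proof -
    have "\<exists>j x'. x' \<in> T q j \<and> norm x' = norm x" using that by (simp only: E_eq)
    then obtain j x' where x': "x' \<in> T q j" "norm x' = norm x" by blast
    then have "real_of_rat q < \<psi> x'" using T(2) by (auto simp: S_def)
    moreover have "\<psi> x' = \<psi> x" using rad x'(2) unfolding radial_def by blast
    ultimately show ?thesis by simp
  qed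
  have Tm: "T q j \<in> sets lebesgue" for q j
  proof -
    have "T q j \<in> sets lborel" using T(1)[of q j] by (simp add: borel_closed)
    then show ?thesis by (rule sets_completionI_sets)
  qed
  have null: "S q - (\<Union>j. T q j) \<in> null_sets lebesgue" for q
  proof -
    have m: "S q - (\<Union>j. T q j) \<in> sets lebesgue"
      by (intro sets.Diff S sets.countable_UN image_subsetI Tm)
    have "emeasure lebesgue (S q - (\<Union>j. T q j)) \<le> ennreal (1 / Suc j)" for j
    proof -
      have "emeasure lebesgue (S q - (\<Union>j. T q j)) \<le> emeasure lebesgue (S q - T q j)"
        by (intro emeasure_mono sets.Diff S Tm) blast
      then show ?thesis using T(3)[of q j] by simp
    qed
    moreover have "(\<lambda>j. ennreal (1 / Suc j)) \<longlonglongrightarrow> ennreal 0"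
      by (intro tendsto_ennrealI LIMSEQ_Suc lim_1_over_n)
    ultimately have "emeasure lebesgue (S q - (\<Union>j. T q j)) \<le> ennreal 0"
      by (intro LIMSEQ_le_const) auto
    then show ?thesis using m by (auto intro: null_setsI)
  qed
  \<comment> \<open>Negative \<open>q\<close> contribute \<open>ennreal q = 0\<close>.\<close>
  define \<Phi> where "\<Phi> = (\<lambda>r. SUP q. ennreal (real_of_rat q) * indicator (E q) r)"
  have [measurable]: "\<Phi> \<in> borel_measurable borel" unfolding \<Phi>_def by measurable
  have \<Phi>_le: "\<Phi> (norm x) \<le> ennreal (\<psi> x)" for x
    unfolding \<Phi>_def
  proof (rule SUP_least)
    show "ennreal (real_of_rat q) * indicator (E q) (norm x) \<le> ennreal (\<psi> x)" for q
      using E_less[of x q] by (auto simp: indicator_def intro: ennreal_leI)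
  qed
  have "AE x in lebesgue. \<forall>q. x \<notin> S q - (\<Union>j. T q j)"
    unfolding AE_all_countable by (intro allI AE_not_in null)
  then have AE: "AE x in lborel. \<forall>q. x \<notin> S q - (\<Union>j. T q j)"
    by (simp add: AE_completion_iff)
  show ?thesis
  proof (rule that[of "\<lambda>r. enn2real (\<Phi> r)"])
    show le: "enn2real (\<Phi> (norm x)) \<le> \<psi> x" for x
      using enn2real_mono[OF \<Phi>_le[of x]] nonneg[of x] by simp
    show "AE x in lborel. \<psi> x = enn2real (\<Phi> (norm x))"
      using AE
    proof eventually_elim
      case (elim x)
      have fin: "\<Phi> (norm x) < \<infinity>" using \<Phi>_le[of x] by (rule le_less_trans) simp
      have "\<psi> x \<le> enn2real (\<Phi> (norm x))"
      proof (rule dense_le)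
        fix r assume "r < \<psi> x"
        from of_rat_dense[OF this] obtain q where q: "r < real_of_rat q" "real_of_rat q < \<psi> x" by blast
        then obtain j where "x \<in> T q j" using elim by (auto simp: S_def)
        then have "norm x \<in> E q" unfolding E_eq by blast
        then have "ennreal (real_of_rat q) * 1 \<le> \<Phi> (norm x)"
          unfolding \<Phi>_def by (intro SUP_upper2[of q]) auto
        then have "real_of_rat q \<le> enn2real (\<Phi> (norm x))"
          using fin by (cases "\<Phi> (norm x)") (auto simp: enn2real_ennreal ennreal_le_iff2)
        then show "r \<le> enn2real (\<Phi> (norm x))" using q by simp
      qed
      with le[of x] show ?case by simp
    qed
    show "(\<lambda>r. enn2real (\<Phi> r)) \<in> borel_measurable borel" by measurable
    show "0 \<le> enn2real (\<Phi> r)" for r by (rule enn2real_nonneg)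
  qed
qed

text \<open>Integration in polar coordinates for radial functions: both measures give \<open>{..a}\<close> the volume of the
  ball of radius \<open>a\<close>.\<close>
lemma distr_lborel_norm:
  defines "n \<equiv> DIM('a::euclidean_space)"
  shows "distr (lborel :: 'a measure) borel norm =
    density lborel (\<lambda>r. ennreal (real n * unit_ball_vol (real n) * r ^ (n - 1)) * indicator {0..} r)"
proof -
  define c where "c = unit_ball_vol (real n)"
  define M where "M = distr (lborel :: 'a measure) borel norm"
  define N where "N = density lborel (\<lambda>r. ennreal (real n * c * r ^ (n - 1)) * indicator {0..} r)"
  have c0: "c \<ge> 0" by (simp add: c_def)
  have n0: "n > 0" by (simp add: n_def)
  have M: "emeasure M {..a} = (if a < 0 then 0 else ennreal (c * a ^ n))" for a
  proof -
    have "emeasure M {..a} = emeasure lborel (norm -` {..a} \<inter> space (lborel :: 'a measure))"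
      unfolding M_def by (rule emeasure_distr) auto
    also have "norm -` {..a} \<inter> space (lborel :: 'a measure) = cball 0 a" by auto
    finally show ?thesis by (auto simp: emeasure_cball c_def n_def)
  qed
  have N: "emeasure N {..a} = (if a < 0 then 0 else ennreal (c * a ^ n))" for a
  proof -
    have "emeasure N {..a} = (\<integral>\<^sup>+ r. ennreal (real n * c * r ^ (n - 1)) * indicator {0..} r * indicator {..a} r \<partial>lborel)"
      unfolding N_def by (rule emeasure_density) auto
    also have "\<dots> = (\<integral>\<^sup>+ r. ennreal (real n * c * r ^ (n - 1)) * indicator {0..a} r \<partial>lborel)"
      by (rule nn_integral_cong) (auto simp: indicator_def)
    also have "\<dots> = (if a < 0 then 0 else ennreal (c * a ^ n))"
    proof (cases "a < 0")
      case False
      have "(\<integral>\<^sup>+ r. ennreal (real n * c * r ^ (n - 1)) * indicator {0..a} r \<partial>lborel) = ennreal (c * a ^ n - c * 0 ^ n)"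
      proof (rule nn_integral_FTC_Icc)
        show "((\<lambda>r. c * r ^ n) has_real_derivative real n * c * r ^ (n - 1)) (at r)" for r
          by (auto intro!: derivative_eq_intros)
      qed (use False c0 in auto)
      moreover have "c * 0 ^ n = 0" using n0 by simp
      ultimately show ?thesis using False by simp
    qed simp
    finally show ?thesis .
  qed
  have "M = N"
  proof (rule measure_eqI_generator_eq[where E = "range atMost" and \<Omega> = UNIV and A = "\<lambda>i::nat. {..real i}"])
    show "Int_stable (range atMost :: real set set)"
    proof (rule Int_stableI)
      fix X Y :: "real set" assume "X \<in> range atMost" "Y \<in> range atMost"
      then obtain a b where "X = {..a}" "Y = {..b}" by blast
      then have "X \<inter> Y = {..min a b}" by auto
      then show "X \<inter> Y \<in> range atMost" by blast
    qed
    show "emeasure M X = emeasure N X" if "X \<in> range atMost" for X :: "real set"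
      using that M N by auto
    show "sets M = sigma_sets UNIV (range atMost)" "sets N = sigma_sets UNIV (range atMost)"
      by (simp_all add: M_def N_def borel_eq_atMost)
    show "(\<Union>i. {..real i}) = UNIV" by (auto intro: real_arch_simple)
    show "emeasure M {..real i} \<noteq> \<infinity>" for i by (simp add: M)
  qed auto
  then show ?thesis by (simp add: M_def N_def c_def)
qed

text \<open>Local integrability puts the divergence at infinity, where the surface factor \<open>r ^ (n - 1)\<close> turns the weight
  \<open>1 / (1 + r) ^ (n + 1)\<close> into \<open>1 / (1 + r)\<^sup>2\<close>.\<close>
lemma tail_integral_infinite:
  fixes \<psi> :: "real^'n \<Rightarrow> real"
  assumes nonneg: "\<And>x. 0 \<le> \<psi> x" and loc: "locally_integrable \<psi>"
    and \<phi> [measurable]: "\<phi> \<in> borel_measurable borel" and \<phi>0: "\<And>r. 0 \<le> \<phi> r"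
    and eq: "AE x in lborel. \<psi> x = \<phi> (norm x)"
    and inf: "weighted_integral \<psi> = \<infinity>"
  shows "(\<integral>\<^sup>+ r. ennreal (cauchy_weight r * \<phi> r) * indicator {R..} r \<partial>lborel) = \<infinity>"
proof -
  define n where "n = CARD('n)"
  have n1: "n \<ge> 1" by (simp add: n_def Suc_leI)
  define c where "c = real n * unit_ball_vol (real n)"
  have c0: "c \<ge> 0" by (simp add: c_def)
  define h where "h = (\<lambda>r. \<phi> r / (1 + \<bar>r\<bar>) ^ (n + 1))"
  have [measurable]: "h \<in> borel_measurable borel" unfolding h_def by measurable
  have h0: "h r \<ge> 0" for r using \<phi>0 by (simp add: h_def)
  have "weighted_integral \<psi> = (\<integral>\<^sup>+ x. ennreal (h (norm (x::real^'n))) \<partial>lebesgue)"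
    unfolding weighted_integral_def
    by (rule nn_integral_cong_AE) (use eq in \<open>auto simp: AE_completion_iff h_def n_def elim: eventually_mono\<close>)
  also have "\<dots> = (\<integral>\<^sup>+ x. ennreal (h (norm (x::real^'n))) \<partial>lborel)"
    by (rule nn_integral_completion)
  also have "\<dots> = (\<integral>\<^sup>+ x. ennreal (h (norm (x::real^'n))) * indicator {..<R} (norm x) + ennreal (h (norm x)) * indicator {R..} (norm x) \<partial>lborel)"
    by (intro nn_integral_cong) (auto simp: indicator_def)
  also have "\<dots> = (\<integral>\<^sup>+ x. ennreal (h (norm (x::real^'n))) * indicator {..<R} (norm x) \<partial>lborel) + (\<integral>\<^sup>+ x. ennreal (h (norm (x::real^'n))) * indicator {R..} (norm x) \<partial>lborel)"
    by (rule nn_integral_add) measurable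
  finally have split: "(\<integral>\<^sup>+ x. ennreal (h (norm (x::real^'n))) * indicator {..<R} (norm x) \<partial>lborel) + (\<integral>\<^sup>+ x. ennreal (h (norm (x::real^'n))) * indicator {R..} (norm x) \<partial>lborel) = \<infinity>"
    using inf by simp
  have "(\<integral>\<^sup>+ x. ennreal (h (norm (x::real^'n))) * indicator {..<R} (norm x) \<partial>lborel) = (\<integral>\<^sup>+ x. ennreal (h (norm (x::real^'n))) * indicator {..<R} (norm x) \<partial>lebesgue)"
    by (rule nn_integral_completion[symmetric])
  also have "\<dots> \<le> (\<integral>\<^sup>+ x. ennreal (norm (indicator (cball 0 R) x *\<^sub>R \<psi> x)) \<partial>lebesgue)"
  proof (rule nn_integral_mono_AE)
    have "AE x in lebesgue. \<psi> x = \<phi> (norm x)" using eq by (simp add: AE_completion_iff)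
    then show "AE x in lebesgue. ennreal (h (norm (x::real^'n))) * indicator {..<R} (norm x) \<le> ennreal (norm (indicator (cball 0 R) x *\<^sub>R \<psi> x))"
    proof eventually_elim
      case (elim x)
      have "\<phi> (norm x) / (1 + norm x) ^ (n + 1) \<le> \<phi> (norm x) / 1"
        using \<phi>0 by (intro divide_left_mono one_le_power mult_pos_pos zero_less_power) (auto simp: add_pos_nonneg)
      then show ?case using elim \<phi>0 by (auto simp: indicator_def h_def intro!: ennreal_leI)
    qed
  qed
  also have "\<dots> < \<infinity>"
  proof -
    have "set_integrable lebesgue (cball 0 R) \<psi>" using loc by (auto simp: locally_integrable_def)
    then show ?thesis unfolding set_integrable_def integrable_iff_bounded by simp
  qed
  finally have "\<infinity> = (\<integral>\<^sup>+ x. ennreal (h (norm (x::real^'n))) * indicator {R..} (norm x) \<partial>lborel)"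
    using split by (auto simp: ennreal_add_eq_top less_top)
  also have "\<dots> = (\<integral>\<^sup>+ r. ennreal (h r) * indicator {R..} r \<partial>distr (lborel :: (real^'n) measure) borel norm)"
    by (subst nn_integral_distr) auto
  also have "\<dots> = (\<integral>\<^sup>+ r. (ennreal (c * r ^ (n - 1)) * indicator {0..} r) * (ennreal (h r) * indicator {R..} r) \<partial>lborel)"
    unfolding distr_lborel_norm by (subst nn_integral_density) (auto simp: c_def n_def)
  also have "\<dots> \<le> (\<integral>\<^sup>+ r. ennreal c * (ennreal (cauchy_weight r * \<phi> r) * indicator {R..} r) \<partial>lborel)"
  proof (rule nn_integral_mono)
    fix r :: real
    show "(ennreal (c * r ^ (n - 1)) * indicator {0..} r) * (ennreal (h r) * indicator {R..} r) \<le> ennreal c * (ennreal (cauchy_weight r * \<phi> r) * indicator {R..} r)"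
    proof (cases "r \<ge> 0")
      case True
      have "r ^ (n - 1) / (1 + r) ^ (n + 1) \<le> (1 + r) ^ (n - 1) / (1 + r) ^ (n + 1)"
        using True by (intro divide_right_mono power_mono) auto
      also have "\<dots> = 1 / (1 + r)\<^sup>2"
      proof -
        have "n + 1 = (n - 1) + 2" using n1 by simp
        then have "(1 + r) ^ (n + 1) = (1 + r) ^ (n - 1) * (1 + r)\<^sup>2" by (simp only: power_add)
        then show ?thesis using True by simp
      qed
      also have "\<dots> \<le> cauchy_weight r"
        unfolding cauchy_weight_def using True by (intro divide_left_mono) (auto simp: power2_eq_square algebra_simps intro!: mult_pos_pos add_pos_nonneg)
      finally have "\<phi> r * (r ^ (n - 1) / (1 + r) ^ (n + 1)) \<le> \<phi> r * cauchy_weight r" using \<phi>0 by (rule mult_left_mono)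
      then have "c * (r ^ (n - 1) * h r) \<le> c * (cauchy_weight r * \<phi> r)"
        using True c0 by (intro mult_left_mono) (auto simp: h_def mult_ac)
      then have "ennreal (c * r ^ (n - 1)) * ennreal (h r) \<le> ennreal c * ennreal (cauchy_weight r * \<phi> r)"
        using True c0 h0[of r] \<phi>0[of r] by (simp add: ennreal_mult[symmetric] mult.assoc ennreal_leI)
      then show ?thesis by (auto simp: indicator_def)
    qed simp
  qed
  also have "\<dots> = ennreal c * (\<integral>\<^sup>+ r. ennreal (cauchy_weight r * \<phi> r) * indicator {R..} r \<partial>lborel)"
    by (rule nn_integral_cmult) measurable
  finally show ?thesis
    by (auto simp: top.extremum_unique ennreal_mult_eq_top_iff)
qed

text \<open>On the line, \<open>norm (y + s \<eta>) = sqrt (D + u\<^sup>2)\<close> with \<open>D \<ge> 0\<close> and \<open>u = s + y \<bullet> \<eta>\<close>.  The substitution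
  \<open>r = sqrt (D + u\<^sup>2)\<close> has derivative at most \<open>1\<close> and satisfies \<open>r \<ge> u\<close>, so it can only decrease the
  integral; the shift by \<open>y \<bullet> \<eta>\<close> changes the weight by a bounded factor.\<close>
lemma line_integral_infinite:
  fixes y \<eta> :: "'a::euclidean_space"
  assumes \<phi> [measurable]: "\<phi> \<in> borel_measurable borel" and \<phi>0: "\<And>r. 0 \<le> \<phi> r"
    and inf: "\<And>R. (\<integral>\<^sup>+ r. ennreal (cauchy_weight r * \<phi> r) * indicator {R..} r \<partial>lborel) = \<infinity>"
    and \<eta>: "norm \<eta> = 1"
  shows "(\<integral>\<^sup>+ s. ennreal (cauchy_weight s * \<phi> (norm (y + s *\<^sub>R \<eta>))) \<partial>lborel) = \<infinity>"
proof -
  define a where "a = y \<bullet> \<eta>"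
  define D where "D = (norm y)\<^sup>2 - a\<^sup>2"
  have D0: "D \<ge> 0"
    using Cauchy_Schwarz_ineq[of y \<eta>] \<eta> by (simp add: D_def a_def power2_norm_eq_inner[symmetric])
  define g where "g = (\<lambda>u. sqrt (D + u\<^sup>2))"
  have [measurable]: "g \<in> borel_measurable borel" unfolding g_def by measurable
  have nrm: "norm (y + s *\<^sub>R \<eta>) = g (s + a)" for s
  proof -
    have "(norm (y + s *\<^sub>R \<eta>))\<^sup>2 = D + (s + a)\<^sup>2"
    proof -
      have "\<eta> \<bullet> \<eta> = 1" using \<eta> by (simp add: dot_square_norm)
      then show ?thesis
        by (simp only: D_def a_def power2_norm_eq_inner inner_add_left inner_add_right inner_scaleR_left inner_scaleR_right)
           (simp add: inner_commute power2_eq_square algebra_simps)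
    qed
    then show ?thesis unfolding g_def by (metis norm_ge_zero real_sqrt_unique)
  qed
  define g' where "g' = (\<lambda>u. u / g u)"
  have gpos: "g u > 0" "u \<le> g u" if "u \<ge> 1" for u
  proof -
    show "g u > 0" using that D0 by (simp add: g_def add_nonneg_pos)
    show "u \<le> g u" unfolding g_def using D0 by (intro real_le_rsqrt) simp
  qed
  define f where "f = (\<lambda>r. cauchy_weight r * \<phi> r)"
  have [measurable]: "f \<in> borel_measurable borel" unfolding f_def by measurable
  have f0: "f r \<ge> 0" for r using \<phi>0 by (simp add: f_def)
  define J where "J = (\<integral>\<^sup>+ u. ennreal (cauchy_weight u * \<phi> (g u)) \<partial>lborel)"
  have part: "(\<integral>\<^sup>+ r. ennreal (f r) * indicator {g 1..g (real m + 1)} r \<partial>lborel) \<le> J" for m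
  proof -
    have "(\<integral>\<^sup>+ r. ennreal (f r) * indicator {g 1..g (real m + 1)} r \<partial>lborel) = (\<integral>\<^sup>+ r. ennreal (f r * indicator {g 1..g (real m + 1)} r) \<partial>lborel)"
      by (intro nn_integral_cong) (auto simp: indicator_def)
    also have "\<dots> = (\<integral>\<^sup>+ u. ennreal (f (g u) * g' u * indicator {1..real m + 1} u) \<partial>lborel)"
    proof (rule nn_integral_substitution)
      show "set_borel_measurable borel {g 1..g (real m + 1)} f" unfolding set_borel_measurable_def by measurable
      show "(g has_real_derivative g' u) (at u)" if "u \<in> {1..real m + 1}" for u
        using that gpos[of u] unfolding g_def g'_def
        by (auto intro!: derivative_eq_intros simp: field_simps)
      show "continuous_on {1..real m + 1} g'"
        unfolding g'_def g_def using D0 by (intro continuous_intros) (auto simp: add_nonneg_eq_0_iff)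
      show "g' u \<ge> 0" if "u \<in> {1..real m + 1}" for u using that gpos[of u] by (simp add: g'_def)
    qed simp
    also have "\<dots> \<le> J"
      unfolding J_def
    proof (rule nn_integral_mono)
      fix u
      show "ennreal (f (g u) * g' u * indicator {1..real m + 1} u) \<le> ennreal (cauchy_weight u * \<phi> (g u))"
      proof (cases "u \<in> {1..real m + 1}")
        case True
        then have u: "g u > 0" "u \<le> g u" "u \<ge> 1" using gpos[of u] by auto
        have "g' u \<le> 1" using u by (simp add: g'_def)
        then have "f (g u) * g' u \<le> f (g u) * 1" using f0 by (rule mult_left_mono)
        also have "\<dots> \<le> cauchy_weight u * \<phi> (g u)"
        proof -
          have "u\<^sup>2 \<le> (g u)\<^sup>2" using u by (intro power_mono) auto
          then have "cauchy_weight (g u) \<le> cauchy_weight u"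
            unfolding cauchy_weight_def by (intro divide_left_mono) (auto intro!: mult_pos_pos add_pos_nonneg)
          then show ?thesis using \<phi>0 by (simp add: f_def mult_right_mono)
        qed
        finally show ?thesis using True by (simp add: ennreal_leI)
      qed simp
    qed
    finally show ?thesis .
  qed
  have "(\<lambda>m. \<integral>\<^sup>+ r. ennreal (f r) * indicator {g 1..g (real m + 1)} r \<partial>lborel) \<longlonglongrightarrow> (\<integral>\<^sup>+ r. ennreal (f r) * indicator {g 1..} r \<partial>lborel)"
  proof (rule nn_integral_LIMSEQ)
    have gm: "g (real m + 1) \<le> g (real m' + 1)" if "m \<le> m'" for m m'
      unfolding g_def using that by (intro real_sqrt_le_mono add_left_mono power_mono) auto
    show "incseq (\<lambda>m r. ennreal (f r) * indicator {g 1..g (real m + 1)} r)"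
      using gm by (auto simp: incseq_def le_fun_def indicator_def intro: order_trans)
    fix r
    have "\<forall>\<^sub>F m in sequentially. r \<le> g (real m + 1)"
      using eventually_ge_at_top[of "nat \<lceil>r\<rceil>"]
    proof eventually_elim
      case (elim m)
      then have "r \<le> real m + 1" by linarith
      also have "\<dots> \<le> g (real m + 1)" by (rule gpos) simp
      finally show ?case .
    qed
    then have "\<forall>\<^sub>F m in sequentially. ennreal (f r) * indicator {g 1..g (real m + 1)} r = ennreal (f r) * indicator {g 1..} r"
      by eventually_elim (auto simp: indicator_def)
    then show "(\<lambda>m. ennreal (f r) * indicator {g 1..g (real m + 1)} r) \<longlonglongrightarrow> ennreal (f r) * indicator {g 1..} r"
      by (rule tendsto_eventually)
  qed measurable
  then have "(\<integral>\<^sup>+ r. ennreal (f r) * indicator {g 1..} r \<partial>lborel) \<le> J"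
    using part by (intro LIMSEQ_le_const2) auto
  then have J: "J = \<infinity>" using inf[of "g 1"] by (simp add: f_def top.extremum_unique)
  define K where "K = 2 * (1 + a\<^sup>2)"
  have K0: "K > 0" by (simp add: K_def add_pos_nonneg)
  have "J \<le> (\<integral>\<^sup>+ u. ennreal K * ennreal (cauchy_weight (u - a) * \<phi> (g u)) \<partial>lborel)"
    unfolding J_def
  proof (rule nn_integral_mono)
    fix u
    have "1 + (u - a)\<^sup>2 \<le> K * (1 + u\<^sup>2)"
    proof -
      have "K * (1 + u\<^sup>2) - (1 + (u - a)\<^sup>2) = 1 + (u + a)\<^sup>2 + 2 * (a * u)\<^sup>2"
        by (simp add: K_def power2_eq_square algebra_simps)
      then show ?thesis by (smt (verit) zero_le_power2)
    qed
    then have "cauchy_weight u \<le> K * cauchy_weight (u - a)"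
      unfolding cauchy_weight_def by (simp add: field_simps add_pos_nonneg)
    then have "cauchy_weight u * \<phi> (g u) \<le> K * cauchy_weight (u - a) * \<phi> (g u)"
      using \<phi>0 by (rule mult_right_mono)
    then show "ennreal (cauchy_weight u * \<phi> (g u)) \<le> ennreal K * ennreal (cauchy_weight (u - a) * \<phi> (g u))"
      using K0 \<phi>0 by (simp add: ennreal_mult[symmetric] ennreal_leI mult.assoc)
  qed
  also have "\<dots> = ennreal K * (\<integral>\<^sup>+ u. ennreal (cauchy_weight (u - a) * \<phi> (g u)) \<partial>lborel)"
    by (rule nn_integral_cmult) measurable
  also have "(\<integral>\<^sup>+ u. ennreal (cauchy_weight (u - a) * \<phi> (g u)) \<partial>lborel) = (\<integral>\<^sup>+ s. ennreal (cauchy_weight s * \<phi> (g (s + a))) \<partial>lborel)"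
    using nn_integral_real_affine[of "\<lambda>u. ennreal (cauchy_weight (u - a) * \<phi> (g u))" 1 a] by (simp add: add.commute)
  finally show ?thesis
    unfolding nrm J
    by (auto simp: top.extremum_unique ennreal_mult_eq_top_iff)
qed

section \<open>Functions supported in a half-space\<close>

lemma locally_integrable_measurable:
  fixes \<psi> :: "real^'n \<Rightarrow> real"
  assumes "locally_integrable \<psi>"
  shows "\<psi> \<in> borel_measurable lebesgue"
proof (rule borel_measurable_LIMSEQ_real)
  show "(\<lambda>x. indicator (cball 0 (real k)) x *\<^sub>R \<psi> x) \<in> borel_measurable lebesgue" for k
    using assms by (auto simp: locally_integrable_def set_integrable_def intro!: borel_measurable_integrable)
  fix x :: "real^'n"
  have "\<forall>\<^sub>F k in sequentially. indicator (cball 0 (real k)) x *\<^sub>R \<psi> x = \<psi> x"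
    using eventually_ge_at_top[of "nat \<lceil>norm x\<rceil>"]
    by eventually_elim (simp add: nat_le_iff ceiling_le_iff)
  then show "(\<lambda>k. indicator (cball 0 (real k)) x *\<^sub>R \<psi> x) \<longlonglongrightarrow> \<psi> x"
    by (rule tendsto_eventually)
qed

text \<open>The open null sets are uncountably many; Lindelof's theorem reduces them to countably many.\<close>
lemma AE_zero_outside_ess_support:
  fixes f :: "real^'n \<Rightarrow> complex"
  shows "AE x in lebesgue. x \<notin> ess_support f \<longrightarrow> f x = 0"
proof -
  define \<U> where "\<U> = {U. open U \<and> (AE x in lebesgue. x \<in> U \<longrightarrow> f x = 0)}"
  obtain \<U>' where \<U>': "\<U>' \<subseteq> \<U>" "countable \<U>'" "\<Union>\<U>' = \<Union>\<U>"
    using Lindelof[of \<U>] by (auto simp: \<U>_def)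
  have "AE x in lebesgue. \<forall>U\<in>\<U>'. x \<in> U \<longrightarrow> f x = 0"
    using \<U>' by (subst AE_ball_countable) (auto simp: \<U>_def)
  then show ?thesis
  proof eventually_elim
    case (elim x)
    then show ?case using \<U>'(3) by (auto simp: ess_support_def \<U>_def)
  qed
qed

text \<open>On a line the vanishing moments with \<open>k \<ge> 1\<close> together with the divergent logarithmic integral force
  the moment with \<open>k = 0\<close> to vanish.\<close>
lemma line_transform_0_eq_0:
  fixes G :: "real^'n \<Rightarrow> complex"
  assumes [measurable]: "G \<in> borel_measurable borel" "\<phi> \<in> borel_measurable borel" and \<phi>0: "\<And>r. 0 \<le> \<phi> r"
    and tail: "\<And>R. (\<integral>\<^sup>+ r. ennreal (cauchy_weight r * \<phi> r) * indicator {R..} r \<partial>lborel) = \<infinity>"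
    and \<eta>: "norm \<eta> = 1"
    and bnd: "AE s in lborel. norm (G (y + s *\<^sub>R \<eta>)) \<le> C * exp (- \<phi> (norm (y + s *\<^sub>R \<eta>)))"
    and moments: "\<And>k. k \<ge> 1 \<Longrightarrow> line_transform G \<eta> t k y = 0"
  shows "line_transform G \<eta> t 0 y = 0"
proof -
  define g where "g = (\<lambda>s. G (y + s *\<^sub>R \<eta>) * exp (2 * of_real pi * \<i> * of_real (t * s)))"
  have eq: "line_transform G \<eta> t k y = (LINT s|lborel. cauchy_weight s *\<^sub>R (g s * cayley (of_real s) ^ k))" for k
    by (simp add: line_transform_def line_kernel_def g_def mult_ac)
  have "(LINT s|lborel. cauchy_weight s *\<^sub>R g s) = 0"
  proof (rule vanishing_of_log_integral)
    show "g \<in> borel_measurable borel" unfolding g_def by measurable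
    show "(\<lambda>s. \<phi> (norm (y + s *\<^sub>R \<eta>))) \<in> borel_measurable borel" by measurable
    show "AE s in lborel. norm (g s) \<le> C * exp (- \<phi> (norm (y + s *\<^sub>R \<eta>)))"
      using bnd by (simp add: g_def norm_mult norm_exp_eq_Re)
    show "(\<integral>\<^sup>+ s. ennreal (cauchy_weight s * \<phi> (norm (y + s *\<^sub>R \<eta>))) \<partial>lborel) = \<infinity>"
      by (rule line_integral_infinite[OF _ \<phi>0 tail \<eta>]) measurable
    show "(LINT s|lborel. cauchy_weight s *\<^sub>R (g s * cayley (complex_of_real s) ^ k)) = 0" if "k \<ge> 1" for k
      using moments[OF that] by (simp add: eq)
  qed (rule \<phi>0)
  then show ?thesis by (simp add: eq)
qed

theorem half_space_uniqueness:
  fixes \<psi> :: "real^'n \<Rightarrow> real" and f fhat :: "real^'n \<Rightarrow> complex"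
  assumes nonneg: "\<And>x. 0 \<le> \<psi> x" and loc: "locally_integrable \<psi>" and rad: "radial \<psi>"
    and hf: "has_fourier_L2 f fhat"
    and decay: "AE y in lebesgue. norm (fhat y) \<le> C * exp (- \<psi> y)"
    and \<eta>: "norm \<eta> = 1" and supp: "ess_support f \<subseteq> {x. x \<bullet> \<eta> \<le> t}"
    and inf: "weighted_integral \<psi> = \<infinity>"
  shows "AE x in lebesgue. f x = 0"
proof -
  have sf: "square_integrable f" "square_integrable fhat" using hf by (auto simp: has_fourier_L2_def)
  obtain f' where f': "f' \<in> borel_measurable borel" "AE x in lborel. f x = f' x"
    using sf(1) lebesgue_measurable_borel_version by (auto simp: square_integrable_def)
  obtain g' where g': "g' \<in> borel_measurable borel" "AE x in lborel. fhat x = g' x"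
    using sf(2) lebesgue_measurable_borel_version by (auto simp: square_integrable_def)
  note [measurable] = f'(1) g'(1)
  obtain \<phi> where \<phi>: "\<phi> \<in> borel_measurable borel" and \<phi>0: "\<And>r. 0 \<le> \<phi> r"
    and \<phi>_le: "\<And>x. \<phi> (norm x) \<le> \<psi> x" and \<phi>_eq: "AE x in lborel. \<psi> x = \<phi> (norm x)"
    using radial_borel_minorant[OF locally_integrable_measurable[OF loc] nonneg rad] by metis
  note [measurable] = \<phi>
  have tail: "(\<integral>\<^sup>+ r. ennreal (cauchy_weight r * \<phi> r) * indicator {R..} r \<partial>lborel) = \<infinity>" for R
    by (rule tail_integral_infinite[OF nonneg loc \<phi> \<phi>0 \<phi>_eq inf])
  define D where "D = \<bar>C\<bar>"
  \<comment> \<open>Changing the transform on a null set makes it bounded everywhere, hence on every line.\<close>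
  define G where "G = (\<lambda>y. if norm (g' y) \<le> D then g' y else 0)"
  have G [measurable]: "G \<in> borel_measurable borel" unfolding G_def by measurable
  have Gb: "norm (G y) \<le> D" for y by (simp add: G_def D_def)
  have dec: "AE y in lborel. norm (fhat y) \<le> D * exp (- \<phi> (norm y))"
    using decay unfolding AE_lebesgue_iff
  proof eventually_elim
    case (elim y)
    also have "C * exp (- \<psi> y) \<le> D * exp (- \<phi> (norm y))"
      using \<phi>_le[of y] by (intro mult_mono) (auto simp: D_def)
    finally show ?case .
  qed
  have fhat_G: "AE y in lborel. fhat y = G y"
    using dec g'(2)
  proof eventually_elim
    case (elim y)
    have "D * exp (- \<phi> (norm y)) \<le> D * 1" using \<phi>0[of "norm y"] by (intro mult_left_mono) (auto simp: D_def)
    then show ?case using elim by (simp add: G_def)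
  qed
  have G_dec: "AE y in lborel. norm (G y) \<le> D * exp (- \<phi> (norm y))"
    using dec fhat_G by eventually_elim simp
  have zero: "AE x in lborel. x \<bullet> \<eta> > t \<longrightarrow> f' x = 0"
    using AE_zero_outside_ess_support[of f, unfolded AE_lebesgue_iff] f'(2)
    by eventually_elim (use supp in force)
  note LT = integral_gauss_line_transform[OF G Gb hf f' fhat_G zero]
  have LT_k: "AE y in lborel. line_transform G \<eta> t k y = 0" if k: "k \<ge> 1" for k
  proof (rule AE_eq_0_of_gauss)
    show "integrable lborel (\<lambda>x. line_transform G \<eta> t k x * complex_of_real (exp (- (norm x)\<^sup>2)))"
      using integrable_gauss[of 1 "0::real^'n"] norm_line_transform_le[OF G Gb] measurable_line_transform[OF G Gb]
      by (intro integrable_mult_bounded(2)) auto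
    fix c :: real and b :: "real^'n" assume c: "c > 0"
    show "(LINT x|lborel. line_transform G \<eta> t k x * complex_of_real (exp (- c * (norm (x - b))\<^sup>2))) = 0"
      using LT[OF c, of 0 b k] k by (simp add: modulated_gauss_def mult.commute)
  qed
  then have "AE y in lborel. \<forall>k. k \<ge> 1 \<longrightarrow> line_transform G \<eta> t k y = 0"
    unfolding AE_all_countable by (auto intro: AE_I2)
  then have LT_0: "AE y in lborel. line_transform G \<eta> t 0 y = 0"
    using AE_on_lines[OF G_dec, of \<eta>]
    by eventually_elim (rule line_transform_0_eq_0[OF G \<phi> \<phi>0 tail \<eta>], auto)
  \<comment> \<open>The transform of the line kernel for \<open>k = 0\<close>, cut off outside the half-space, where it would be unbounded.\<close>
  define w where "w = (\<lambda>x. complex_of_real (if x \<bullet> \<eta> \<le> t then pi * exp (- (2 * pi * (t - x \<bullet> \<eta>))) else 0))"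
  have [measurable]: "w \<in> borel_measurable borel" unfolding w_def by measurable
  have w1: "norm (w x) \<le> pi" for x by (simp add: w_def)
  have "AE x in lborel. f' x * w x = 0"
  proof (rule AE_eq_0_of_gauss)
    have "square_integrable (\<lambda>x::real^'n. complex_of_real (exp (- (norm x)\<^sup>2)))"
      using integrable_gauss[of 1 "0::real^'n"] by (intro square_integrable_of_bounded[where B = 1]) auto
    then have "integrable lebesgue (\<lambda>x. f x * complex_of_real (exp (- (norm x)\<^sup>2)))"
      using sf(1) by (intro square_integrable_mult)
    moreover have "(\<lambda>x::real^'n. f' x * complex_of_real (exp (- (norm x)\<^sup>2))) \<in> borel_measurable lebesgue"
      by (intro measurable_completion) measurable
    ultimately have "integrable lebesgue (\<lambda>x. f' x * complex_of_real (exp (- (norm x)\<^sup>2)))"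
      using f'(2) unfolding AE_lebesgue_iff[symmetric]
      by (subst integrable_cong_AE[where g = "\<lambda>x. f x * complex_of_real (exp (- (norm x)\<^sup>2))"]) (auto elim: eventually_mono)
    then have "integrable lborel (\<lambda>x. f' x * complex_of_real (exp (- (norm x)\<^sup>2)))"
      by (subst (asm) integrable_completion) auto
    then have "integrable lborel (\<lambda>x. (f' x * complex_of_real (exp (- (norm x)\<^sup>2))) * w x)"
      by (rule integrable_mult_bounded(1)[OF _ _ w1]) measurable
    then show "integrable lborel (\<lambda>x. f' x * w x * complex_of_real (exp (- (norm x)\<^sup>2)))"
      by (simp add: mult_ac)
    fix c :: real and b :: "real^'n" assume c: "c > 0"
    define c' where "c' = pi\<^sup>2 / c"
    have c': "c' > 0" "pi\<^sup>2 / c' = c" using c by (simp_all add: c'_def)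
    define A where "A = complex_of_real (sqrt (pi / c') ^ CARD('n))"
    have A: "A \<noteq> 0" using c' by (simp add: A_def)
    have "0 = (LINT y|lborel. modulated_gauss c' b 0 y * line_transform G \<eta> t 0 y)"
    proof -
      have "(LINT y|lborel. modulated_gauss c' b 0 y * line_transform G \<eta> t 0 y) = (LINT (y::real^'n)|lborel. 0)"
        using LT_0 measurable_line_transform[OF G Gb] by (intro integral_cong_AE) (auto elim: eventually_mono)
      then show ?thesis by simp
    qed
    also have "\<dots> = (LINT x|lborel. f' x * fourier_L1 (modulated_gauss c' b 0) x * of_real (pi * exp (- (2 * pi * (t - x \<bullet> \<eta>)))))"
      using LT[OF c'(1), of b 0 0] by simp
    also have "\<dots> = (LINT x|lborel. A * (f' x * w x * complex_of_real (exp (- c * (norm (x - b))\<^sup>2))))"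
    proof (rule integral_cong_AE)
      show "AE x in lborel. f' x * fourier_L1 (modulated_gauss c' b 0) x * of_real (pi * exp (- (2 * pi * (t - x \<bullet> \<eta>)))) = A * (f' x * w x * complex_of_real (exp (- c * (norm (x - b))\<^sup>2)))"
        using zero
      proof eventually_elim
        case (elim x)
        then show ?case
          by (cases "x \<bullet> \<eta> \<le> t") (simp_all only: fourier_modulated_gauss[OF c'(1)] c'(2) w_def A_def, simp_all add: mult_ac)
      qed
    qed measurable
    also have "\<dots> = A * (LINT x|lborel. f' x * w x * complex_of_real (exp (- c * (norm (x - b))\<^sup>2)))" by simp
    finally show "(LINT x|lborel. f' x * w x * complex_of_real (exp (- c * (norm (x - b))\<^sup>2))) = 0" using A by simp
  qed
  then have "AE x in lborel. f x = 0"
    using f'(2) zero by eventually_elim (auto simp: w_def split: if_splits)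
  then show ?thesis by (simp add: AE_lebesgue_iff)
qed

section \<open>Smooth functions and random translations\<close>

lemma C_k_Suc_I:
  fixes f :: "real^'n \<Rightarrow> complex"
  assumes "\<And>x. (f has_derivative f' x) (at x)" and "\<And>v. C_k k (\<lambda>x. f' x v)"
  shows "C_k (Suc k) f"
proof -
  have "frechet_derivative f (at x) = f' x" for x
    using assms(1)[of x] by (rule frechet_derivative_at[symmetric])
  then show ?thesis using assms by (auto simp: differentiable_on_def differentiable_def)
qed

lemma C_k_Suc_derivative:
  fixes f :: "real^'n \<Rightarrow> complex"
  assumes "C_k (Suc k) f"
  shows "(f has_derivative frechet_derivative f (at x)) (at x)" "C_k k (\<lambda>x. frechet_derivative f (at x) v)"
  using assms by (auto simp: differentiable_on_def frechet_derivative_works)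

lemma C_k_SucD: "C_k (Suc k) f \<Longrightarrow> C_k k f"
proof (induction k arbitrary: f)
  case 0
  then show ?case by (auto intro: differentiable_imp_continuous_on)
qed auto

lemma C_k_const: "C_k k (\<lambda>x::real^'n. c)"
proof (induction k arbitrary: c)
  case (Suc k)
  show ?case by (rule C_k_Suc_I[where f' = "\<lambda>_ _. 0"]) (auto intro: Suc)
qed simp

lemma C_k_add: "C_k k f \<Longrightarrow> C_k k g \<Longrightarrow> C_k k (\<lambda>x::real^'n. f x + g x)"
proof (induction k arbitrary: f g)
  case (Suc k)
  show ?case
    by (rule C_k_Suc_I[OF has_derivative_add[OF C_k_Suc_derivative(1)[OF Suc.prems(1)] C_k_Suc_derivative(1)[OF Suc.prems(2)]]])
       (intro Suc.IH C_k_Suc_derivative Suc.prems)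
qed (auto intro: continuous_intros)

lemma C_k_mult: "C_k k f \<Longrightarrow> C_k k g \<Longrightarrow> C_k k (\<lambda>x::real^'n. f x * g x)"
proof (induction k arbitrary: f g)
  case (Suc k)
  show ?case
    by (rule C_k_Suc_I[OF has_derivative_mult[OF C_k_Suc_derivative(1)[OF Suc.prems(1)] C_k_Suc_derivative(1)[OF Suc.prems(2)]]])
       (intro C_k_add Suc.IH C_k_Suc_derivative Suc.prems C_k_SucD)
qed (auto intro: continuous_intros)

lemma C_k_inner: "C_k k (\<lambda>x::real^'n. complex_of_real (c * (x \<bullet> v)))"
proof (cases k)
  case (Suc k)
  have "((\<lambda>x::real^'n. complex_of_real (c * (x \<bullet> v))) has_derivative (\<lambda>u. complex_of_real (c * (u \<bullet> v)))) (at x)" for x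
    by (auto intro!: derivative_eq_intros has_derivative_of_real)
  then show ?thesis unfolding Suc by (rule C_k_Suc_I) (rule C_k_const)
qed (auto intro!: continuous_intros)

text \<open>The family of functions \<open>q(1/t) exp (-1/t)\<close>, extended by \<open>0\<close> to \<open>t \<le> 0\<close>; it contains \<open>exp (-1/t)\<close>
  and is closed under differentiation.\<close>
definition flat_exp :: "real poly \<Rightarrow> real \<Rightarrow> real" where
  "flat_exp q t = (if t > 0 then poly q (1 / t) * exp (- 1 / t) else 0)"

lemma poly_div_exp_tendsto_0: "((\<lambda>s. poly q s / exp s) \<longlongrightarrow> (0::real)) at_top"
proof -
  have "((\<lambda>s. \<Sum>i\<le>degree q. coeff q i * (s ^ i / exp s)) \<longlongrightarrow> (\<Sum>i\<le>degree q. coeff q i * 0)) (at_top :: real filter)"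
    by (intro tendsto_intros tendsto_power_div_exp_0)
  then show ?thesis by (simp add: poly_altdef sum_divide_distrib)
qed

lemma flat_exp_derivative:
  "(flat_exp q has_real_derivative flat_exp ([:0, 0, 1:] * (q - pderiv q)) t) (at t)"
proof -
  consider "t > 0" | "t < 0" | "t = 0" by linarith
  then show ?thesis
  proof cases
    case 1
    have inv: "((\<lambda>t. 1 / t) has_real_derivative - 1 / t\<^sup>2) (at t)" "((\<lambda>t. - 1 / t) has_real_derivative 1 / t\<^sup>2) (at t)"
      using 1 by (auto intro!: derivative_eq_intros simp: power2_eq_square)
    have "((\<lambda>t. poly q (1 / t)) has_real_derivative poly (pderiv q) (1 / t) * (- 1 / t\<^sup>2)) (at t)"
      by (rule DERIV_chain2[OF poly_DERIV inv(1)])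
    moreover have "((\<lambda>t. exp (- 1 / t)) has_real_derivative exp (- 1 / t) * (1 / t\<^sup>2)) (at t)"
      by (rule DERIV_chain2[OF DERIV_exp inv(2)])
    ultimately have "((\<lambda>t. poly q (1 / t) * exp (- 1 / t)) has_real_derivative poly (pderiv q) (1 / t) * (- 1 / t\<^sup>2) * exp (- 1 / t) + exp (- 1 / t) * (1 / t\<^sup>2) * poly q (1 / t)) (at t)"
      by (rule DERIV_mult)
    also have "poly (pderiv q) (1 / t) * (- 1 / t\<^sup>2) * exp (- 1 / t) + exp (- 1 / t) * (1 / t\<^sup>2) * poly q (1 / t) = flat_exp ([:0, 0, 1:] * (q - pderiv q)) t"
      using 1 by (simp add: flat_exp_def power2_eq_square field_simps)
    finally show ?thesis
      by (rule has_field_derivative_transform_within_open[where S = "{0<..}"]) (use 1 in \<open>auto simp: flat_exp_def\<close>)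
  next
    case 2
    have "((\<lambda>t. 0) has_real_derivative 0) (at t)" by simp
    then have "(flat_exp q has_real_derivative 0) (at t)"
      by (rule has_field_derivative_transform_within_open[where S = "{..<0}"]) (use 2 in \<open>auto simp: flat_exp_def\<close>)
    then show ?thesis using 2 by (simp add: flat_exp_def)
  next
    case 3
    have "((\<lambda>h. flat_exp q h / h) \<longlongrightarrow> 0) (at_right 0)"
      unfolding filterlim_at_right_to_top
    proof (rule Lim_transform_eventually)
      show "((\<lambda>s. poly (pCons 0 q) s / exp s) \<longlongrightarrow> (0::real)) at_top" by (rule poly_div_exp_tendsto_0)
      show "\<forall>\<^sub>F s in at_top. poly (pCons 0 q) s / exp s = flat_exp q (inverse s) / inverse s"
        using eventually_gt_at_top[of "0::real"] by eventually_elim (simp add: flat_exp_def exp_minus field_simps)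
    qed
    moreover have "((\<lambda>h. flat_exp q h / h) \<longlongrightarrow> 0) (at_left 0)"
    proof (rule tendsto_eventually)
      show "\<forall>\<^sub>F h in at_left 0. flat_exp q h / h = 0"
        by (auto simp: eventually_at_filter flat_exp_def)
    qed
    ultimately have "((\<lambda>h. flat_exp q h / h) \<longlongrightarrow> 0) (at 0)" by (rule filterlim_split_at[rotated])
    then show ?thesis using 3 by (simp add: has_field_derivative_iff flat_exp_def)
  qed
qed

lemma C_k_flat_exp: "C_k k (\<lambda>x::real^'n. complex_of_real (flat_exp q (d - x \<bullet> x)))"
proof (induction k arbitrary: q)
  case 0
  have "continuous_on UNIV (flat_exp q)" by (rule DERIV_continuous_on) (rule has_field_derivative_at_within, rule flat_exp_derivative)
  then have "continuous_on UNIV (\<lambda>x::real^'n. flat_exp q (d - x \<bullet> x))"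
    by (rule continuous_on_compose2) (auto intro!: continuous_intros)
  then show ?case by (auto intro: continuous_intros)
next
  case (Suc k)
  let ?q = "[:0, 0, 1:] * (q - pderiv q)"
  have "((\<lambda>x::real^'n. flat_exp q (d - x \<bullet> x)) has_derivative (\<lambda>v. flat_exp ?q (d - x \<bullet> x) * (- 2 * (x \<bullet> v)))) (at x)" for x
  proof -
    have "((\<lambda>x::real^'n. d - x \<bullet> x) has_derivative (\<lambda>v. - 2 * (x \<bullet> v))) (at x)"
      by (auto intro!: derivative_eq_intros simp: inner_commute)
    from has_derivative_compose[OF this flat_exp_derivative[unfolded has_field_derivative_def]] show ?thesis by simp
  qed
  then have "((\<lambda>x::real^'n. complex_of_real (flat_exp q (d - x \<bullet> x))) has_derivative (\<lambda>v. complex_of_real (flat_exp ?q (d - x \<bullet> x) * (- 2 * (x \<bullet> v))))) (at x)" for x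
    by (rule has_derivative_of_real)
  then show ?case
  proof (rule C_k_Suc_I)
    fix v :: "real^'n"
    have "C_k k (\<lambda>x. complex_of_real (flat_exp ?q (d - x \<bullet> x)) * complex_of_real (- 2 * (x \<bullet> v)))"
      by (intro C_k_mult Suc C_k_inner)
    then show "C_k k (\<lambda>x. complex_of_real (flat_exp ?q (d - x \<bullet> x) * (- 2 * (x \<bullet> v))))" by simp
  qed
qed

text \<open>On a ball the partial derivatives are uniformly continuous, so the error of the linear approximation
  is small uniformly in the base point.  This uniformity allows differentiation under an integral.\<close>
lemma C_1_uniform_linearization:
  fixes h :: "real^'n \<Rightarrow> complex"
  assumes h: "C_k (Suc 0) h" and e: "e > 0"
  obtains \<delta> where "\<delta> > 0" "\<And>y v. norm y \<le> r \<Longrightarrow> norm v < \<delta> \<Longrightarrow> norm (h (y + v) - h y - frechet_derivative h (at y) v) \<le> e * norm v"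
proof -
  define h' where "h' = (\<lambda>y. frechet_derivative h (at y))"
  have der: "(h has_derivative h' y) (at y)" for y
    unfolding h'_def by (rule C_k_Suc_derivative[OF h])
  \<comment> \<open>All partial derivatives are collected in one vector, so that a single modulus of continuity serves them all.\<close>
  define V where "V = (\<lambda>y. \<chi> i. h' y (axis i 1))"
  have "continuous_on UNIV V"
    unfolding V_def using h by (intro continuous_on_vec_lambda) (auto simp: h'_def)
  then have "uniformly_continuous_on (cball 0 (r + 1)) V"
    by (intro compact_uniformly_continuous) (auto intro: continuous_on_subset)
  moreover define e' where "e' = e / CARD('n)"
  have e': "e' > 0" using e by (simp add: e'_def)
  ultimately obtain \<delta>0 where \<delta>0: "\<delta>0 > 0" "\<And>y z. y \<in> cball 0 (r + 1) \<Longrightarrow> z \<in> cball 0 (r + 1) \<Longrightarrow> dist z y < \<delta>0 \<Longrightarrow> dist (V z) (V y) < e'"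
    unfolding uniformly_continuous_on_def by metis
  define \<delta> where "\<delta> = min 1 \<delta>0"
  show ?thesis
  proof (rule that[of \<delta>])
    show "\<delta> > 0" using \<delta>0 by (simp add: \<delta>_def)
    fix y v :: "real^'n" assume y: "norm y \<le> r" and v: "norm v < \<delta>"
    have seg: "norm (y + t *\<^sub>R v) \<le> r + 1" "norm (t *\<^sub>R v) < \<delta>0" if "t \<in> {0..1}" for t
    proof -
      have "\<bar>t\<bar> * norm v \<le> 1 * norm v" using that by (intro mult_right_mono) auto
      then have "norm (t *\<^sub>R v) \<le> norm v" by simp
      then show "norm (y + t *\<^sub>R v) \<le> r + 1" "norm (t *\<^sub>R v) < \<delta>0"
        using y v norm_triangle_ineq[of y "t *\<^sub>R v"] by (auto simp: \<delta>_def)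
    qed
    define S where "S = (\<lambda>t. y + t *\<^sub>R v) ` {0..1}"
    have "norm (h (y + v) - h y - h' y ((y + v) - y)) \<le> norm ((y + v) - y) * e"
    proof (rule differentiable_bound_linearization[where S = S])
      show "y + t *\<^sub>R (y + v - y) \<in> S" if "t \<in> {0..1}" for t using that by (auto simp: S_def)
      show "(h has_derivative h' z) (at z within S)" for z using der by (rule has_derivative_at_withinI)
      show "y \<in> S" unfolding S_def by (rule image_eqI[of _ _ 0]) auto
      show "onorm (h' z - h' y) \<le> e" if zS: "z \<in> S" for z
        unfolding fun_diff_def
      proof (rule onorm_le)
        obtain t where "z = y + t *\<^sub>R v" "t \<in> {0..1}" by (rule imageE[OF zS[unfolded S_def]])
        then have t: "t \<in> {0..1}" "z = y + t *\<^sub>R v" by simp_all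
        have "dist (V z) (V y) < e'"
        proof (rule \<delta>0(2))
          show "y \<in> cball 0 (r + 1)" "z \<in> cball 0 (r + 1)" using y seg(1)[OF t(1)] t(2) by (simp_all only: mem_cball_0)
          show "dist z y < \<delta>0" using seg(2)[OF t(1)] t(2) by (simp add: dist_norm)
        qed
        then have Vd: "norm (V z - V y) \<le> e'" by (simp add: dist_norm)
        fix u
        have lin: "linear (h' w)" for w using has_derivative_bounded_linear[OF der] by (rule bounded_linear.linear)
        have ex: "h' w u = (\<Sum>i\<in>UNIV. (u $ i) *\<^sub>R (V w $ i))" for w
        proof -
          have "h' w u = h' w (\<Sum>i\<in>UNIV. (u $ i) *\<^sub>R axis i 1)" by (simp only: basis_expansion scalar_mult_eq_scaleR[symmetric])
          then show ?thesis by (simp add: linear_sum[OF lin] linear_scale[OF lin] V_def)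
        qed
        have "norm (h' z u - h' y u) = norm (\<Sum>i\<in>UNIV. (u $ i) *\<^sub>R ((V z - V y) $ i))"
          by (simp add: ex sum_subtractf scaleR_diff_right)
        also have "\<dots> \<le> (\<Sum>i\<in>(UNIV :: 'n set). norm u * e')"
        proof (rule order_trans[OF norm_sum sum_mono])
          fix i
          have "norm ((V z - V y) $ i) \<le> e'" using Vd Finite_Cartesian_Product.norm_nth_le[of "V z - V y" i] by linarith
          then show "norm ((u $ i) *\<^sub>R ((V z - V y) $ i)) \<le> norm u * e'"
            using component_le_norm_cart[of u i] by (simp only: norm_scaleR) (intro mult_mono, auto)
        qed
        also have "\<dots> = e * norm u" by (simp add: e'_def)
        finally show "norm (h' z u - h' y u) \<le> e * norm u" .
      qed
    qed
    then show "norm (h (y + v) - h y - frechet_derivative h (at y) v) \<le> e * norm v"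
      by (simp add: h'_def mult.commute)
  qed
qed

text \<open>The convolution of \<open>h\<close> with the distribution of \<open>X\<close>.\<close>
definition average :: "'w measure \<Rightarrow> ('w \<Rightarrow> real^'n) \<Rightarrow> (real^'n \<Rightarrow> complex) \<Rightarrow> real^'n \<Rightarrow> complex" where
  "average M X h x = (LINT w|M. h (x - X w))"

context
  fixes M :: "'w measure" and X :: "'w \<Rightarrow> real^'n" and R :: real
  assumes prob: "prob_space M" and X [measurable]: "X \<in> borel_measurable M" and R: "\<And>w. norm (X w) \<le> R"
begin

interpretation prob_space M by (rule prob)

lemma integrable_average:
  fixes h :: "real^'n \<Rightarrow> complex"
  assumes "continuous_on UNIV h" shows "integrable M (\<lambda>w. h (x - X w))"
proof -
  have [measurable]: "h \<in> borel_measurable borel" using assms by (rule borel_measurable_continuous_onI)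
  have "compact (h ` cball x R)" using assms by (intro compact_continuous_image) (auto intro: continuous_on_subset)
  then obtain B where B: "\<And>z. z \<in> cball x R \<Longrightarrow> norm (h z) \<le> B" using compact_imp_bounded bounded_iff by (metis imageI)
  show ?thesis
    by (rule integrable_const_bound[where B = B]) (use R in \<open>auto intro!: B AE_I2 simp: dist_norm\<close>)
qed

text \<open>Since \<open>X\<close> is bounded, the points \<open>x - X w\<close> stay in a fixed ball, where \<open>C_1_uniform_linearization\<close> applies.\<close>
lemma average_has_derivative:
  assumes h: "C_k (Suc 0) h"
  shows "(average M X h has_derivative (\<lambda>v. average M X (\<lambda>y. frechet_derivative h (at y) v) x)) (at x)"
proof -
  have hc: "continuous_on UNIV h" using C_k_SucD[OF h] by simp
  have dc: "continuous_on UNIV (\<lambda>y. frechet_derivative h (at y) v)" for v using h by auto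
  have lin: "linear (frechet_derivative h (at y))" for y
    using has_derivative_bounded_linear[OF C_k_Suc_derivative(1)[OF h]] by (rule bounded_linear.linear)
  note int = integrable_average[OF hc] integrable_average[OF dc]
  show ?thesis
    unfolding has_derivative_at_alt
  proof (intro conjI allI impI)
    have "linear (\<lambda>v. average M X (\<lambda>y. frechet_derivative h (at y) v) x)"
      unfolding average_def by (rule linearI) (simp_all add: linear_add[OF lin] linear_scale[OF lin] int Bochner_Integration.integral_add)
    then show "bounded_linear (\<lambda>v. average M X (\<lambda>y. frechet_derivative h (at y) v) x)"
      by (simp add: linear_conv_bounded_linear)
    fix e :: real assume e: "e > 0"
    obtain \<delta> where \<delta>: "\<delta> > 0" "\<And>y v. norm y \<le> norm x + R \<Longrightarrow> norm v < \<delta> \<Longrightarrow> norm (h (y + v) - h y - frechet_derivative h (at y) v) \<le> e * norm v"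
      using C_1_uniform_linearization[OF h e] by blast
    show "\<exists>d>0. \<forall>y. norm (y - x) < d \<longrightarrow> norm (average M X h y - average M X h x - average M X (\<lambda>z. frechet_derivative h (at z) (y - x)) x) \<le> e * norm (y - x)"
    proof (intro exI[of _ \<delta>] conjI allI impI \<delta>(1))
      fix y assume y: "norm (y - x) < \<delta>"
      have "average M X h y - average M X h x - average M X (\<lambda>z. frechet_derivative h (at z) (y - x)) x =
         (LINT w|M. h (y - X w) - h (x - X w) - frechet_derivative h (at (x - X w)) (y - x))"
        unfolding average_def by (simp add: int)
      also have "norm \<dots> \<le> (LINT w|M. e * norm (y - x))"
      proof (rule integral_norm_bound_integral_AE)
        show "integrable M (\<lambda>w. h (y - X w) - h (x - X w) - frechet_derivative h (at (x - X w)) (y - x))"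
          by (intro Bochner_Integration.integrable_diff int)
        show "AE w in M. norm (h (y - X w) - h (x - X w) - frechet_derivative h (at (x - X w)) (y - x)) \<le> e * norm (y - x)"
        proof (rule AE_I2)
          fix w
          have "norm (x - X w) \<le> norm x + R" using norm_triangle_ineq4[of x "X w"] R[of w] by linarith
          from \<delta>(2)[OF this y] show "norm (h (y - X w) - h (x - X w) - frechet_derivative h (at (x - X w)) (y - x)) \<le> e * norm (y - x)"
            by (simp add: algebra_simps)
        qed
      qed simp
      finally show "norm (average M X h y - average M X h x - average M X (\<lambda>z. frechet_derivative h (at z) (y - x)) x) \<le> e * norm (y - x)"
        by (simp add: prob_space)
    qed
  qed
qed

text \<open>The directional derivatives of the average are the averages of the directional derivatives, which are again
  of class \<open>C_k\<close> for every \<open>k\<close>.\<close>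
lemma C_k_average: "(\<And>k. C_k k h) \<Longrightarrow> C_k k (average M X h)"
proof (induction k arbitrary: h)
  case 0
  show ?case using average_has_derivative[OF 0]
    by (auto intro!: continuous_at_imp_continuous_on has_derivative_continuous)
next
  case (Suc k)
  show ?case
  proof (rule C_k_Suc_I[OF average_has_derivative[OF Suc.prems]])
    show "C_k k (average M X (\<lambda>y. frechet_derivative h (at y) v))" for v
      by (rule Suc.IH) (rule C_k_Suc_derivative(2)[OF Suc.prems])
  qed
qed

lemma fourier_average:
  assumes hc: "continuous_on UNIV h" and hi: "integrable lborel h"
  shows "fourier_L1 (average M X h) y = fourier_L1 h y * (LINT w|M. fourier_char (X w \<bullet> y))"
proof -
  interpret P: pair_sigma_finite M "lborel :: (real^'n) measure" ..
  have [measurable]: "h \<in> borel_measurable borel" using hc by (rule borel_measurable_continuous_onI)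
  define E where "E = (\<lambda>x. fourier_char (x \<bullet> y))"
  have [measurable]: "E \<in> borel_measurable borel" unfolding E_def by measurable
  have E1: "norm (E x) = 1" for x by (simp add: E_def)
  have E_add: "E (x + z) = E x * E z" for x z by (simp add: E_def exp_add[symmetric] inner_add_left algebra_simps)
  have int1: "integrable lborel (\<lambda>x. h (x - X w) * E x)" for w
  proof -
    have "integrable lborel (\<lambda>x. h (x - X w))"
      using integrable_lborel_translate[OF hi, of "- X w"] by simp
    then show ?thesis by (rule integrable_mult_bounded(1)[where B = 1]) (auto simp: E1)
  qed
  have n1: "(LINT x|lborel. norm (h (x - X w) * E x)) = (LINT x|lborel. norm (h x))" for w
  proof -
    have "(LINT x|lborel. complex_of_real (norm (h (x - X w)))) = (LINT x|lborel. complex_of_real (norm (h x)))"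
      using integral_lborel_translate[of "\<lambda>x. complex_of_real (norm (h x))" "- X w"] by simp
    then show ?thesis by (simp add: norm_mult E1)
  qed
  have int: "integrable (M \<Otimes>\<^sub>M lborel) (\<lambda>(w, x). h (x - X w) * E x)"
  proof (rule P.Fubini_integrable)
    show "(\<lambda>(w, x). h (x - X w) * E x) \<in> borel_measurable (M \<Otimes>\<^sub>M lborel)" by measurable
  qed (use int1 n1 in auto)
  have [measurable]: "average M X h \<in> borel_measurable borel"
    unfolding average_def[abs_def] by measurable
  have "fourier_L1 (average M X h) y = (LINT x|lborel. LINT w|M. h (x - X w) * E x)"
    unfolding fourier_L1_borel[OF \<open>average M X h \<in> borel_measurable borel\<close>] by (simp add: average_def E_def flip: integral_mult_left_zero)
  also have "\<dots> = (LINT w|M. LINT x|lborel. h (x - X w) * E x)"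
    using P.Fubini_integral[OF int] by simp
  also have "\<dots> = (LINT w|M. fourier_L1 h y * E (X w))"
  proof (rule Bochner_Integration.integral_cong[OF refl])
    fix w
    have "(LINT x|lborel. h (x - X w) * E x) = (LINT x|lborel. h x * E (x + X w))"
      using integral_lborel_translate[of "\<lambda>x. h (x - X w) * E x" "X w"] by simp
    also have "\<dots> = (LINT x|lborel. (h x * E x) * E (X w))" by (simp add: E_add mult_ac)
    also have "\<dots> = fourier_L1 h y * E (X w)" by (simp add: fourier_L1_borel E_def)
    finally show "(LINT x|lborel. h (x - X w) * E x) = fourier_L1 h y * E (X w)" .
  qed
  finally show ?thesis by (simp add: E_def)
qed

lemma support_average:
  assumes "\<And>x. norm x > d \<Longrightarrow> h x = 0"
  shows "support (average M X h) \<subseteq> cball 0 (d + R)"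
  unfolding support_def
proof (rule closure_minimal)
  show "{x. average M X h x \<noteq> 0} \<subseteq> cball 0 (d + R)"
  proof
    fix x assume "x \<in> {x. average M X h x \<noteq> 0}"
    then have "(LINT w|M. h (x - X w)) \<noteq> 0" by (simp add: average_def)
    have "\<not> (\<forall>w. h (x - X w) = 0)"
    proof
      assume "\<forall>w. h (x - X w) = 0"
      then have "(LINT w|M. h (x - X w)) = 0" by simp
      with \<open>(LINT w|M. h (x - X w)) \<noteq> 0\<close> show False by simp
    qed
    then obtain w where "h (x - X w) \<noteq> 0" by blast
    then have "norm (x - X w) \<le> d" using assms not_le by blast
    then show "x \<in> cball 0 (d + R)" using R[of w] norm_triangle_sub[of x "X w"] by simp
  qed
qed simp

end

section \<open>A random vector with rapidly decaying characteristic function\<close>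

lemma (in product_prob_space) integral_PiM_finite_prod:
  fixes g :: "'i \<Rightarrow> 'a \<Rightarrow> complex"
  assumes J: "finite J" "J \<subseteq> I" and g: "\<And>k. k \<in> J \<Longrightarrow> integrable (M k) (g k)"
  shows "(LINT w|PiM I M. (\<Prod>k\<in>J. g k (w k))) = (\<Prod>k\<in>J. LINT u|M k. g k u)"
proof -
  have meas: "(\<lambda>w. \<Prod>k\<in>J. g k (w k)) \<in> borel_measurable (PiM J M)"
    using g by (intro borel_measurable_prod measurable_compose[OF measurable_component_singleton borel_measurable_integrable])
  have "(LINT w|PiM I M. (\<Prod>k\<in>J. g k (w k))) = (LINT w|PiM I M. (\<Prod>k\<in>J. g k (restrict w J k)))"
    by (intro Bochner_Integration.integral_cong prod.cong) auto
  also have "\<dots> = (LINT w|distr (PiM I M) (PiM J M) (\<lambda>w. restrict w J). (\<Prod>k\<in>J. g k (w k)))"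
    by (rule integral_distr[symmetric, OF _ meas]) (rule measurable_restrict_subset[OF J(2)])
  also have "\<dots> = (LINT w|PiM J M. (\<Prod>k\<in>J. g k (w k)))"
    by (simp only: distr_PiM_restrict_finite[OF J])
  also have "\<dots> = (\<Prod>k\<in>J. LINT u|M k. g k u)"
    using J(1) g by (rule product_integral_prod)
  finally show ?thesis .
qed

text \<open>The identity on the support of \<open>uniform1\<close>; bounded everywhere, so that bounds for the random
  series below hold at every point and not only almost surely.\<close>
definition clamp1 :: "real \<Rightarrow> real" where "clamp1 u = max (- 1) (min 1 u)"

lemma measurable_clamp1 [measurable]: "clamp1 \<in> borel_measurable borel"
  unfolding clamp1_def by measurable

lemma abs_clamp1: "\<bar>clamp1 u\<bar> \<le> 1"
  by (auto simp: clamp1_def)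

abbreviation uniform1 :: "real measure" where "uniform1 \<equiv> uniform_measure lborel {-1..1}"

lemma prob_space_uniform1: "prob_space uniform1"
  by (rule prob_space_uniform_measure) auto

lemma integral_uniform1:
  fixes f :: "real \<Rightarrow> complex"
  assumes "f \<in> borel_measurable borel"
  shows "(LINT u|uniform1. f u) = (LINT u|lborel. indicator {-1..1} u *\<^sub>R f u) / 2"
proof -
  have "uniform1 = density lborel (\<lambda>u. ennreal (indicator {-1..1} u / 2))"
    unfolding uniform_measure_def
  proof (rule density_cong)
    show "AE u in lborel. indicator {-1..1::real} u / emeasure lborel {-1..1::real} = ennreal (indicator {-1..1} u / 2)"
    proof (rule AE_I2)
      fix u :: real
      have "emeasure lborel {-1..1::real} = ennreal 2" by simp
      then show "indicator {-1..1} u / emeasure lborel {-1..1::real} = ennreal (indicator {-1..1} u / 2)"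
        using divide_ennreal[of 1 2] by (cases "u \<in> {-1..1}") simp_all
    qed
  qed measurable
  then have "(LINT u|uniform1. f u) = (LINT u|lborel. (indicator {-1..1} u / 2) *\<^sub>R f u)"
    using assms by (simp only:) (rule integral_density, auto)
  also have "\<dots> = (LINT u|lborel. (indicator {-1..1} u *\<^sub>R f u) / 2)"
    by (simp add: scaleR_conv_of_real)
  finally show ?thesis by simp
qed

text \<open>The characteristic function of the uniform distribution on \<open>[-1, 1]\<close>, that is,
  \<open>sin (2 \<pi> \<theta>) / (2 \<pi> \<theta>)\<close>.\<close>
definition uniform_char :: "real \<Rightarrow> complex" where
  "uniform_char \<theta> = (LINT u|uniform1. fourier_char (\<theta> * clamp1 u))"

lemma integrable_uniform_char: "integrable uniform1 (\<lambda>u. fourier_char (\<theta> * clamp1 u))"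
proof -
  interpret prob_space uniform1 by (rule prob_space_uniform1)
  show ?thesis by (rule integrable_const_bound[where B = 1]) auto
qed

lemma norm_uniform_char_le_1: "norm (uniform_char \<theta>) \<le> 1"
proof -
  interpret prob_space uniform1 by (rule prob_space_uniform1)
  have "norm (uniform_char \<theta>) \<le> (LINT u|uniform1. norm (fourier_char (\<theta> * clamp1 u)))"
    unfolding uniform_char_def by (rule integral_norm_bound)
  then show ?thesis by (simp add: prob_space)
qed

lemma norm_uniform_char_le:
  assumes \<theta>: "\<bar>\<theta>\<bar> \<ge> 1" shows "norm (uniform_char \<theta>) \<le> exp (- 1)"
proof -
  define z where "z = - (2 * of_real pi * \<i> * of_real \<theta>)"
  have nz: "norm z = 2 * pi * \<bar>\<theta>\<bar>" by (simp add: z_def norm_mult)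
  have z0: "z \<noteq> 0" using \<theta> by (auto simp: z_def)
  have zu: "norm (exp (z * of_real u)) = 1" for u by (simp add: z_def norm_exp_eq_Re)
  have "uniform_char \<theta> = (LINT u|lborel. indicator {-1..1} u *\<^sub>R fourier_char (\<theta> * clamp1 u)) / 2"
    unfolding uniform_char_def by (rule integral_uniform1) measurable
  also have "(LINT u|lborel. indicator {-1..1} u *\<^sub>R fourier_char (\<theta> * clamp1 u)) =
     (LINT u|lborel. indicator {-1..1} u *\<^sub>R exp (z * of_real u))"
    by (intro Bochner_Integration.integral_cong) (auto simp: indicator_def clamp1_def z_def mult_ac)
  also have "\<dots> = exp (z * of_real 1) / z - exp (z * of_real (- 1)) / z"
  proof (rule integral_FTC_Icc)
    fix u :: real
    have "((\<lambda>w. exp (z * w) / z) has_field_derivative exp (z * of_real u)) (at (of_real u))"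
      using z0 by (auto intro!: derivative_eq_intros)
    from has_vector_derivative_real_field[OF this]
    show "((\<lambda>u. exp (z * of_real u) / z) has_vector_derivative exp (z * of_real u)) (at u within {-1..1})"
      by (rule has_vector_derivative_at_within)
  qed (auto intro!: continuous_intros)
  finally have "norm (uniform_char \<theta>) = norm (exp (z * of_real 1) - exp (z * of_real (- 1))) / norm z / 2"
    by (simp only: diff_divide_distrib[symmetric] norm_divide) simp
  also have "\<dots> \<le> 2 / norm z / 2"
    using norm_triangle_ineq4[of "exp (z * of_real 1)" "exp (z * of_real (- 1))"] zu[of 1] zu[of "- 1"]
    by (intro divide_right_mono) simp_all
  also have "\<dots> = 1 / norm z" by simp
  also have "\<dots> \<le> 1 / exp 1"
  proof (rule divide_left_mono)
    have "exp 1 \<le> (3::real)" by (rule exp_le)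
    also have "3 \<le> 2 * pi * 1" using pi_gt3 by simp
    also have "\<dots> \<le> 2 * pi * \<bar>\<theta>\<bar>" using \<theta> by (intro mult_left_mono) auto
    finally show "exp 1 \<le> norm z" using nz by simp
  qed (use z0 in auto)
  finally show ?thesis by (simp add: exp_minus inverse_eq_divide)
qed

text \<open>Ingham's infinite product as the characteristic function of a random series: \<open>m j\<close> independent copies
  of the uniform distribution on the cube of half-side \<open>\<rho> j\<close>, for each \<open>j\<close>.  The index \<open>(j, c, i)\<close> stands for scale,
  copy and coordinate.  If \<open>\<rho> J \<bar>y\<^sub>i\<bar> \<ge> 1\<close>, the \<open>m J\<close> factors with scale \<open>J\<close> and coordinate \<open>i\<close> are at
  most \<open>1/e\<close> each, and all other factors are at most \<open>1\<close>.\<close>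
lemma random_vector_with_decaying_transform:
  fixes m :: "nat \<Rightarrow> nat" and \<rho> :: "nat \<Rightarrow> real"
  assumes \<rho>: "\<And>j. \<rho> j \<ge> 0" and sum: "summable (\<lambda>j. real (m j) * \<rho> j)"
  obtains M :: "(nat \<times> nat \<times> 'n::finite \<Rightarrow> real) measure" and X :: "(nat \<times> nat \<times> 'n \<Rightarrow> real) \<Rightarrow> real^'n"
  where "prob_space M" "X \<in> borel_measurable M"
    "\<And>w. norm (X w) \<le> real CARD('n) * (\<Sum>j. real (m j) * \<rho> j)"
    "\<And>y J i. \<rho> J * \<bar>y $ i\<bar> \<ge> 1 \<Longrightarrow> norm (LINT w|M. fourier_char (X w \<bullet> y)) \<le> exp (- real (m J))"
proof -
  interpret product_prob_space "\<lambda>_. uniform1" "UNIV :: (nat \<times> nat \<times> 'n) set"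
    by (rule product_prob_spaceI) (rule prob_space_uniform1)
  define M where "M = PiM (UNIV :: (nat \<times> nat \<times> 'n) set) (\<lambda>_. uniform1)"
  have prob: "prob_space M" unfolding M_def by (rule prob_space_PiM) (rule prob_space_uniform1)
  define Y where "Y = (\<lambda>j (w :: nat \<times> nat \<times> 'n \<Rightarrow> real). \<rho> j *\<^sub>R (\<Sum>c<m j. \<Sum>i\<in>UNIV. clamp1 (w (j, c, i)) *\<^sub>R (axis i 1 :: real^'n)))"
  define X where "X = (\<lambda>w. \<Sum>j. Y j w)"
  have comp [measurable]: "(\<lambda>w. w k) \<in> borel_measurable M" for k
  proof -
    have "(\<lambda>w. w k) \<in> measurable M uniform1" unfolding M_def by (rule measurable_component_singleton) simp
    then show ?thesis using measurable_cong_sets[of M M uniform1 borel] by simp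
  qed
  have [measurable]: "Y j \<in> borel_measurable M" for j unfolding Y_def by measurable
  have Yn: "norm (Y j w) \<le> real CARD('n) * (real (m j) * \<rho> j)" for j w
  proof -
    have "norm (\<Sum>c<m j. \<Sum>i\<in>UNIV. clamp1 (w (j, c, i)) *\<^sub>R (axis i 1 :: real^'n)) \<le> (\<Sum>c<m j. \<Sum>i\<in>(UNIV::'n set). 1)"
      using abs_clamp1 by (intro order_trans[OF norm_sum] sum_mono) (auto intro!: order_trans[OF norm_sum] sum_mono simp: norm_axis_1)
    then have "\<rho> j * norm (\<Sum>c<m j. \<Sum>i\<in>UNIV. clamp1 (w (j, c, i)) *\<^sub>R (axis i 1 :: real^'n)) \<le> \<rho> j * (real (m j) * real CARD('n))"
      using \<rho> by (intro mult_left_mono) auto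
    then show ?thesis using \<rho>[of j] by (simp add: Y_def mult_ac)
  qed
  have sumY: "summable (\<lambda>j. norm (Y j w))" for w
    by (rule summable_comparison_test'[OF summable_mult[OF sum, of "real CARD('n)"], of 0]) (use Yn in auto)
  have X_lim: "(\<lambda>N. \<Sum>j<N. Y j w) \<longlonglongrightarrow> X w" for w
    unfolding X_def using summable_norm_cancel[OF sumY] by (rule summable_LIMSEQ)
  have [measurable]: "X \<in> borel_measurable M"
    by (rule borel_measurable_LIMSEQ_metric[OF _ X_lim]) measurable
  show ?thesis
  proof (rule that[OF prob])
    show "X \<in> borel_measurable M" by measurable
    show "norm (X w) \<le> real CARD('n) * (\<Sum>j. real (m j) * \<rho> j)" for w
    proof -
      have "norm (X w) \<le> (\<Sum>j. norm (Y j w))" unfolding X_def by (rule summable_norm[OF sumY])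
      also have "\<dots> \<le> (\<Sum>j. real CARD('n) * (real (m j) * \<rho> j))"
        by (rule suminf_le[OF Yn sumY summable_mult[OF sum]])
      finally show ?thesis by (simp add: suminf_mult[OF sum])
    qed
    fix y :: "real^'n" and J i assume J: "\<rho> J * \<bar>y $ i\<bar> \<ge> 1"
    define I where "I = (\<lambda>N. SIGMA j:{..<N}. {..<m j} \<times> (UNIV :: 'n set))"
    have fI: "finite (I N)" for N unfolding I_def by auto
    define \<theta> where "\<theta> = (\<lambda>(j, c::nat, i). \<rho> j * y $ i)"
    have inner: "(\<Sum>j<N. Y j w) \<bullet> y = (\<Sum>k\<in>I N. \<theta> k * clamp1 (w k))" for N w
    proof -
      have "(\<Sum>j<N. Y j w) \<bullet> y = (\<Sum>j<N. \<Sum>c<m j. \<Sum>i\<in>UNIV. \<theta> (j, c, i) * clamp1 (w (j, c, i)))"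
        by (simp add: Y_def \<theta>_def inner_sum_left sum_distrib_left inner_axis' mult_ac)
      also have "\<dots> = (\<Sum>j<N. \<Sum>k\<in>{..<m j} \<times> UNIV. \<theta> (j, k) * clamp1 (w (j, k)))"
        by (simp add: sum.cartesian_product case_prod_unfold)
      also have "\<dots> = (\<Sum>k\<in>I N. \<theta> k * clamp1 (w k))"
        unfolding I_def by (subst sum.Sigma) (auto simp: case_prod_unfold)
      finally show ?thesis .
    qed
    have E_N: "(LINT w|M. fourier_char ((\<Sum>j<N. Y j w) \<bullet> y)) = (\<Prod>k\<in>I N. uniform_char (\<theta> k))" for N
    proof -
      have "(LINT w|M. fourier_char ((\<Sum>j<N. Y j w) \<bullet> y)) =
        (LINT w|M. (\<Prod>k\<in>I N. fourier_char (\<theta> k * clamp1 (w k))))"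
        unfolding inner exp_sum[OF fI, symmetric] by (simp only: of_real_sum sum_distrib_left sum_negf)
      also have "\<dots> = (\<Prod>k\<in>I N. uniform_char (\<theta> k))"
        unfolding M_def uniform_char_def by (rule integral_PiM_finite_prod[OF fI subset_UNIV integrable_uniform_char])
      finally show ?thesis .
    qed
    have lim: "(\<lambda>N. LINT w|M. fourier_char ((\<Sum>j<N. Y j w) \<bullet> y)) \<longlonglongrightarrow> (LINT w|M. fourier_char (X w \<bullet> y))"
    proof (rule integral_dominated_convergence)
      show "integrable M (\<lambda>w. 1 :: real)" using prob prob_space.finite_measure finite_measure.integrable_const by blast
      show "AE w in M. (\<lambda>N. fourier_char ((\<Sum>j<N. Y j w) \<bullet> y)) \<longlonglongrightarrow> fourier_char (X w \<bullet> y)"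
        by (intro AE_I2 tendsto_intros X_lim)
      show "AE w in M. norm (fourier_char ((\<Sum>j<N. Y j w) \<bullet> y)) \<le> 1" for N
        by simp
    qed measurable
    have bnd: "norm (\<Prod>k\<in>I N. uniform_char (\<theta> k)) \<le> exp (- real (m J))" if "N > J" for N
    proof -
      define K where "K = {J} \<times> {..<m J} \<times> {i}"
      have K: "K \<subseteq> I N" using that by (auto simp: K_def I_def)
      have "norm (\<Prod>k\<in>I N. uniform_char (\<theta> k)) = (\<Prod>k\<in>I N - K. norm (uniform_char (\<theta> k))) * (\<Prod>k\<in>K. norm (uniform_char (\<theta> k)))"
        unfolding prod_norm[symmetric] by (rule prod.subset_diff[OF K fI])
      also have "\<dots> \<le> 1 * (\<Prod>k\<in>K. exp (- 1))"
      proof (intro mult_mono prod_le_1 prod_mono conjI)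
        show "norm (uniform_char (\<theta> k)) \<le> exp (- 1)" if "k \<in> K" for k
          using that J \<rho>[of J] by (intro norm_uniform_char_le) (auto simp: K_def \<theta>_def abs_mult)
      qed (auto simp: norm_uniform_char_le_1 intro: prod_nonneg)
      also have "\<dots> = exp (- real (m J))"
        by (simp add: K_def card_cartesian_product exp_of_nat_mult[symmetric])
      finally show ?thesis .
    qed
    have "(\<lambda>N. norm (LINT w|M. fourier_char ((\<Sum>j<N. Y j w) \<bullet> y))) \<longlonglongrightarrow> norm (LINT w|M. fourier_char (X w \<bullet> y))"
      by (intro tendsto_norm lim)
    then show "norm (LINT w|M. fourier_char (X w \<bullet> y)) \<le> exp (- real (m J))"
      unfolding E_N by (rule LIMSEQ_le_const2) (use bnd in \<open>auto intro!: exI[of _ "Suc J"]\<close>)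
  qed
qed

text \<open>On the annulus \<open>2\<^sup>j \<le> norm x < 2 ^ (j + 1)\<close>, of volume comparable to \<open>2 ^ (j n)\<close>, the integrand is at least
  \<open>\<psi>(2\<^sup>j) / (2 ^ (j + 2)) ^ (n + 1)\<close> by monotonicity; so the annulus contributes at least a constant times
  \<open>\<psi>(2\<^sup>j) / 2\<^sup>j\<close>.\<close>
lemma summable_dyadic_values:
  fixes \<psi> :: "real^'n \<Rightarrow> real" and e :: "real^'n"
  assumes nonneg: "\<And>x. 0 \<le> \<psi> x" and mono: "radially_nondecreasing \<psi>"
    and fin: "weighted_integral \<psi> < \<infinity>" and e: "norm e = 1"
  shows "summable (\<lambda>j. \<psi> (2 ^ j *\<^sub>R e) / 2 ^ j)"
proof -
  define n where "n = CARD('n)"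
  have n1: "n \<ge> 1" by (simp add: n_def Suc_leI)
  define c where "c = unit_ball_vol (real n)"
  have c0: "c > 0" by (simp add: c_def)
  define A where "A = (\<lambda>j::nat. ball (0::real^'n) (2 ^ Suc j) - ball 0 (2 ^ j))"
  have A [measurable]: "A j \<in> sets borel" for j by (simp add: A_def)
  have mem: "x \<in> A j \<longleftrightarrow> 2 ^ j \<le> norm x \<and> norm x < 2 ^ Suc j" for x j by (auto simp: A_def)
  have disj: "disjoint_family A"
    unfolding disjoint_family_on_def
  proof (intro ballI impI)
    have less: "A i \<inter> A j = {}" if "i < j" for i j
    proof -
      have "(2::real) ^ Suc i \<le> 2 ^ j" using that by (intro power_increasing) auto
      then show ?thesis by (fastforce simp: mem)
    qed
    show "A i \<inter> A j = {}" if "i \<noteq> j" for i j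
      using less[of i j] less[of j i] that by (cases "i < j") auto
  qed
  have Al [measurable]: "A j \<in> sets lebesgue" for j
    using A[of j] by (intro sets_completionI_sets) simp
  have emA: "emeasure lebesgue (A j) \<ge> ennreal (c * (2 ^ j) ^ n)" for j
  proof -
    have "emeasure lebesgue (A j) = emeasure lborel (A j)" using A[of j] by simp
    also have "\<dots> = emeasure lborel (ball (0::real^'n) (2 ^ Suc j)) - emeasure lborel (ball (0::real^'n) (2 ^ j))"
      unfolding A_def by (rule emeasure_Diff) (auto simp: emeasure_ball intro!: subset_ball)
    also have "\<dots> = ennreal (c * (2 ^ Suc j) ^ n - c * (2 ^ j) ^ n)"
      using c0 by (simp add: emeasure_ball c_def n_def ennreal_minus[symmetric])
    also have "\<dots> \<ge> ennreal (c * (2 ^ j) ^ n)"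
    proof (rule ennreal_leI)
      have "(2::real) * (2 ^ j) ^ n \<le> 2 ^ n * (2 ^ j) ^ n"
        using n1 self_le_power[of "2::real" n] by (intro mult_right_mono) auto
      also have "\<dots> = (2 ^ Suc j) ^ n" by (simp add: power_mult_distrib)
      finally have "c * (2 * (2 ^ j) ^ n) \<le> c * (2 ^ Suc j) ^ n" using c0 by (intro mult_left_mono) auto
      then show "c * (2 ^ j) ^ n \<le> c * (2 ^ Suc j) ^ n - c * (2 ^ j) ^ n" by simp
    qed
    finally show ?thesis .
  qed
  define a where "a = (\<lambda>j. \<psi> (2 ^ j *\<^sub>R e) / (2 ^ (j + 2)) ^ (n + 1))"
  have a0: "a j \<ge> 0" for j using nonneg by (simp add: a_def)
  have "(\<Sum>j. ennreal (a j * (c * (2 ^ j) ^ n))) \<le> (\<Sum>j. ennreal (a j) * emeasure lebesgue (A j))"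
    using a0 c0 emA by (intro suminf_le summableI) (auto simp: ennreal_mult intro: mult_left_mono)
  also have "\<dots> = (\<Sum>j. \<integral>\<^sup>+ x. ennreal (a j) * indicator (A j) x \<partial>lebesgue)"
    using A by (intro suminf_cong nn_integral_cmult_indicator[symmetric]) auto
  also have "\<dots> = (\<integral>\<^sup>+ x. (\<Sum>j. ennreal (a j) * indicator (A j) x) \<partial>lebesgue)"
    by (rule nn_integral_suminf[symmetric]) measurable
  also have "\<dots> \<le> weighted_integral \<psi>"
    unfolding weighted_integral_def
  proof (rule nn_integral_mono)
    fix x :: "real^'n"
    show "(\<Sum>j. ennreal (a j) * indicator (A j) x) \<le> ennreal (\<psi> x / (1 + norm x) ^ (CARD('n) + 1))"
    proof (cases "\<exists>j. x \<in> A j")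
      case True
      then obtain j where j: "x \<in> A j" by blast
      have "(\<Sum>j. ennreal (a j) * indicator (A j) x) = ennreal (a j)"
        by (rule suminf_cmult_indicator[OF disj j])
      also have "a j \<le> \<psi> x / (1 + norm x) ^ (n + 1)"
        unfolding a_def
      proof (rule frac_le)
        have x: "2 ^ j \<le> norm x" "norm x < 2 ^ Suc j" using j by (auto simp: mem)
        show "\<psi> (2 ^ j *\<^sub>R e) \<le> \<psi> x" using mono e x(1) by (auto simp: radially_nondecreasing_def)
        have "1 \<le> (2::real) ^ Suc j" by (rule one_le_power) simp
        then have "1 + norm x \<le> 2 ^ (j + 2)" using x(2) by simp
        then show "(1 + norm x) ^ (n + 1) \<le> (2 ^ (j + 2)) ^ (n + 1)" by (intro power_mono) auto
        show "0 < (1 + norm x) ^ (n + 1)" by (intro zero_less_power add_pos_nonneg) auto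
      qed (rule nonneg)
      then have "ennreal (a j) \<le> ennreal (\<psi> x / (1 + norm x) ^ (CARD('n) + 1))" by (intro ennreal_leI) (simp add: n_def)
      finally show ?thesis .
    next
      case False
      then show ?thesis by (simp add: indicator_def)
    qed
  qed
  finally have "(\<Sum>j. ennreal (a j * (c * (2 ^ j) ^ n))) < \<infinity>" using fin by (rule le_less_trans)
  then have "(\<Sum>j. ennreal (a j * (c * (2 ^ j) ^ n))) \<noteq> top" by auto
  then have "summable (\<lambda>j. a j * (c * (2 ^ j) ^ n))"
    using a0 c0 by (intro summable_suminf_not_top) auto
  then have "summable (\<lambda>j. (4 ^ (n + 1) / c) * (a j * (c * (2 ^ j) ^ n)))" by (rule summable_mult)
  also have "(\<lambda>j. (4 ^ (n + 1) / c) * (a j * (c * (2 ^ j) ^ n))) = (\<lambda>j. \<psi> (2 ^ j *\<^sub>R e) / 2 ^ j)"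
  proof
    fix j
    have "((2::real) ^ (j + 2)) ^ (n + 1) = 4 ^ (n + 1) * (2 ^ j) ^ n * 2 ^ j"
      by (simp add: power_add power_mult_distrib)
    then show "(4 ^ (n + 1) / c) * (a j * (c * (2 ^ j) ^ n)) = \<psi> (2 ^ j *\<^sub>R e) / 2 ^ j"
      using c0 by (simp add: a_def)
  qed
  finally show ?thesis .
qed

section \<open>A compactly supported function with prescribed decay\<close>

lemma flat_exp_1: "t > 0 \<Longrightarrow> flat_exp 1 t > 0" "0 \<le> flat_exp 1 t" "flat_exp 1 t \<le> 1" "t \<le> 0 \<Longrightarrow> flat_exp 1 t = 0"
  by (auto simp: flat_exp_def)

definition bump :: "real \<Rightarrow> real^'n \<Rightarrow> complex" where
  "bump d x = complex_of_real (flat_exp 1 (d\<^sup>2 - x \<bullet> x))"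

lemma C_k_bump: "C_k k (bump d)"
  using C_k_flat_exp[of k 1 "d\<^sup>2"] by (simp add: bump_def[abs_def])

lemma bump_eq_0: "d \<ge> 0 \<Longrightarrow> norm x > d \<Longrightarrow> bump d x = 0"
  using power_mono[of d "norm x" 2] by (simp add: bump_def power2_norm_eq_inner flat_exp_1)

lemma continuous_bump: "continuous_on UNIV (bump d)"
  using C_k_bump[of 0 d] by simp

lemma integrable_bump:
  assumes d: "d \<ge> 0" shows "integrable lborel (bump d :: real^'n \<Rightarrow> complex)"
proof (rule Bochner_Integration.integrable_bound)
  show "integrable lborel (indicator (cball 0 d) :: real^'n \<Rightarrow> real)"
    using emeasure_compact_finite[of "cball (0::real^'n) d"] by (intro integrable_real_indicator) auto
  show "AE x in lborel. norm (bump d x) \<le> norm (indicator (cball (0::real^'n) d) x :: real)"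
  proof (rule AE_I2)
    fix x :: "real^'n"
    show "norm (bump d x) \<le> norm (indicator (cball 0 d) x :: real)"
    proof (cases "norm x \<le> d")
      case True then show ?thesis by (simp add: bump_def flat_exp_1)
    qed (use bump_eq_0[OF d, of x] in simp)
  qed
  show "(bump d :: real^'n \<Rightarrow> complex) \<in> borel_measurable lborel"
    using borel_measurable_continuous_onI[OF continuous_bump] by simp
qed

lemma integral_bump_neq_0:
  assumes d: "d > 0" shows "(LINT x|lborel. bump d (x :: real^'n)) \<noteq> 0"
proof
  let ?r = "\<lambda>x::real^'n. flat_exp 1 (d\<^sup>2 - x \<bullet> x)"
  assume "(LINT x|lborel. bump d (x :: real^'n)) = 0"
  then have "(LINT x|lborel. ?r x) = 0" by (simp add: bump_def)
  moreover have "integrable lborel ?r"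
    using integrable_bump[of d, where 'n = 'n] d by (simp add: bump_def[abs_def] complex_of_real_integrable_eq)
  ultimately have "AE x in lborel. ?r x = 0"
    by (subst (asm) integral_nonneg_eq_0_iff_AE) (auto simp: flat_exp_1)
  then have "AE x in lborel. x \<notin> ball (0::real^'n) d"
  proof eventually_elim
    case (elim x)
    show ?case
    proof
      assume "x \<in> ball 0 d"
      then have "(norm x)\<^sup>2 < d\<^sup>2" by (intro power_strict_mono) auto
      then show False using elim flat_exp_1(1)[of "d\<^sup>2 - x \<bullet> x"] by (simp add: power2_norm_eq_inner)
    qed
  qed
  then have "ball (0::real^'n) d \<in> null_sets lborel" by (subst AE_iff_null_sets) auto
  then have "emeasure lborel (ball (0::real^'n) d) = 0" by auto
  then show False using d unit_ball_vol_pos[of "real CARD('n)"] by (simp add: emeasure_ball)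
qed

text \<open>The scales \<open>1 / 2\<^sup>j\<close>, \<open>j \<ge> j0\<close>, are used with multiplicity about \<open>\<psi>(2 ^ (j + s))\<close>.  The shift \<open>s\<close> pays for
  the comparison of \<open>norm y\<close> with its largest coordinate: if that coordinate lies between \<open>2\<^sup>J\<close> and
  \<open>2 ^ (J + 1)\<close>, then \<open>norm y \<le> 2 n 2\<^sup>J \<le> 2 ^ (J + s)\<close>.  Frequencies with \<open>norm y \<le> n 2 ^ j0\<close> only affect the constant.\<close>
theorem compactly_supported_with_decaying_transform:
  fixes \<psi> :: "real^'n \<Rightarrow> real"
  assumes nonneg: "\<And>x. 0 \<le> \<psi> x" and mono: "radially_nondecreasing \<psi>"
    and fin: "weighted_integral \<psi> < \<infinity>" and l: "l > 0"
  obtains f :: "real^'n \<Rightarrow> complex" and C where "C_c_infinity f" "\<exists>x. f x \<noteq> 0" "support f \<subseteq> ball 0 l"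
    "\<And>y. norm (fourier_L1 f y) \<le> C * exp (- \<psi> y)"
proof -
  define n where "n = CARD('n)"
  have n1: "n \<ge> 1" by (simp add: n_def Suc_leI)
  define e :: "real^'n" where "e = axis undefined 1"
  have e: "norm e = 1" by (simp add: e_def norm_axis_1)
  define \<Psi> where "\<Psi> = (\<lambda>r::real. \<psi> (r *\<^sub>R e))"
  have \<Psi>0: "\<Psi> r \<ge> 0" for r using nonneg by (simp add: \<Psi>_def)
  have \<Psi>: "\<psi> x \<le> \<Psi> r" if "norm x \<le> r" for x r
  proof -
    have "norm x \<le> norm (r *\<^sub>R e)" using that e by simp
    then show ?thesis using mono by (auto simp: radially_nondecreasing_def \<Psi>_def)
  qed
  define s where "s = n + 1"
  have s: "2 * real n \<le> 2 ^ s"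
    using of_nat_less_two_power[of n, where 'a = real] by (simp add: s_def)
  \<comment> \<open>The geometric term absorbs the rounding of the multiplicities to integers.\<close>
  define b where "b = (\<lambda>j. \<Psi> (2 ^ (j + s)) / 2 ^ j + (1 / 2) ^ j)"
  have b0: "b j \<ge> 0" for j using \<Psi>0 by (simp add: b_def)
  have "summable b"
  proof -
    have "summable (\<lambda>j. \<Psi> (2 ^ (j + s)) / 2 ^ (j + s))"
      using summable_dyadic_values[OF nonneg mono fin e] unfolding \<Psi>_def by (rule summable_ignore_initial_segment)
    then have "summable (\<lambda>j. 2 ^ s * (\<Psi> (2 ^ (j + s)) / 2 ^ (j + s)))" by (rule summable_mult)
    then have "summable (\<lambda>j. \<Psi> (2 ^ (j + s)) / 2 ^ j)" by (simp add: power_add)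
    then show ?thesis unfolding b_def by (intro summable_add summable_geometric) auto
  qed
  define \<epsilon> where "\<epsilon> = l / (4 * real n)"
  have \<epsilon>: "\<epsilon> > 0" using l n1 by (simp add: \<epsilon>_def)
  obtain j0 where j0: "norm (\<Sum>j. b (j + j0)) < \<epsilon>"
    using suminf_exist_split[OF \<epsilon> \<open>summable b\<close>] by blast
  define m where "m = (\<lambda>j. if j < j0 then 0 else nat \<lceil>\<Psi> (2 ^ (j + s))\<rceil>)"
  define \<rho> where "\<rho> = (\<lambda>j::nat. (1 / 2 :: real) ^ j)"
  have \<rho>0: "\<rho> j \<ge> 0" for j by (simp add: \<rho>_def)
  have mb: "real (m j) * \<rho> j \<le> b j" for j
  proof -
    have "real (m j) \<le> \<Psi> (2 ^ (j + s)) + 1" using \<Psi>0[of "2 ^ (j + s)"] by (simp add: m_def)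
    then have "real (m j) * \<rho> j \<le> (\<Psi> (2 ^ (j + s)) + 1) * \<rho> j" using \<rho>0 by (rule mult_right_mono)
    then show ?thesis by (simp add: b_def \<rho>_def power_one_over field_simps)
  qed
  have sum: "summable (\<lambda>j. real (m j) * \<rho> j)"
    by (rule summable_comparison_test'[OF \<open>summable b\<close>, of 0]) (use mb \<rho>0 in simp)
  have "(\<Sum>j. real (m j) * \<rho> j) = (\<Sum>j. real (m (j + j0)) * \<rho> (j + j0)) + (\<Sum>j<j0. real (m j) * \<rho> j)"
    by (rule suminf_split_initial_segment[OF sum])
  also have "(\<Sum>j<j0. real (m j) * \<rho> j) = 0" by (simp add: m_def)
  also have "(\<Sum>j. real (m (j + j0)) * \<rho> (j + j0)) \<le> (\<Sum>j. b (j + j0))"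
    using mb by (intro suminf_le summable_ignore_initial_segment sum \<open>summable b\<close>)
  also have "\<dots> < \<epsilon>" using j0 by simp
  finally have sum_le: "real n * (\<Sum>j. real (m j) * \<rho> j) \<le> l / 4"
    using n1 by (simp add: \<epsilon>_def field_simps)
  obtain M :: "(nat \<times> nat \<times> 'n \<Rightarrow> real) measure" and X :: "(nat \<times> nat \<times> 'n \<Rightarrow> real) \<Rightarrow> real^'n"
    where M: "prob_space M" and X: "X \<in> borel_measurable M"
      and Xb: "\<And>w. norm (X w) \<le> real CARD('n) * (\<Sum>j. real (m j) * \<rho> j)"
      and dec: "\<And>y J i. \<rho> J * \<bar>y $ i\<bar> \<ge> 1 \<Longrightarrow> norm (LINT w|M. fourier_char (X w \<bullet> y)) \<le> exp (- real (m J))"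
    using random_vector_with_decaying_transform[OF \<rho>0 sum] by blast
  interpret prob_space M by (rule M)
  have XR: "norm (X w) \<le> l / 4" for w using Xb[of w] sum_le by (simp add: n_def)
  define E where "E = (\<lambda>y. LINT w|M. fourier_char (X w \<bullet> y))"
  define A where "A = exp (\<Psi> (real n * 2 ^ j0))"
  have E1: "norm (E y) \<le> 1" for y
  proof -
    have "norm (E y) \<le> (LINT w|M. norm (fourier_char (X w \<bullet> y)))"
      unfolding E_def by (rule integral_norm_bound)
    then show ?thesis by (simp add: prob_space)
  qed
  have E_dec: "norm (E y) \<le> A * exp (- \<psi> y)" for y
  proof (cases "norm y \<le> real n * 2 ^ j0")
    case True
    then have "1 \<le> A * exp (- \<psi> y)" using \<Psi>[OF True] by (simp add: A_def exp_add[symmetric])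
    then show ?thesis using E1[of y] by simp
  next
    case False
    have "\<exists>i. norm y \<le> real n * \<bar>y $ i\<bar>"
    proof (rule ccontr)
      assume "\<nexists>i. norm y \<le> real n * \<bar>y $ i\<bar>"
      then have "(\<Sum>i\<in>(UNIV::'n set). real n * \<bar>y $ i\<bar>) < (\<Sum>i\<in>(UNIV::'n set). norm y)"
        by (intro sum_strict_mono) (auto simp: not_le)
      then have "real n * (\<Sum>i\<in>(UNIV::'n set). \<bar>y $ i\<bar>) < real n * norm y"
        by (simp add: sum_distrib_left n_def)
      then have "(\<Sum>i\<in>(UNIV::'n set). \<bar>y $ i\<bar>) < norm y" using n1 by simp
      then show False using norm_le_l1_cart[of y] by simp
    qed
    then obtain i where i: "norm y \<le> real n * \<bar>y $ i\<bar>" by blast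
    with False have "real n * 2 ^ j0 < real n * \<bar>y $ i\<bar>" by simp
    then have yi: "2 ^ j0 \<le> \<bar>y $ i\<bar>" using n1 by simp
    \<comment> \<open>The dyadic scale of a dominant coordinate of \<open>y\<close>.\<close>
    define J where "J = nat \<lfloor>log 2 \<bar>y $ i\<bar>\<rfloor>"
    have yi1: "1 \<le> \<bar>y $ i\<bar>" using yi one_le_power[of "2::real" j0] by linarith
    then have lg: "log 2 \<bar>y $ i\<bar> \<ge> 0" by simp
    have J1: "2 ^ J \<le> \<bar>y $ i\<bar>"
    proof -
      have "real J \<le> log 2 \<bar>y $ i\<bar>" using lg by (simp add: J_def)
      then show ?thesis using yi1 by (subst (asm) le_log_iff) (auto simp: powr_realpow)
    qed
    have J2: "\<bar>y $ i\<bar> \<le> 2 ^ Suc J"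
    proof -
      have "log 2 \<bar>y $ i\<bar> \<le> real (Suc J)" using lg by (simp add: J_def) linarith
      then have "\<bar>y $ i\<bar> \<le> 2 powr real (Suc J)" using yi1 by (subst (asm) log_le_iff) auto
      then show ?thesis by (simp only: powr_realpow[OF zero_less_numeral])
    qed
    have "j0 \<le> J"
    proof -
      have "log 2 (2 ^ j0) \<le> log 2 \<bar>y $ i\<bar>" using yi yi1 by (subst log_le_cancel_iff) auto
      then have "real j0 \<le> log 2 \<bar>y $ i\<bar>" by (simp add: log_nat_power)
      then show ?thesis by (simp add: J_def le_nat_iff le_floor_iff)
    qed
    have "norm y \<le> real n * 2 ^ Suc J" using i J2 by (meson mult_left_mono of_nat_0_le_iff order_trans)
    also have "\<dots> = 2 * real n * 2 ^ J" by simp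
    also have "\<dots> \<le> 2 ^ s * 2 ^ J" using s by (intro mult_right_mono) auto
    finally have "\<psi> y \<le> \<Psi> (2 ^ (J + s))" by (intro \<Psi>) (simp add: power_add mult.commute)
    also have "\<dots> \<le> real (m J)" using \<open>j0 \<le> J\<close> by (simp add: m_def) linarith
    finally have "exp (- real (m J)) \<le> exp (- \<psi> y)" by simp
    moreover have "norm (E y) \<le> exp (- real (m J))"
      unfolding E_def using J1 by (intro dec[of J y i]) (simp add: \<rho>_def power_one_over field_simps)
    moreover have "exp (- \<psi> y) \<le> A * exp (- \<psi> y)" using \<Psi>0 by (simp add: A_def)
    ultimately show ?thesis by linarith
  qed
  define h :: "real^'n \<Rightarrow> complex" where "h = bump (l / 4)"
  have hC: "C_k k h" for k unfolding h_def by (rule C_k_bump)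
  have hc: "continuous_on UNIV h" unfolding h_def by (rule continuous_bump)
  have hi: "integrable lborel h" unfolding h_def using l by (intro integrable_bump) simp
  have hm: "h \<in> borel_measurable borel" using hc by (rule borel_measurable_continuous_onI)
  define f where "f = average M X h"
  have Ff: "fourier_L1 f y = fourier_L1 h y * E y" for y
    unfolding f_def E_def by (rule fourier_average[OF M X XR hc hi])
  have sup: "support f \<subseteq> cball 0 (l / 4 + l / 4)"
    unfolding f_def using l by (intro support_average[OF M X XR]) (auto simp: h_def bump_eq_0)
  show ?thesis
  proof (rule that[of f "(LINT x|lborel. norm (h x)) * A"])
    have "compact (support f)"
      unfolding compact_eq_bounded_closed using sup bounded_subset[OF bounded_cball] by (auto simp: support_def)
    moreover have "C_k k f" for k unfolding f_def by (rule C_k_average[OF M X XR hC])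
    ultimately show "C_c_infinity f" by (simp add: C_c_infinity_def)
    show "support f \<subseteq> ball 0 l" using sup l by force
    show "\<exists>x. f x \<noteq> 0"
    proof (rule ccontr)
      assume "\<nexists>x. f x \<noteq> 0"
      then have "fourier_L1 f 0 = 0" by (simp add: fourier_L1_def)
      moreover have "E 0 = 1" by (simp add: E_def prob_space)
      ultimately have "fourier_L1 h 0 = 0" using Ff[of 0] by simp
      moreover have "fourier_L1 h 0 = (LINT x|lborel. h x)" using fourier_L1_borel[OF hm, of 0] by simp
      ultimately show False using integral_bump_neq_0[of "l / 4", where 'n = 'n] l by (simp add: h_def)
    qed
    show "norm (fourier_L1 f y) \<le> (LINT x|lborel. norm (h x)) * A * exp (- \<psi> y)" for y
      unfolding Ff norm_mult mult.assoc
      by (intro mult_mono norm_fourier_L1_le hm E_dec) auto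
  qed
qed

theorem theorem2p3:
  fixes \<psi> :: "real^'n \<Rightarrow> real"
  assumes nonneg: "\<And>x. 0 \<le> \<psi> x"
    and loc_int: "locally_integrable \<psi>"
    and rad: "radial \<psi>"
  shows
    "(\<forall>(f :: real^'n \<Rightarrow> complex) fhat \<eta> t.
        square_integrable f \<and> has_fourier_L2 f fhat \<and>
        (\<exists>C::real. AE y in lebesgue. norm (fhat y) \<le> C * exp (- \<psi> y)) \<and>
        \<eta> \<in> sphere 0 1 \<and> ess_support f \<subseteq> {x. x \<bullet> \<eta> \<le> t} \<and>
        weighted_integral \<psi> = \<infinity>
        \<longrightarrow> (AE x in lebesgue. f x = 0))
   \<and> (weighted_integral \<psi> < \<infinity> \<and> radially_nondecreasing \<psi> \<longrightarrow>
        (\<forall>l::real. l > 0 \<longrightarrow>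
          (\<exists>f :: real^'n \<Rightarrow> complex.
             C_c_infinity f \<and> (\<exists>x. f x \<noteq> 0) \<and> support f \<subseteq> ball 0 l \<and>
             (\<exists>C::real. AE y in lebesgue. norm (fourier_L1 f y) \<le> C * exp (- \<psi> y)))))"
proof (intro conjI allI impI)
  fix f fhat :: "real^'n \<Rightarrow> complex" and \<eta> :: "real^'n" and t :: real
  assume a: "square_integrable f \<and> has_fourier_L2 f fhat \<and>
        (\<exists>C::real. AE y in lebesgue. norm (fhat y) \<le> C * exp (- \<psi> y)) \<and>
        \<eta> \<in> sphere 0 1 \<and> ess_support f \<subseteq> {x. x \<bullet> \<eta> \<le> t} \<and>
        weighted_integral \<psi> = \<infinity>"
  then obtain C where "AE y in lebesgue. norm (fhat y) \<le> C * exp (- \<psi> y)" by blast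
  with a show "AE x in lebesgue. f x = 0"
    by (intro half_space_uniqueness[OF nonneg loc_int rad]) auto
next
  fix l :: real
  assume a: "weighted_integral \<psi> < \<infinity> \<and> radially_nondecreasing \<psi>" and l: "l > 0"
  obtain f :: "real^'n \<Rightarrow> complex" and C where f: "C_c_infinity f" "\<exists>x. f x \<noteq> 0" "support f \<subseteq> ball 0 l"
    "\<And>y. norm (fourier_L1 f y) \<le> C * exp (- \<psi> y)"
    using compactly_supported_with_decaying_transform[of \<psi> l] nonneg a l by blast
  then show "\<exists>f :: real^'n \<Rightarrow> complex. C_c_infinity f \<and> (\<exists>x. f x \<noteq> 0) \<and> support f \<subseteq> ball 0 l \<and>
             (\<exists>C::real. AE y in lebesgue. norm (fourier_L1 f y) \<le> C * exp (- \<psi> y))"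
    by (intro exI[of _ f] conjI exI[of _ C] AE_I2) auto
qed

end
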